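(* Let $(M,g,f,\lambda)$ be a four-dimensional oriented gradient Ricci soliton. Then $$\Delta_f|\mathrm W^+|^2=2|\nabla \mathrm W^+|^2+4\lambda|\mathrm W^+|^2-36\det \mathrm W^+-\langle \mathrm{Rc}\circ \mathrm{Rc},\mathrm W^+\rangle$$ and $$\Delta_f|\mathrm W^+|^2=2|\nabla \mathrm W^+|^2+4\lambda|\mathrm W^+|^2-36\det \mathrm W^+-\langle \mathrm{Hess} f\circ \mathrm{Hess} f,\mathrm W^+\rangle .$$
   Context: A gradient Ricci soliton (GRS) $(M,g,f,\lambda)$ is a Riemannian manifold $(M,g)$ with a smooth function $f$ and a constant $\lambda\in\mathbb R$ such that $\mathrm{Rc}+\mathrm{Hess} f=\lambda g$, where $\mathrm{Rc}$ is the Ricci tensor. The modified Laplacian is $\Delta_f=\Delta-\nabla_{\nabla f}$. The curvature sign convention is that $R_{ijij}$ is the sectional curvature of the plane spanned by orthonormal $e_i,e_j$. $\mathrm W$ is the Weyl tensor (with all indices lowered), viewed also as a symmetric operator/bilinear form on $\Lambda_2(TM)$ by $\mathrm W(e_i\wedge e_j,e_k\wedge e_l)=\mathrm W_{ijkl}$. In dimension four, the Hodge star splits $\Lambda_2=\Lambda_2^+\oplus\Lambda_2^-$ orthogonally into $\pm1$ eigenspaces, $\mathrm W$ preserves each, and $\mathrm W^{+}(\alpha,\beta)=\mathrm W(\alpha^+,\beta^+)$, with $\alpha^+$ the projection of $\alpha$ on $\Lambda_2^+$; $\det \mathrm W^+$ is the determinant of $\mathrm W^+$ as an endomorphism of the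 3-dimensional space $\Lambda_2^+$ (in which $e_i\wedge e_j$, $i<j$, are unit vectors of $\Lambda_2$). For symmetric $(2,0)$-tensors $A,B$ the Kulkarni–Nomizu product is $(A\circ B)_{ijkl}=A_{ik}B_{jl}+A_{jl}B_{ik}-A_{il}B_{jk}-A_{jk}B_{il}$. Norms and inner products of curvature-type tensors are, in an orthonormal frame, $\langle T,U\rangle=\sum_{i<j;\,k<l}T_{ijkl}U_{ijkl}$ (so $|\mathrm W^+|^2$ is the sum of squared eigenvalues of $\mathrm W^+$), and $|\nabla \mathrm W^+|^2=\sum_i\sum_{a<b;\,c<d}(\nabla_i \mathrm W^+_{abcd})^2$. *)

theory Defs
  imports "HOL-Analysis.Analysis"
begin

section \<open>Smooth functions on open subsets of Euclidean space\<close>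

definition pd :: "'n::finite \<Rightarrow> (real^'n \<Rightarrow> 'b::real_normed_vector) \<Rightarrow> real^'n \<Rightarrow> 'b" where
  "pd i h x = frechet_derivative h (at x) (axis i 1)"

primrec Ck_on :: "nat \<Rightarrow> (real^'n::finite) set \<Rightarrow> (real^'n \<Rightarrow> 'b::real_normed_vector) \<Rightarrow> bool" where
  "Ck_on 0 S h \<longleftrightarrow> continuous_on S h"
| "Ck_on (Suc k) S h \<longleftrightarrow> (\<forall>x\<in>S. h differentiable (at x)) \<and> (\<forall>i. Ck_on k S (pd i h))"

text \<open>Intended for open \<open>S\<close>, since the derivatives are taken at interior points.\<close>

definition smooth_on :: "(real^'n::finite) set \<Rightarrow> (real^'n \<Rightarrow> 'b::real_normed_vector) \<Rightarrow> bool" where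
  "smooth_on S h \<longleftrightarrow> (\<forall>k. Ck_on k S h)"

section \<open>Oriented smooth four-manifolds\<close>

text \<open>
  The manifold is the whole (Hausdorff, second countable) type \<open>'m\<close>. An orientation is given by
  an atlas all of whose transition maps have positive Jacobian determinant; all its charts
  are declared to be positively oriented.
\<close>

record 'm chart =
  chart_dom :: "'m set"
  chart_map :: "'m \<Rightarrow> real^4"

definition chart_inv :: "'m chart \<Rightarrow> real^4 \<Rightarrow> 'm" where
  "chart_inv c = inv_into (chart_dom c) (chart_map c)"

definition chart_image :: "'m chart \<Rightarrow> (real^4) set" where
  "chart_image c = chart_map c ` chart_dom c"

definition is_chart :: "'m::topological_space chart \<Rightarrow> bool" where
  "is_chart c \<longleftrightarrow> open (chart_dom c) \<and> open (chart_image c) \<and>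
     homeomorphism (chart_dom c) (chart_image c) (chart_map c) (chart_inv c)"

definition transition :: "'m chart \<Rightarrow> 'm chart \<Rightarrow> real^4 \<Rightarrow> real^4" where
  "transition c c' = chart_map c' \<circ> chart_inv c"

definition overlap :: "'m chart \<Rightarrow> 'm chart \<Rightarrow> (real^4) set" where
  "overlap c c' = chart_map c ` (chart_dom c \<inter> chart_dom c')"

definition jacobian_matrix :: "(real^4 \<Rightarrow> real^4) \<Rightarrow> real^4 \<Rightarrow> real^4^4" where
  "jacobian_matrix h x = matrix (frechet_derivative h (at x))"

definition oriented_atlas :: "'m::{t2_space,second_countable_topology} chart set \<Rightarrow> bool" where
  "oriented_atlas \<A> \<longleftrightarrow>
     (\<Union>c\<in>\<A>. chart_dom c) = UNIV \<and> (\<forall>c\<in>\<A>. is_chart c) \<and>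
     (\<forall>c\<in>\<A>. \<forall>c'\<in>\<A>. smooth_on (overlap c c') (transition c c') \<and>
        (\<forall>x\<in>overlap c c'. det (jacobian_matrix (transition c c') x) > 0))"

definition smooth_function :: "'m chart set \<Rightarrow> ('m \<Rightarrow> real) \<Rightarrow> bool" where
  "smooth_function \<A> u \<longleftrightarrow> (\<forall>c\<in>\<A>. smooth_on (chart_image c) (u \<circ> chart_inv c))"

text \<open>
  A symmetric 2-tensor field is given by its component matrices in every chart, which are
  related by the tensor transformation law; \<open>g c x\<close> is the matrix of components in the chart \<open>c\<close>
  at the point with coordinates \<open>x\<close>.
\<close>

definition riemannian_metric :: "'m chart set \<Rightarrow> ('m chart \<Rightarrow> real^4 \<Rightarrow> real^4^4) \<Rightarrow> bool" where
  "riemannian_metric \<A> g \<longleftrightarrow>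
     (\<forall>c\<in>\<A>. smooth_on (chart_image c) (g c) \<and>
        (\<forall>x\<in>chart_image c. transpose (g c x) = g c x \<and> (\<forall>v. v \<noteq> 0 \<longrightarrow> v \<bullet> (g c x *v v) > 0))) \<and>
     (\<forall>c\<in>\<A>. \<forall>c'\<in>\<A>. \<forall>x\<in>overlap c c'.
        g c x = transpose (jacobian_matrix (transition c c') x) ** g c' (transition c c' x)
                  ** jacobian_matrix (transition c c') x)"

section \<open>Levi-Civita connection and curvature in a coordinate chart\<close>

text \<open>
  From here on \<open>G\<close> is the matrix-valued function of the metric components \<open>g\<^sub>i\<^sub>j\<close> in a chart.
  All tensors are given by their coordinate components.
\<close>

type_synonym tensor4 = "4 \<Rightarrow> 4 \<Rightarrow> 4 \<Rightarrow> 4 \<Rightarrow> real"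

definition ginv :: "(real^4 \<Rightarrow> real^4^4) \<Rightarrow> real^4 \<Rightarrow> real^4^4" where
  "ginv G x = matrix_inv (G x)"

text \<open>\<open>christoffel G k i j\<close> is \<open>\<Gamma>\<^sup>k\<^sub>i\<^sub>j\<close>.\<close>

definition christoffel :: "(real^4 \<Rightarrow> real^4^4) \<Rightarrow> 4 \<Rightarrow> 4 \<Rightarrow> 4 \<Rightarrow> real^4 \<Rightarrow> real" where
  "christoffel G k i j x = (\<Sum>l\<in>UNIV. ginv G x $ k $ l / 2 *
     (pd i (\<lambda>y. G y $ j $ l) x + pd j (\<lambda>y. G y $ i $ l) x - pd l (\<lambda>y. G y $ i $ j) x))"

text \<open>
  \<open>curv_op G m l i j\<close> is the \<open>m\<close>-th component of
  \<open>R(\<partial>\<^sub>i,\<partial>\<^sub>j)\<partial>\<^sub>l = \<nabla>\<^sub>i\<nabla>\<^sub>j\<partial>\<^sub>l - \<nabla>\<^sub>j\<nabla>\<^sub>i\<partial>\<^sub>l\<close>. Lowering it as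
  \<open>R\<^sub>i\<^sub>j\<^sub>k\<^sub>l = g(R(\<partial>\<^sub>i,\<partial>\<^sub>j)\<partial>\<^sub>l, \<partial>\<^sub>k)\<close> makes \<open>R\<^sub>i\<^sub>j\<^sub>i\<^sub>j\<close> the sectional curvature
  in an orthonormal frame.
\<close>

definition curv_op :: "(real^4 \<Rightarrow> real^4^4) \<Rightarrow> 4 \<Rightarrow> 4 \<Rightarrow> 4 \<Rightarrow> 4 \<Rightarrow> real^4 \<Rightarrow> real" where
  "curv_op G m l i j x =
     pd i (christoffel G m j l) x - pd j (christoffel G m i l) x
     + (\<Sum>p\<in>UNIV. christoffel G m i p x * christoffel G p j l x
                 - christoffel G m j p x * christoffel G p i l x)"

definition riem :: "(real^4 \<Rightarrow> real^4^4) \<Rightarrow> real^4 \<Rightarrow> tensor4" where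
  "riem G x i j k l = (\<Sum>m\<in>UNIV. G x $ k $ m * curv_op G m l i j x)"

definition ricci :: "(real^4 \<Rightarrow> real^4^4) \<Rightarrow> real^4 \<Rightarrow> real^4^4" where
  "ricci G x = (\<chi> i k. \<Sum>j\<in>UNIV. \<Sum>l\<in>UNIV. ginv G x $ j $ l * riem G x i j k l)"

definition gtrace :: "(real^4 \<Rightarrow> real^4^4) \<Rightarrow> real^4 \<Rightarrow> real^4^4 \<Rightarrow> real" where
  "gtrace G x A = (\<Sum>i\<in>UNIV. \<Sum>j\<in>UNIV. ginv G x $ i $ j * A $ i $ j)"

definition scal :: "(real^4 \<Rightarrow> real^4^4) \<Rightarrow> real^4 \<Rightarrow> real" where
  "scal G x = gtrace G x (ricci G x)"

definition kulkarni_nomizu :: "real^4^4 \<Rightarrow> real^4^4 \<Rightarrow> tensor4" where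
  "kulkarni_nomizu A B i j k l =
     A $ i $ k * B $ j $ l + A $ j $ l * B $ i $ k - A $ i $ l * B $ j $ k - A $ j $ k * B $ i $ l"

text \<open>
  In dimension \<open>n\<close> the Weyl tensor is
  \<open>W = R - Rc \<circ> g / (n - 2) + S (g \<circ> g) / (2 (n - 1) (n - 2))\<close>.
\<close>

definition weyl :: "(real^4 \<Rightarrow> real^4^4) \<Rightarrow> real^4 \<Rightarrow> tensor4" where
  "weyl G x i j k l = riem G x i j k l
     - kulkarni_nomizu (ricci G x) (G x) i j k l / 2
     + scal G x * kulkarni_nomizu (G x) (G x) i j k l / 12"

definition hess :: "(real^4 \<Rightarrow> real^4^4) \<Rightarrow> (real^4 \<Rightarrow> real) \<Rightarrow> real^4 \<Rightarrow> real^4^4" where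
  "hess G u x = (\<chi> i j. pd i (pd j u) x - (\<Sum>k\<in>UNIV. christoffel G k i j x * pd k u x))"

definition laplacian :: "(real^4 \<Rightarrow> real^4^4) \<Rightarrow> (real^4 \<Rightarrow> real) \<Rightarrow> real^4 \<Rightarrow> real" where
  "laplacian G u x = gtrace G x (hess G u x)"

definition gradient :: "(real^4 \<Rightarrow> real^4^4) \<Rightarrow> (real^4 \<Rightarrow> real) \<Rightarrow> real^4 \<Rightarrow> real^4" where
  "gradient G u x = (\<chi> i. \<Sum>j\<in>UNIV. ginv G x $ i $ j * pd j u x)"

text \<open>\<open>mod_laplacian G F u\<close> is \<open>\<Delta>\<^sub>F u = \<Delta> u - \<nabla>\<^bsub>\<nabla>F\<^esub> u\<close>.\<close>

definition mod_laplacian ::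
    "(real^4 \<Rightarrow> real^4^4) \<Rightarrow> (real^4 \<Rightarrow> real) \<Rightarrow> (real^4 \<Rightarrow> real) \<Rightarrow> real^4 \<Rightarrow> real" where
  "mod_laplacian G F u x = laplacian G u x - (\<Sum>i\<in>UNIV. gradient G F x $ i * pd i u x)"

text \<open>\<open>cov_deriv4 G T x i\<close> is the 4-tensor \<open>\<nabla>\<^sub>i T\<close> at \<open>x\<close>.\<close>

definition cov_deriv4 :: "(real^4 \<Rightarrow> real^4^4) \<Rightarrow> (real^4 \<Rightarrow> tensor4) \<Rightarrow> real^4 \<Rightarrow> 4 \<Rightarrow> tensor4" where
  "cov_deriv4 G T x i a b c d = pd i (\<lambda>y. T y a b c d) x
     - (\<Sum>p\<in>UNIV. christoffel G p i a x * T x p b c d + christoffel G p i b x * T x a p c d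
                 + christoffel G p i c x * T x a b p d + christoffel G p i d x * T x a b c p)"

section \<open>Bivectors, Hodge star and the self-dual Weyl tensor\<close>

text \<open>
  Elements of \<open>\<Lambda>\<^sub>2\<close> are represented by antisymmetric matrices of contravariant components;
  \<open>v \<and> w\<close> has the components \<open>v\<^sup>iw\<^sup>j - v\<^sup>jw\<^sup>i\<close>.
\<close>

definition wedge :: "real^4 \<Rightarrow> real^4 \<Rightarrow> real^4^4" where
  "wedge v w = (\<chi> i j. v $ i * w $ j - v $ j * w $ i)"

definition bivectors :: "(real^4^4) set" where
  "bivectors = {\<alpha>. transpose \<alpha> = - \<alpha>}"

text \<open>
  Components of the Riemannian volume form of the standard orientation of coordinate space
  (the index \<open>4 :: 4\<close> equals \<open>0\<close>; \<open>vector\<close> lists the rows \<open>1, 2, 3, 4\<close> in this order).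
\<close>

definition vol_form :: "(real^4 \<Rightarrow> real^4^4) \<Rightarrow> real^4 \<Rightarrow> tensor4" where
  "vol_form G x i j k l =
     sqrt (det (G x)) * det (vector [axis i 1, axis j 1, axis k 1, axis l 1] :: real^4^4)"

text \<open>
  \<open>(\<star>\<alpha>)\<^sup>k\<^sup>l = (1/2) \<alpha>\<^sup>i\<^sup>j vol\<^sub>i\<^sub>j\<^sub>p\<^sub>q g\<^sup>p\<^sup>k g\<^sup>q\<^sup>l\<close>; the factor \<open>1/2\<close> makes \<open>\<star>(e\<^sub>1 \<and> e\<^sub>2) = e\<^sub>3 \<and> e\<^sub>4\<close>
  for every positively oriented orthonormal frame.
\<close>

definition hodge :: "(real^4 \<Rightarrow> real^4^4) \<Rightarrow> real^4 \<Rightarrow> real^4^4 \<Rightarrow> real^4^4" where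
  "hodge G x \<alpha> = (\<chi> k l. (\<Sum>i\<in>UNIV. \<Sum>j\<in>UNIV. \<Sum>p\<in>UNIV. \<Sum>q\<in>UNIV.
     \<alpha> $ i $ j * vol_form G x i j p q * ginv G x $ p $ k * ginv G x $ q $ l) / 2)"

definition self_dual_bivectors :: "(real^4 \<Rightarrow> real^4^4) \<Rightarrow> real^4 \<Rightarrow> (real^4^4) set" where
  "self_dual_bivectors G x = {\<alpha> \<in> bivectors. hodge G x \<alpha> = \<alpha>}"

text \<open>The projection onto the \<open>+1\<close> eigenspace of \<open>\<star>\<close> along the \<open>-1\<close> eigenspace.\<close>

definition self_dual_part :: "(real^4 \<Rightarrow> real^4^4) \<Rightarrow> real^4 \<Rightarrow> real^4^4 \<Rightarrow> real^4^4" where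
  "self_dual_part G x \<alpha> = (1/2) *\<^sub>R (\<alpha> + hodge G x \<alpha>)"

text \<open>
  The bilinear form on \<open>\<Lambda>\<^sub>2\<close> with \<open>T(\<partial>\<^sub>i \<and> \<partial>\<^sub>j, \<partial>\<^sub>k \<and> \<partial>\<^sub>l) = T\<^sub>i\<^sub>j\<^sub>k\<^sub>l\<close>. Every pair of indices is counted twice
  in the full sum, whence the factor \<open>1/4\<close>.
\<close>

definition bivector_form :: "tensor4 \<Rightarrow> real^4^4 \<Rightarrow> real^4^4 \<Rightarrow> real" where
  "bivector_form T \<alpha> \<beta> =
     (\<Sum>i\<in>UNIV. \<Sum>j\<in>UNIV. \<Sum>k\<in>UNIV. \<Sum>l\<in>UNIV. T i j k l * \<alpha> $ i $ j * \<beta> $ k $ l) / 4"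

definition weyl_plus :: "(real^4 \<Rightarrow> real^4^4) \<Rightarrow> real^4 \<Rightarrow> tensor4" where
  "weyl_plus G x i j k l = bivector_form (weyl G x)
     (self_dual_part G x (wedge (axis i 1) (axis j 1)))
     (self_dual_part G x (wedge (axis k 1) (axis l 1)))"

text \<open>
  The endomorphism of \<open>\<Lambda>\<^sub>2\<close> associated with a curvature-type tensor by the inner product on \<open>\<Lambda>\<^sub>2\<close>
  for which \<open>e\<^sub>i \<and> e\<^sub>j\<close> (\<open>i < j\<close>) is an orthonormal basis whenever \<open>(e\<^sub>i)\<close> is an orthonormal frame.
\<close>

definition bivector_endo ::
    "(real^4 \<Rightarrow> real^4^4) \<Rightarrow> real^4 \<Rightarrow> tensor4 \<Rightarrow> real^4^4 \<Rightarrow> real^4^4" where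
  "bivector_endo G x T \<alpha> = (\<chi> i j. (\<Sum>p\<in>UNIV. \<Sum>q\<in>UNIV. \<Sum>k\<in>UNIV. \<Sum>l\<in>UNIV.
     ginv G x $ i $ p * ginv G x $ j $ q * T p q k l * \<alpha> $ k $ l) / 2)"

text \<open>
  The determinant of an endomorphism \<open>L\<close> of a 3-dimensional space \<open>V\<close>: the common determinant of
  its matrices with respect to all bases of \<open>V\<close>.
\<close>

definition endo_det3 :: "'a::real_vector set \<Rightarrow> ('a \<Rightarrow> 'a) \<Rightarrow> real" where
  "endo_det3 V L = (THE d. \<forall>(b :: 3 \<Rightarrow> 'a) (A :: real^3^3).
     inj b \<and> independent (range b) \<and> span (range b) = V \<and>
     (\<forall>j. L (b j) = (\<Sum>i\<in>UNIV. A $ i $ j *\<^sub>R b i)) \<longrightarrow> d = det A)"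

definition det_weyl_plus :: "(real^4 \<Rightarrow> real^4^4) \<Rightarrow> real^4 \<Rightarrow> real" where
  "det_weyl_plus G x = endo_det3 (self_dual_bivectors G x) (bivector_endo G x (weyl_plus G x))"

section \<open>Norms in an orthonormal frame\<close>

definition orthonormal_frame :: "(real^4 \<Rightarrow> real^4^4) \<Rightarrow> real^4 \<Rightarrow> (4 \<Rightarrow> real^4) \<Rightarrow> bool" where
  "orthonormal_frame G x e \<longleftrightarrow> (\<forall>i j. e i \<bullet> (G x *v e j) = (if i = j then 1 else 0))"

text \<open>The sums below do not depend on the orthonormal frame, so that any choice will do.\<close>

definition frame :: "(real^4 \<Rightarrow> real^4^4) \<Rightarrow> real^4 \<Rightarrow> 4 \<Rightarrow> real^4" where
  "frame G x = (SOME e. orthonormal_frame G x e)"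

definition in_frame :: "(4 \<Rightarrow> real^4) \<Rightarrow> tensor4 \<Rightarrow> tensor4" where
  "in_frame e T i j k l = (\<Sum>a\<in>UNIV. \<Sum>b\<in>UNIV. \<Sum>c\<in>UNIV. \<Sum>d\<in>UNIV.
     T a b c d * e i $ a * e j $ b * e k $ c * e l $ d)"

definition curv_inner :: "(real^4 \<Rightarrow> real^4^4) \<Rightarrow> real^4 \<Rightarrow> tensor4 \<Rightarrow> tensor4 \<Rightarrow> real" where
  "curv_inner G x T U = (\<Sum>(i,j)\<in>{(i,j). i < j}. \<Sum>(k,l)\<in>{(k,l). k < l}.
     in_frame (frame G x) T i j k l * in_frame (frame G x) U i j k l)"

definition weyl_plus_normsq :: "(real^4 \<Rightarrow> real^4^4) \<Rightarrow> real^4 \<Rightarrow> real" where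
  "weyl_plus_normsq G x = curv_inner G x (weyl_plus G x) (weyl_plus G x)"

definition grad_weyl_plus_normsq :: "(real^4 \<Rightarrow> real^4^4) \<Rightarrow> real^4 \<Rightarrow> real" where
  "grad_weyl_plus_normsq G x = (\<Sum>i\<in>UNIV. \<Sum>(a,b)\<in>{(a,b). a < b}. \<Sum>(c,d)\<in>{(c,d). c < d}.
     (in_frame (frame G x)
        (\<lambda>a b c d. \<Sum>m\<in>UNIV. frame G x i $ m * cov_deriv4 G (weyl_plus G) x m a b c d)
        a b c d)\<^sup>2)"

section \<open>Gradient Ricci solitons\<close>

definition gradient_ricci_soliton ::
    "'m chart set \<Rightarrow> ('m chart \<Rightarrow> real^4 \<Rightarrow> real^4^4) \<Rightarrow> ('m \<Rightarrow> real) \<Rightarrow> real \<Rightarrow> bool" where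
  "gradient_ricci_soliton \<A> g f lam \<longleftrightarrow> riemannian_metric \<A> g \<and> smooth_function \<A> f \<and>
     (\<forall>c\<in>\<A>. \<forall>x\<in>chart_image c. ricci (g c) x + hess (g c) (f \<circ> chart_inv c) x = lam *\<^sub>R g c x)"

end

theory Submission
  imports Defs
begin

text \<open>
  The formula arises by pairing an elliptic equation for the whole curvature tensor with \<open>W\<^sup>+\<close>.

  The second Bianchi identity and the commutation of covariant derivatives express \<open>\<Delta> R\<close> by the
  derivative of the divergence of \<open>R\<close> and by terms that are quadratic in \<open>R\<close>. The divergence of \<open>R\<close> is the
  antisymmetrised derivative of \<open>Rc = \<lambda> g - Hess f\<close>, hence a commutator of derivatives of \<open>\<nabla>f\<close>, hence
  the contraction of \<open>R\<close> with \<open>\<nabla>f\<close>. When this is differentiated, one part is the derivative of \<open>R\<close> in the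
  direction of \<open>\<nabla>f\<close>, and the part with \<open>Hess f\<close> combines with the Ricci terms of the commutators to
  \<open>2 \<lambda> R\<close>. The result, lemma \<open>laplacian_curvature\<close>, is \<open>\<Delta>\<^sub>f R = 2 \<lambda> R + Q(R)\<close> with \<open>Q\<close> quadratic.

  The map that takes \<open>R\<close> to \<open>W\<^sup>+\<close> is an orthogonal projection that commutes with covariant
  derivatives. Therefore
  \<open>\<Delta>\<^sub>f |W\<^sup>+|\<^sup>2 = 2 |\<nabla>W\<^sup>+|\<^sup>2 + 2 \<langle>W\<^sup>+, \<Delta>\<^sub>f R\<rangle> = 2 |\<nabla>W\<^sup>+|\<^sup>2 + 4 \<lambda> |W\<^sup>+|\<^sup>2 + 2 \<langle>W\<^sup>+, Q(R)\<rangle>\<close>,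
  and the last term is a matter of algebra at one point. Let \<open>w\<close> be the \<open>3 \<times> 3\<close> matrix of \<open>W\<^sup>+\<close> on \<open>\<Lambda>\<^sub>2\<^sup>+\<close>.
  The \<open>\<Lambda>\<^sub>2\<^sup>+\<close> block of \<open>2 Q(R) + Rc \<circ> Rc\<close> is \<open>-12 w\<^sup>2\<close> up to a multiple of the identity (lemma
  \<open>quadratic_identities\<close>). As \<open>w\<close> is trace-free, pairing with \<open>w\<close> yields \<open>-12 tr w\<^sup>3 = -36 det w\<close> (lemma
  \<open>cubic_identity\<close>). The second formula follows from the first, since \<open>Hess f\<close> and \<open>- Rc\<close> differ by a
  multiple of the metric and \<open>W\<^sup>+\<close> is trace-free.

  Two devices keep the tensor calculus short. Tensors of all ranks are functions of lists of indices,
  so that the Ricci identity and the behaviour under changes of frame are proved once, by induction on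
  the list. All differentiations at a point \<open>x\<close> are carried out in a frame that is orthonormal near \<open>x\<close> and
  parallel at \<open>x\<close> (lemma \<open>adapted_frame_exists\<close>). In such a frame the covariant derivative at \<open>x\<close> is the
  ordinary derivative of the components (lemma \<open>pd_frame_comp_parallel\<close>), while the metric and the volume
  form have constant components, so that contractions, the Hodge star and the projection to \<open>W\<^sup>+\<close>
  are differentiated like constants. The frame is parallel at \<open>x\<close> only, which suffices because every
  identity to be differentiated is first established in all orthonormal frames at all nearby points.
\<close>

section \<open>Calculus of partial derivatives\<close>

lemma pd_eqI:
  assumes "(h has_derivative D) (at x)"
  shows "pd i h x = D (axis i 1)"
  using frechet_derivative_at[OF assms] by (simp add: pd_def)


lemma has_derivative_cong_open:
  assumes "open S" "x \<in> S" "\<And>y. y \<in> S \<Longrightarrow> f y = g y"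
  shows "(f has_derivative D) (at x) \<longleftrightarrow> (g has_derivative D) (at x)"
  using assms has_derivative_transform_within_open[of f D x UNIV S g]
    has_derivative_transform_within_open[of g D x UNIV S f] by auto

lemma pd_cong_open:
  assumes "open S" "x \<in> S" "\<And>y. y \<in> S \<Longrightarrow> f y = g y"
  shows "pd i f x = pd i g x"
  using has_derivative_cong_open[OF assms] by (simp add: pd_def frechet_derivative_def)

lemma differentiable_cong_open:
  assumes "open S" "x \<in> S" "\<And>y. y \<in> S \<Longrightarrow> f y = g y"
  shows "f differentiable (at x) \<longleftrightarrow> g differentiable (at x)"
  using has_derivative_cong_open[OF assms] by (simp add: differentiable_def)

lemma eventually_pd_cong:
  assumes "eventually (\<lambda>y. f y = g y) (nhds x)"
  shows "pd i f x = pd i g x" and "f differentiable (at x) \<longleftrightarrow> g differentiable (at x)"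
proof -
  obtain S where "open S" "x \<in> S" "\<And>y. y \<in> S \<Longrightarrow> f y = g y"
    using assms unfolding eventually_nhds by blast
  then show "pd i f x = pd i g x" "f differentiable (at x) \<longleftrightarrow> g differentiable (at x)"
    using pd_cong_open differentiable_cong_open by blast+
qed

lemma pd_const [simp]: "pd i (\<lambda>y. c) x = 0"
  using pd_eqI[OF has_derivative_const, of i c x] by simp

lemma pd_add:
  assumes "f differentiable (at x)" "g differentiable (at x)"
  shows "pd i (\<lambda>y. f y + g y) x = pd i f x + pd i g x"
proof -
  have "((\<lambda>y. f y + g y) has_derivative
      (\<lambda>v. frechet_derivative f (at x) v + frechet_derivative g (at x) v)) (at x)"
    using assms by (intro has_derivative_add) (simp_all add: frechet_derivative_works)
  from pd_eqI[OF this] show ?thesis by (simp add: pd_def)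
qed

lemma pd_linear:
  assumes "bounded_linear L" "f differentiable (at x)"
  shows "pd i (\<lambda>y. L (f y)) x = L (pd i f x)"
proof -
  have "((\<lambda>y. L (f y)) has_derivative (\<lambda>v. L (frechet_derivative f (at x) v))) (at x)"
    using assms(2) by (intro bounded_linear.has_derivative[OF assms(1)]) (simp add: frechet_derivative_works)
  from pd_eqI[OF this] show ?thesis by (simp add: pd_def)
qed

lemma pd_minus:
  assumes "f differentiable (at x)"
  shows "pd i (\<lambda>y. - f y) x = - pd i f x"
proof -
  have "((\<lambda>y. - f y) has_derivative (\<lambda>v. - frechet_derivative f (at x) v)) (at x)"
    using assms by (intro has_derivative_minus) (simp add: frechet_derivative_works)
  from pd_eqI[OF this] show ?thesis by (simp add: pd_def)
qed

lemma pd_diff: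
  assumes "f differentiable (at x)" "g differentiable (at x)"
  shows "pd i (\<lambda>y. f y - g y) x = pd i f x - pd i g x"
proof -
  have "((\<lambda>y. f y - g y) has_derivative
      (\<lambda>v. frechet_derivative f (at x) v - frechet_derivative g (at x) v)) (at x)"
    using assms by (intro has_derivative_diff) (simp_all add: frechet_derivative_works)
  from pd_eqI[OF this] show ?thesis by (simp add: pd_def)
qed

lemma pd_sum:
  assumes "\<And>a. a \<in> A \<Longrightarrow> f a differentiable (at x)"
  shows "pd i (\<lambda>y. \<Sum>a\<in>A. f a y) x = (\<Sum>a\<in>A. pd i (f a) x)"
proof -
  have "((\<lambda>y. \<Sum>a\<in>A. f a y) has_derivative
      (\<lambda>v. \<Sum>a\<in>A. frechet_derivative (f a) (at x) v)) (at x)"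
    using assms by (intro has_derivative_sum) (simp_all add: frechet_derivative_works)
  from pd_eqI[OF this] show ?thesis by (simp add: pd_def)
qed

lemma pd_mult:
  fixes f g :: "real^'n::finite \<Rightarrow> real"
  assumes "f differentiable (at x)" "g differentiable (at x)"
  shows "pd i (\<lambda>y. f y * g y) x = pd i f x * g x + f x * pd i g x"
proof -
  have "((\<lambda>y. f y * g y) has_derivative
      (\<lambda>v. f x * frechet_derivative g (at x) v + frechet_derivative f (at x) v * g x)) (at x)"
    using assms by (intro has_derivative_mult) (simp_all add: frechet_derivative_works)
  from pd_eqI[OF this] show ?thesis by (simp add: pd_def)
qed

lemma pd_cmult:
  fixes f :: "real^'n::finite \<Rightarrow> real"
  assumes "f differentiable (at x)"
  shows "pd i (\<lambda>y. c * f y) x = c * pd i f x"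
  using pd_mult[of "\<lambda>y. c" x f i] assms by simp

lemma pd_inverse:
  fixes f :: "real^'n::finite \<Rightarrow> real"
  assumes "f differentiable (at x)" "f x \<noteq> 0"
  shows "pd i (\<lambda>y. inverse (f y)) x = - (inverse (f x) * (inverse (f x) * pd i f x))"
proof -
  have "((\<lambda>y. inverse (f y)) has_derivative
      (\<lambda>v. - (inverse (f x) * frechet_derivative f (at x) v * inverse (f x)))) (at x)"
    by (rule Deriv.has_derivative_inverse) (use assms in \<open>simp_all add: frechet_derivative_works\<close>)
  from pd_eqI[OF this] show ?thesis by (simp add: pd_def algebra_simps)
qed

section \<open>Closure properties of smooth functions\<close>

lemma Ck_on_cong:
  assumes "open S" "\<And>y. y \<in> S \<Longrightarrow> f y = g y"
  shows "Ck_on k S f \<longleftrightarrow> Ck_on k S g"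
  using assms(2)
proof (induction k arbitrary: f g)
  case 0
  then show ?case using continuous_on_cong[of S S f g] by simp
next
  case (Suc k)
  have "(\<forall>x\<in>S. f differentiable at x) = (\<forall>x\<in>S. g differentiable at x)"
    using differentiable_cong_open[OF assms(1)] Suc.prems by blast
  moreover have "Ck_on k S (pd i f) = Ck_on k S (pd i g)" for i
    using pd_cong_open[OF assms(1)] Suc.prems by (intro Suc.IH) blast
  ultimately show ?case by simp
qed

lemma Ck_on_imp_continuous_on: "Ck_on k S f \<Longrightarrow> continuous_on S f"
  by (cases k) (simp_all add: continuous_at_imp_continuous_on differentiable_imp_continuous_within)

lemma Ck_on_SucD: "Ck_on (Suc k) S f \<Longrightarrow> Ck_on k S f"
proof (induction k arbitrary: f)
  case 0
  then show ?case using Ck_on_imp_continuous_on[of "Suc 0"] by simp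
qed simp

lemma Ck_on_const: "Ck_on k (S :: (real^'n::finite) set) (\<lambda>y. c)"
proof (induction k arbitrary: c)
  case (Suc k)
  moreover have "pd i (\<lambda>y. c) = (\<lambda>y. 0)" for i :: 'n
    by (rule ext) simp
  ultimately show ?case by simp
qed simp

lemma Ck_on_linear:
  assumes "open S" "bounded_linear L" "Ck_on k S f"
  shows "Ck_on k S (\<lambda>y. L (f y))"
  using assms(3)
proof (induction k arbitrary: f)
  case 0
  then show ?case
    using assms(2) by (simp add: bounded_linear.continuous_on)
next
  case (Suc k)
  have "Ck_on k S (pd i (\<lambda>y. L (f y)))" for i
  proof (subst Ck_on_cong[OF assms(1)])
    show "Ck_on k S (\<lambda>y. L (pd i f y))" by (rule Suc.IH) (use Suc.prems in simp)
  qed (use Suc.prems in \<open>simp add: pd_linear[OF assms(2)]\<close>)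
  moreover have "(\<lambda>y. L (f y)) differentiable (at x)" if "x \<in> S" for x
    using Suc.prems that differentiable_compose[of L f x UNIV] bounded_linear_imp_differentiable[OF assms(2)]
    by simp
  ultimately show ?case by simp
qed

lemma Ck_on_add:
  assumes "open S" "Ck_on k S f" "Ck_on k S g"
  shows "Ck_on k S (\<lambda>y. f y + g y)"
  using assms(2,3)
proof (induction k arbitrary: f g)
  case (Suc k)
  have "Ck_on k S (pd i (\<lambda>y. f y + g y))" for i
  proof (subst Ck_on_cong[OF assms(1)])
    show "Ck_on k S (\<lambda>y. pd i f y + pd i g y)" by (rule Suc.IH) (use Suc.prems in simp_all)
  qed (use Suc.prems in \<open>simp add: pd_add\<close>)
  then show ?case using Suc.prems by simp
qed (auto intro: continuous_on_add)

lemma Ck_on_mult: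
  fixes f g :: "real^'n::finite \<Rightarrow> real"
  assumes "open S" "Ck_on k S f" "Ck_on k S g"
  shows "Ck_on k S (\<lambda>y. f y * g y)"
  using assms(2,3)
proof (induction k arbitrary: f g)
  case (Suc k)
  have "Ck_on k S (pd i (\<lambda>y. f y * g y))" for i
  proof (subst Ck_on_cong[OF assms(1)])
    show "Ck_on k S (\<lambda>y. pd i f y * g y + f y * pd i g y)"
      using Suc.prems(1,2)[THEN Ck_on_SucD] Suc.prems
      by (intro Ck_on_add[OF assms(1)] Suc.IH) simp_all
  qed (use Suc.prems in \<open>simp add: pd_mult\<close>)
  then show ?case using Suc.prems by simp
qed (auto intro: continuous_on_mult)

lemma Ck_on_inverse:
  fixes f :: "real^'n::finite \<Rightarrow> real"
  assumes "open S" "Ck_on k S f" "\<And>y. y \<in> S \<Longrightarrow> f y \<noteq> 0"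
  shows "Ck_on k S (\<lambda>y. inverse (f y))"
  using assms(2,3)
proof (induction k arbitrary: f)
  case (Suc k)
  have "Ck_on k S (\<lambda>y. - (inverse (f y) * (inverse (f y) * pd i f y)))" for i
    using Suc.prems(1)[THEN Ck_on_SucD] Suc.prems
    by (intro Ck_on_linear[OF assms(1) bounded_linear_minus[OF bounded_linear_ident]]
        Ck_on_mult[OF assms(1)] Suc.IH) simp_all
  then have "Ck_on k S (pd i (\<lambda>y. inverse (f y)))" for i
    by (subst Ck_on_cong[OF assms(1)]) (use Suc.prems in \<open>simp_all add: pd_inverse\<close>)
  then show ?case using Suc.prems by simp
qed (auto intro: continuous_on_inverse)

lemma smooth_on_const: "smooth_on S (\<lambda>y. c)"
  by (simp add: smooth_on_def Ck_on_const)

lemma smooth_on_pd: "smooth_on S f \<Longrightarrow> smooth_on S (pd i f)"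
  unfolding smooth_on_def by (meson Ck_on.simps(2))

lemma smooth_on_differentiable: "smooth_on S f \<Longrightarrow> x \<in> S \<Longrightarrow> f differentiable (at x)"
  unfolding smooth_on_def by (meson Ck_on.simps(2))

lemma smooth_on_cong:
  "open S \<Longrightarrow> (\<And>y. y \<in> S \<Longrightarrow> f y = g y) \<Longrightarrow> smooth_on S f \<longleftrightarrow> smooth_on S g"
  unfolding smooth_on_def using Ck_on_cong by blast

lemma smooth_on_linear:
  "open S \<Longrightarrow> bounded_linear L \<Longrightarrow> smooth_on S f \<Longrightarrow> smooth_on S (\<lambda>y. L (f y))"
  unfolding smooth_on_def using Ck_on_linear by blast

lemma smooth_on_add:
  "open S \<Longrightarrow> smooth_on S f \<Longrightarrow> smooth_on S g \<Longrightarrow> smooth_on S (\<lambda>y. f y + g y)"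
  unfolding smooth_on_def using Ck_on_add by blast

lemma smooth_on_minus: "open S \<Longrightarrow> smooth_on S f \<Longrightarrow> smooth_on S (\<lambda>y. - f y)"
  using smooth_on_linear[OF _ bounded_linear_minus[OF bounded_linear_ident]] by blast

lemma smooth_on_diff:
  "open S \<Longrightarrow> smooth_on S f \<Longrightarrow> smooth_on S g \<Longrightarrow> smooth_on S (\<lambda>y. f y - g y)"
  using smooth_on_add[of S f "\<lambda>y. - g y"] smooth_on_minus[of S g] by simp

lemma smooth_on_mult:
  fixes f g :: "real^'n::finite \<Rightarrow> real"
  shows "open S \<Longrightarrow> smooth_on S f \<Longrightarrow> smooth_on S g \<Longrightarrow> smooth_on S (\<lambda>y. f y * g y)"
  unfolding smooth_on_def using Ck_on_mult by blast

lemma smooth_on_inverse: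
  fixes f :: "real^'n::finite \<Rightarrow> real"
  shows "open S \<Longrightarrow> smooth_on S f \<Longrightarrow> (\<And>y. y \<in> S \<Longrightarrow> f y \<noteq> 0) \<Longrightarrow> smooth_on S (\<lambda>y. inverse (f y))"
  unfolding smooth_on_def using Ck_on_inverse by blast

lemma smooth_on_sum:
  assumes "open S" "\<And>a. a \<in> A \<Longrightarrow> smooth_on S (f a)"
  shows "smooth_on S (\<lambda>y. \<Sum>a\<in>A. f a y)"
  using assms(2)
  by (induction A rule: infinite_finite_induct) (auto intro: smooth_on_const smooth_on_add[OF assms(1)])

lemma smooth_on_prod:
  fixes f :: "'a \<Rightarrow> real^'n::finite \<Rightarrow> real"
  assumes "open S" "\<And>a. a \<in> A \<Longrightarrow> smooth_on S (f a)"
  shows "smooth_on S (\<lambda>y. \<Prod>a\<in>A. f a y)"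
  using assms(2)
  by (induction A rule: infinite_finite_induct) (auto intro: smooth_on_const smooth_on_mult[OF assms(1)])

lemmas smooth_on_intros =
  smooth_on_const smooth_on_add smooth_on_diff smooth_on_minus smooth_on_mult smooth_on_sum smooth_on_pd

section \<open>Symmetry of second derivatives\<close>

lemma DERIV_along_axis:
  fixes f :: "real^'n::finite \<Rightarrow> real"
  assumes "f differentiable (at (p + s *\<^sub>R axis i 1))"
  shows "((\<lambda>s. f (p + s *\<^sub>R axis i 1)) has_real_derivative pd i f (p + s *\<^sub>R axis i 1)) (at s)"
proof -
  have "((\<lambda>s. f (p + s *\<^sub>R axis i 1)) has_derivative
      (\<lambda>h. frechet_derivative f (at (p + s *\<^sub>R axis i 1)) (h *\<^sub>R axis i 1))) (at s)"
    using assms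
    by (intro has_derivative_compose[where f="\<lambda>s. p + s *\<^sub>R axis i 1" and g=f])
       (auto intro!: derivative_eq_intros simp: frechet_derivative_works)
  moreover have "frechet_derivative f (at (p + s *\<^sub>R axis i 1)) (h *\<^sub>R axis i 1)
      = pd i f (p + s *\<^sub>R axis i 1) * h" for h
    using assms linear_frechet_derivative linear_scale unfolding pd_def by fastforce
  ultimately show ?thesis
    by (simp add: has_field_derivative_def)
qed

text \<open>
  The second difference \<open>f(x+hi+hj) - f(x+hi) - f(x+hj) + f(x)\<close> equals, by applying the mean value
  theorem twice, \<open>h\<^sup>2\<close> times a mixed derivative near \<open>x\<close>. The expression is symmetric in \<open>i\<close> and \<open>j\<close>,
  so that both orders of differentiation occur.
\<close>

lemma second_difference:
  fixes f :: "real^'n::finite \<Rightarrow> real"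
  assumes d: "\<And>y. y \<in> ball x e \<Longrightarrow> f differentiable (at y)"
    and d2: "\<And>y. y \<in> ball x e \<Longrightarrow> pd i f differentiable (at y)"
    and h: "0 < h" "2 * h < e"
  shows "\<exists>p\<in>ball x e. f (x + h *\<^sub>R axis i 1 + h *\<^sub>R axis j 1) - f (x + h *\<^sub>R axis i 1)
      - f (x + h *\<^sub>R axis j 1) + f x = h * h * pd j (pd i f) p"
proof -
  have near: "x + s *\<^sub>R axis i 1 + t *\<^sub>R axis j 1 \<in> ball x e"
    if "0 \<le> s" "s \<le> h" "0 \<le> t" "t \<le> h" for s t
  proof -
    have "norm (s *\<^sub>R axis i 1 + t *\<^sub>R axis j 1 :: real^'n) \<le> s + t"
      using that by (intro order_trans[OF norm_triangle_ineq]) simp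
    moreover have "dist x (x + s *\<^sub>R axis i 1 + t *\<^sub>R axis j 1)
        = norm (s *\<^sub>R axis i 1 + t *\<^sub>R axis j 1 :: real^'n)"
      by (metis add.assoc add_diff_cancel_left' dist_commute dist_norm)
    ultimately show ?thesis using that h by simp
  qed
  let ?q = "x + h *\<^sub>R axis j 1"
  let ?u = "\<lambda>s. f (?q + s *\<^sub>R axis i 1) - f (x + s *\<^sub>R axis i 1)"
  let ?u' = "\<lambda>s. pd i f (?q + s *\<^sub>R axis i 1) - pd i f (x + s *\<^sub>R axis i 1)"
  have n1: "?q + s *\<^sub>R axis i 1 \<in> ball x e" "x + s *\<^sub>R axis i 1 \<in> ball x e" if "0 \<le> s" "s \<le> h" for s
    using near[of s h] near[of s 0] that h by (simp_all add: algebra_simps)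
  have "\<exists>z>0. z < h \<and> ?u h - ?u 0 = (h - 0) * ?u' z"
    using h n1 d by (intro MVT2 DERIV_diff DERIV_along_axis) auto
  then obtain s where s: "0 < s" "s < h" "?u h - ?u 0 = h * ?u' s" by auto
  let ?r = "x + s *\<^sub>R axis i 1"
  let ?v = "\<lambda>t. pd i f (?r + t *\<^sub>R axis j 1)"
  have "\<exists>z>0. z < h \<and> ?v h - ?v 0 = (h - 0) * pd j (pd i f) (?r + z *\<^sub>R axis j 1)"
    using h s near d2 by (intro MVT2 DERIV_along_axis) auto
  then obtain t where t: "0 < t" "t < h" "?v h - ?v 0 = h * pd j (pd i f) (?r + t *\<^sub>R axis j 1)" by auto
  have "?u' s = ?v h - ?v 0" by (simp add: algebra_simps)
  then have "?u h - ?u 0 = h * h * pd j (pd i f) (?r + t *\<^sub>R axis j 1)"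
    using s(3) t(3) by simp
  moreover have "?r + t *\<^sub>R axis j 1 \<in> ball x e"
    using near s t by simp
  ultimately show ?thesis
    by (intro bexI[of _ "?r + t *\<^sub>R axis j 1"]) (simp_all add: algebra_simps)
qed

text \<open>
  The second difference equals a mixed derivative of either order at some point near \<open>x\<close>; by continuity
  the two orders agree at \<open>x\<close>.
\<close>

lemma pd_commute:
  fixes f :: "real^'n::finite \<Rightarrow> real"
  assumes S: "open S" "x \<in> S" and f: "smooth_on S f"
  shows "pd i (pd j f) x = pd j (pd i f) x"
proof (rule ccontr)
  assume neq: "pd i (pd j f) x \<noteq> pd j (pd i f) x"
  define c where "c = \<bar>pd i (pd j f) x - pd j (pd i f) x\<bar> / 2"
  have c: "c > 0" using neq by (simp add: c_def)
  have cont: "isCont (pd a (pd b f)) x" for a b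
    using S f smooth_on_pd smooth_on_differentiable differentiable_imp_continuous_within by blast
  obtain e1 where e1: "e1 > 0" "\<And>y. dist y x < e1 \<Longrightarrow> dist (pd i (pd j f) y) (pd i (pd j f) x) < c"
    using cont[of i j] c unfolding continuous_at_eps_delta by blast
  obtain e2 where e2: "e2 > 0" "\<And>y. dist y x < e2 \<Longrightarrow> dist (pd j (pd i f) y) (pd j (pd i f) x) < c"
    using cont[of j i] c unfolding continuous_at_eps_delta by blast
  obtain e3 where e3: "e3 > 0" "ball x e3 \<subseteq> S" using S open_contains_ball by blast
  define e where "e = min e1 (min e2 e3)"
  have e: "e > 0" using e1 e2 e3 by (simp add: e_def)
  have sub: "y \<in> S" if "y \<in> ball x e" for y using that e3 by (auto simp: e_def)
  have df: "f differentiable (at y)" "pd a f differentiable (at y)" if "y \<in> ball x e" for y a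
    using sub[OF that] f smooth_on_pd smooth_on_differentiable by blast+
  obtain p where p: "p \<in> ball x e" "f (x + (e/3) *\<^sub>R axis i 1 + (e/3) *\<^sub>R axis j 1) - f (x + (e/3) *\<^sub>R axis i 1)
      - f (x + (e/3) *\<^sub>R axis j 1) + f x = (e/3) * (e/3) * pd j (pd i f) p"
    using second_difference[of x e f i "e/3" j] df e by auto
  obtain q where q: "q \<in> ball x e" "f (x + (e/3) *\<^sub>R axis j 1 + (e/3) *\<^sub>R axis i 1) - f (x + (e/3) *\<^sub>R axis j 1)
      - f (x + (e/3) *\<^sub>R axis i 1) + f x = (e/3) * (e/3) * pd i (pd j f) q"
    using second_difference[of x e f j "e/3" i] df e by auto
  have "(e/3) * (e/3) * pd j (pd i f) p = (e/3) * (e/3) * pd i (pd j f) q"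
    using p(2) q(2) by (simp add: algebra_simps)
  then have "pd j (pd i f) p = pd i (pd j f) q" using e by simp
  moreover have "dist (pd j (pd i f) p) (pd j (pd i f) x) < c"
    using e2 p(1) by (auto simp: e_def dist_commute)
  moreover have "dist (pd i (pd j f) q) (pd i (pd j f) x) < c"
    using e1 q(1) by (auto simp: e_def dist_commute)
  ultimately have "\<bar>pd i (pd j f) x - pd j (pd i f) x\<bar> < 2 * c"
    unfolding dist_real_def by linarith
  then show False by (simp add: c_def)
qed

section \<open>Tensor fields indexed by lists\<close>

text \<open>
  A covariant tensor is a function of the list of its indices. The action of a matrix on tensors as
  a derivation, here \<open>gl_act\<close>, is how both the connection and the curvature enter the calculus.
\<close>

fun gl_act :: "('n::finite \<Rightarrow> 'n \<Rightarrow> real) \<Rightarrow> ('n list \<Rightarrow> real) \<Rightarrow> 'n list \<Rightarrow> real" where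
  "gl_act M T [] = 0"
| "gl_act M T (a # as) = (\<Sum>p\<in>UNIV. M p a * T (p # as)) + gl_act M (\<lambda>bs. T (a # bs)) as"

lemma gl_act_cong:
  assumes "\<And>bs. length bs = length as \<Longrightarrow> S bs = T bs"
  shows "gl_act M S as = gl_act M T as"
  using assms
proof (induction as arbitrary: S T)
  case (Cons a as)
  have "S (p # as) = T (p # as)" for p
    by (rule Cons.prems) simp
  moreover have "gl_act M (\<lambda>bs. S (a # bs)) as = gl_act M (\<lambda>bs. T (a # bs)) as"
    by (rule Cons.IH) (rule Cons.prems, simp)
  ultimately show ?case by simp
qed simp

lemma gl_act_add: "gl_act M (\<lambda>as. S as + T as) as = gl_act M S as + gl_act M T as"
  by (induction as arbitrary: S T) (simp_all add: sum.distrib algebra_simps)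

lemma gl_act_diff: "gl_act M (\<lambda>as. S as - T as) as = gl_act M S as - gl_act M T as"
  by (induction as arbitrary: S T) (simp_all add: sum_subtractf algebra_simps)

lemma gl_act_cmult: "gl_act M (\<lambda>as. c * T as) as = c * gl_act M T as"
  by (induction as arbitrary: T) (simp_all add: sum_distrib_left algebra_simps)

lemma gl_act_zero: "gl_act M (\<lambda>as. 0) as = 0"
  by (induction as) simp_all

lemma gl_act_sum:
  assumes "finite A"
  shows "gl_act M (\<lambda>as. \<Sum>q\<in>A. T q as) as = (\<Sum>q\<in>A. gl_act M (T q) as)"
  using assms by (induction A) (simp_all add: gl_act_zero gl_act_add)

lemma gl_act_diff_matrix: "gl_act (\<lambda>p a. M p a - N p a) T as = gl_act M T as - gl_act N T as"
  by (induction as arbitrary: T) (simp_all add: sum_subtractf algebra_simps)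

lemma gl_act_add_matrix: "gl_act (\<lambda>p a. M p a + N p a) T as = gl_act M T as + gl_act N T as"
  by (induction as arbitrary: T) (simp_all add: sum.distrib algebra_simps)

text \<open>
  Lower indices are acted on by the transposed matrices, whence the reversed order of the products.
\<close>

lemma gl_act_commutator:
  "gl_act M (gl_act N T) as - gl_act N (gl_act M T) as
     = gl_act (\<lambda>q a. (\<Sum>p\<in>UNIV. N q p * M p a) - (\<Sum>p\<in>UNIV. M q p * N p a)) T as"
proof (induction as arbitrary: T)
  case (Cons a as)
  have *: "gl_act M (gl_act N T) (a # as) = (\<Sum>p\<in>UNIV. \<Sum>q\<in>UNIV. M p a * N q p * T (q # as))
      + (\<Sum>p\<in>UNIV. M p a * gl_act N (\<lambda>bs. T (p # bs)) as)
      + (\<Sum>q\<in>UNIV. N q a * gl_act M (\<lambda>bs. T (q # bs)) as)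
      + gl_act M (gl_act N (\<lambda>bs. T (a # bs))) as" for M N
    by (simp add: gl_act_add gl_act_sum gl_act_cmult distrib_left sum.distrib sum_distrib_left mult.assoc)
  have "(\<Sum>p\<in>UNIV. \<Sum>q\<in>UNIV. M p a * N q p * T (q # as))
      = (\<Sum>q\<in>UNIV. (\<Sum>p\<in>UNIV. N q p * M p a) * T (q # as))" for M N
    by (subst sum.swap) (simp add: sum_distrib_right sum_distrib_left mult.commute)
  from this[of M N] this[of N M] show ?case
    unfolding * using Cons.IH[of "\<lambda>bs. T (a # bs)"]
    by (simp add: left_diff_distrib sum_subtractf)
qed simp

lemma gl_act_differentiable:
  assumes "\<And>p a. (\<lambda>y. M y p a) differentiable (at x)" "\<And>as. (\<lambda>y. T as y) differentiable (at x)"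
  shows "(\<lambda>y. gl_act (M y) (\<lambda>bs. T bs y) as) differentiable (at x)"
  using assms(2)
proof (induction as arbitrary: T)
  case (Cons a as)
  have "(\<lambda>y. gl_act (M y) (\<lambda>bs. T (a # bs) y) as) differentiable (at x)"
    by (rule Cons.IH) (rule Cons.prems)
  then show ?case using assms(1) Cons.prems
    by (auto intro!: differentiable_add differentiable_sum differentiable_mult)
qed simp

lemma pd_gl_act:
  assumes "\<And>p a. (\<lambda>y. M y p a) differentiable (at x)" "\<And>as. T as differentiable (at x)"
  shows "pd i (\<lambda>y. gl_act (M y) (\<lambda>bs. T bs y) as) x
    = gl_act (\<lambda>p a. pd i (\<lambda>y. M y p a) x) (\<lambda>bs. T bs x) as + gl_act (M x) (\<lambda>bs. pd i (T bs) x) as"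
  using assms(2)
proof (induction as arbitrary: T)
  case (Cons a as)
  have "(\<lambda>y. gl_act (M y) (\<lambda>bs. T (a # bs) y) as) differentiable (at x)"
    by (rule gl_act_differentiable) (rule assms(1) Cons.prems)+
  moreover have "(\<lambda>y. M y p a * T (p # as) y) differentiable (at x)" for p
    using assms(1) Cons.prems by (intro differentiable_mult)
  moreover have "pd i (\<lambda>y. gl_act (M y) (\<lambda>bs. T (a # bs) y) as) x
    = gl_act (\<lambda>p a. pd i (\<lambda>y. M y p a) x) (\<lambda>bs. T (a # bs) x) as + gl_act (M x) (\<lambda>bs. pd i (T (a # bs)) x) as"
    by (rule Cons.IH) (rule Cons.prems)
  ultimately show ?case
    using assms(1) Cons.prems
    by (simp add: pd_add pd_sum pd_mult sum.distrib differentiable_sum)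
qed simp

lemma smooth_on_gl_act:
  assumes "open S" "\<And>p a. smooth_on S (\<lambda>y. M y p a)" "\<And>as. smooth_on S (T as)"
  shows "smooth_on S (\<lambda>y. gl_act (M y) (\<lambda>bs. T bs y) as)"
  using assms(3)
proof (induction as arbitrary: T)
  case Nil
  then show ?case by (simp add: smooth_on_const)
next
  case (Cons a as)
  have "smooth_on S (\<lambda>y. gl_act (M y) (\<lambda>bs. T (a # bs) y) as)"
    by (rule Cons.IH) (rule Cons.prems)
  then show ?case using assms(1,2) Cons.prems
    by (auto intro!: smooth_on_intros)
qed

definition nabla :: "(real^4 \<Rightarrow> real^4^4) \<Rightarrow> (4 list \<Rightarrow> real^4 \<Rightarrow> real) \<Rightarrow> 4 list \<Rightarrow> real^4 \<Rightarrow> real" where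
  "nabla G T as x = (case as of [] \<Rightarrow> 0
     | m # bs \<Rightarrow> pd m (T bs) x - gl_act (\<lambda>p a. christoffel G p m a x) (\<lambda>cs. T cs x) bs)"

lemma nabla_Nil [simp]: "nabla G T [] x = 0"
  by (simp add: nabla_def)

lemma nabla_Cons:
  "nabla G T (m # as) x = pd m (T as) x - gl_act (\<lambda>p a. christoffel G p m a x) (\<lambda>bs. T bs x) as"
  by (simp add: nabla_def)

lemma nabla_cong_open:
  assumes "open S" "x \<in> S" "\<And>bs y. Suc (length bs) = length as \<Longrightarrow> y \<in> S \<Longrightarrow> T bs y = T' bs y"
  shows "nabla G T as x = nabla G T' as x"
proof (cases as)
  case (Cons m bs)
  have "pd m (T bs) x = pd m (T' bs) x"
    using assms Cons by (intro pd_cong_open) auto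
  moreover have "gl_act (\<lambda>p a. christoffel G p m a x) (\<lambda>bs. T bs x) bs
      = gl_act (\<lambda>p a. christoffel G p m a x) (\<lambda>bs. T' bs x) bs"
    using assms Cons by (intro gl_act_cong) auto
  ultimately show ?thesis by (simp add: Cons nabla_Cons)
qed simp

definition field2 :: "(real^4 \<Rightarrow> real^4^4) \<Rightarrow> 4 list \<Rightarrow> real^4 \<Rightarrow> real" where
  "field2 A as x = A x $ (as ! 0) $ (as ! 1)"

definition field4 :: "(real^4 \<Rightarrow> tensor4) \<Rightarrow> 4 list \<Rightarrow> real^4 \<Rightarrow> real" where
  "field4 T as x = T x (as ! 0) (as ! 1) (as ! 2) (as ! 3)"

lemma field2_simp [simp]: "field2 A [i, j] = (\<lambda>x. A x $ i $ j)"
  by (simp add: field2_def fun_eq_iff)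

lemma field4_simp [simp]: "field4 T [i, j, k, l] = (\<lambda>x. T x i j k l)"
  by (simp add: field4_def fun_eq_iff)

lemma cov_deriv4_eq_nabla: "cov_deriv4 G T x i a b c d = nabla G (field4 T) [i, a, b, c, d] x"
  by (simp add: cov_deriv4_def nabla_Cons sum.distrib algebra_simps)

section \<open>The Levi-Civita connection of a metric on an open set\<close>

lemma smooth_on_det:
  assumes "open S" "\<And>i j. smooth_on S (\<lambda>y. A y $ i $ j)"
  shows "smooth_on S (\<lambda>y. det (A y :: real^'m^'m))"
  unfolding det_def using assms by (intro smooth_on_intros smooth_on_prod)

lemma matrix_inv_right:
  assumes "invertible A"
  shows "A ** matrix_inv A = mat 1"
  using someI_ex[OF assms[unfolded invertible_def]] by (simp add: matrix_inv_def)

locale metric_on =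
  fixes U :: "(real^4) set" and G :: "real^4 \<Rightarrow> real^4^4"
  assumes openU: "open U" and smoothG: "smooth_on U G"
    and symG: "x \<in> U \<Longrightarrow> G x $ i $ j = G x $ j $ i"
    and posG: "x \<in> U \<Longrightarrow> v \<noteq> 0 \<Longrightarrow> v \<bullet> (G x *v v) > 0"
begin

lemma smooth_G_entry: "smooth_on U (\<lambda>y. G y $ i $ j)"
proof -
  have "bounded_linear (\<lambda>A::real^4^4. A $ i $ j)"
    using bounded_linear_compose[OF bounded_linear_vec_nth bounded_linear_vec_nth] by blast
  from smooth_on_linear[OF openU this smoothG] show ?thesis .
qed

lemma det_G_nonzero: "x \<in> U \<Longrightarrow> det (G x) \<noteq> 0"
  using posG[of x] by (metis inner_zero_right invertible_det_nz invertible_left_inverse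
      less_irrefl matrix_left_invertible_ker)

text \<open>
  By Cramer's rule the entries of the inverse are rational functions of the entries of the metric,
  which makes them smooth.
\<close>

lemma ginv_entry:
  assumes "x \<in> U"
  shows "ginv G x $ k $ l = det (\<chi> i j. if j = k then axis l 1 $ i else G x $ i $ j) / det (G x)"
proof -
  have "G x ** ginv G x = mat 1"
    using det_G_nonzero[OF assms] unfolding ginv_def
    by (simp add: invertible_det_nz matrix_inv_right)
  then have "G x *v (ginv G x *v axis l 1) = axis l 1"
    by (simp add: matrix_vector_mul_assoc)
  then have "ginv G x *v axis l 1
      = (\<chi> k. det (\<chi> i j. if j = k then axis l 1 $ i else G x $ i $ j) / det (G x))"
    using cramer[OF det_G_nonzero[OF assms]] by blast
  moreover have "(ginv G x *v axis l 1) $ k = ginv G x $ k $ l"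
    by (simp add: matrix_vector_mul_component inner_axis)
  ultimately show ?thesis by simp
qed

lemma smooth_ginv_entry: "smooth_on U (\<lambda>y. ginv G y $ k $ l)"
proof -
  have "smooth_on U (\<lambda>y. if j = k then axis l 1 $ i else G y $ i $ j)" for i j
    by (cases "j = k") (simp_all add: smooth_on_const smooth_G_entry)
  then have "smooth_on U (\<lambda>y. det (\<chi> i j. if j = k then axis l 1 $ i else G y $ i $ j) * inverse (det (G y)))"
    using det_G_nonzero smooth_G_entry
    by (intro smooth_on_mult smooth_on_inverse smooth_on_det openU) simp_all
  then show ?thesis
    by (subst smooth_on_cong[OF openU]) (simp_all add: ginv_entry divide_inverse)
qed

lemma G_ginv: "x \<in> U \<Longrightarrow> (\<Sum>p\<in>UNIV. G x $ i $ p * ginv G x $ p $ j) = (if i = j then 1 else 0)"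
proof -
  assume "x \<in> U"
  then have "G x ** ginv G x = mat 1"
    using det_G_nonzero unfolding ginv_def by (simp add: invertible_det_nz matrix_inv_right)
  then have "(G x ** ginv G x) $ i $ j = mat 1 $ i $ j" by simp
  then show ?thesis by (simp add: matrix_matrix_mult_def mat_def)
qed

abbreviation Gam :: "4 \<Rightarrow> 4 \<Rightarrow> 4 \<Rightarrow> real^4 \<Rightarrow> real" where
  "Gam \<equiv> christoffel G"

lemma smooth_Gam: "smooth_on U (Gam k i j)"
  unfolding christoffel_def[abs_def] divide_inverse
  by (intro smooth_on_intros smooth_ginv_entry smooth_G_entry openU)

lemma pd_G_sym: "x \<in> U \<Longrightarrow> pd m (\<lambda>y. G y $ i $ j) x = pd m (\<lambda>y. G y $ j $ i) x"
  using symG by (intro pd_cong_open[OF openU]) auto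

lemma Gam_sym: "x \<in> U \<Longrightarrow> Gam k i j x = Gam k j i x"
  unfolding christoffel_def by (simp add: pd_G_sym[of x _ i j] add.commute)

lemma Gam_lower:
  assumes "x \<in> U"
  shows "(\<Sum>p\<in>UNIV. Gam p m i x * G x $ p $ j)
    = (pd m (\<lambda>y. G y $ i $ j) x + pd i (\<lambda>y. G y $ m $ j) x - pd j (\<lambda>y. G y $ m $ i) x) / 2"
proof -
  let ?k = "\<lambda>l. pd m (\<lambda>y. G y $ i $ l) x + pd i (\<lambda>y. G y $ m $ l) x - pd l (\<lambda>y. G y $ m $ i) x"
  have "(\<Sum>p\<in>UNIV. Gam p m i x * G x $ p $ j)
      = (\<Sum>p\<in>UNIV. \<Sum>l\<in>UNIV. (G x $ j $ p * ginv G x $ p $ l) * (?k l / 2))"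
    unfolding christoffel_def sum_distrib_right
    using symG[OF assms] by (intro sum.cong) simp_all
  also have "\<dots> = (\<Sum>l\<in>UNIV. (\<Sum>p\<in>UNIV. G x $ j $ p * ginv G x $ p $ l) * (?k l / 2))"
    by (subst sum.swap) (simp only: sum_distrib_right)
  also have "\<dots> = ?k j / 2"
  proof -
    have "(if j = l then 1 else 0) * (?k l / 2) = (if j = l then ?k l / 2 else 0)" for l
      by simp
    then show ?thesis unfolding G_ginv[OF assms] by (simp only: sum.delta' finite_UNIV UNIV_I if_True sum.delta finite)
  qed
  finally show ?thesis .
qed

lemma metric_compatible:
  assumes "x \<in> U"
  shows "pd m (\<lambda>y. G y $ i $ j) x
    = (\<Sum>p\<in>UNIV. Gam p m i x * G x $ p $ j) + (\<Sum>p\<in>UNIV. Gam p m j x * G x $ i $ p)"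
proof -
  have "(\<Sum>p\<in>UNIV. Gam p m j x * G x $ i $ p) = (\<Sum>p\<in>UNIV. Gam p m j x * G x $ p $ i)"
    using symG[OF assms] by simp
  then show ?thesis
    unfolding Gam_lower[OF assms] pd_G_sym[OF assms, of m j i] by (simp add: field_simps)
qed

lemma nabla_metric: "x \<in> U \<Longrightarrow> nabla G (field2 G) [m, i, j] x = 0"
  by (simp add: nabla_Cons metric_compatible)

lemma smooth_nabla:
  assumes "\<And>as. smooth_on U (T as)"
  shows "smooth_on U (nabla G T as)"
proof (cases as)
  case Nil
  then show ?thesis by (simp add: smooth_on_const nabla_def[abs_def])
next
  case (Cons m bs)
  have "smooth_on U (\<lambda>x. pd m (T bs) x - gl_act (\<lambda>p a. christoffel G p m a x) (\<lambda>cs. T cs x) bs)"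
    by (intro smooth_on_intros smooth_on_gl_act smooth_Gam assms openU)
  then show ?thesis by (simp add: Cons nabla_def[abs_def])
qed

lemma curv_op_split:
  "curv_op G m l i j x = (pd i (Gam m j l) x - pd j (Gam m i l) x)
     + ((\<Sum>p\<in>UNIV. Gam m i p x * Gam p j l x) - (\<Sum>p\<in>UNIV. Gam m j p x * Gam p i l x))"
  by (simp add: curv_op_def sum_subtractf)

text \<open>
  The curvature enters through the commutator of two covariant derivatives: the terms that
  contain a derivative of \<open>T\<close> cancel, and so do those with the connection on the derivative indices,
  as the connection is torsion free.
\<close>

lemma ricci_identity:
  assumes T: "\<And>as. smooth_on U (T as)" and x: "x \<in> U"
  shows "nabla G (nabla G T) (i # j # as) x - nabla G (nabla G T) (j # i # as) x
    = - gl_act (\<lambda>p a. curv_op G p a i j x) (\<lambda>bs. T bs x) as"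
proof -
  let ?A = "\<lambda>i T. gl_act (\<lambda>p a. Gam p i a x) T as"
  have dG: "Gam p i a differentiable (at x)" for p i a
    using smooth_Gam x smooth_on_differentiable by blast
  have dT: "T bs differentiable (at x)" and dT': "pd j (T bs) differentiable (at x)" for bs j
    using T x smooth_on_differentiable smooth_on_pd by blast+
  have *: "nabla G (nabla G T) (i # j # as) x
    = pd i (pd j (T as)) x - gl_act (\<lambda>p a. pd i (Gam p j a) x) (\<lambda>bs. T bs x) as
      - ?A j (\<lambda>bs. pd i (T bs) x) - (\<Sum>p\<in>UNIV. Gam p i j x * nabla G T (p # as) x)
      - ?A i (\<lambda>bs. pd j (T bs) x) + ?A i (gl_act (\<lambda>p a. Gam p j a x) (\<lambda>bs. T bs x))" for i j
  proof -
    have "pd i (nabla G T (j # as)) x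
        = pd i (\<lambda>y. pd j (T as) y - gl_act (\<lambda>p a. Gam p j a y) (\<lambda>bs. T bs y) as) x"
      by (simp add: nabla_def[abs_def])
    also have "\<dots> = pd i (pd j (T as)) x - gl_act (\<lambda>p a. pd i (Gam p j a) x) (\<lambda>bs. T bs x) as
      - ?A j (\<lambda>bs. pd i (T bs) x)"
      by (subst pd_diff) (use dG dT dT' in \<open>simp_all add: gl_act_differentiable pd_gl_act\<close>)
    finally show ?thesis
      by (simp add: nabla_Cons[of G "nabla G T"]) (simp add: nabla_Cons gl_act_diff)
  qed
  have "pd i (pd j (T as)) x = pd j (pd i (T as)) x"
    using pd_commute[OF openU x T] .
  moreover have "(\<Sum>p\<in>UNIV. Gam p i j x * nabla G T (p # as) x) = (\<Sum>p\<in>UNIV. Gam p j i x * nabla G T (p # as) x)"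
    using Gam_sym[OF x] by simp
  moreover note gl_act_commutator[of "\<lambda>p a. Gam p i a x" "\<lambda>p a. Gam p j a x" "\<lambda>bs. T bs x" as]
  ultimately show ?thesis
    unfolding * curv_op_split
    by (simp add: gl_act_add_matrix gl_act_diff_matrix)
qed

section \<open>Symmetries of the curvature tensor\<close>

lemma curv_op_antisym: "curv_op G m l i j x = - curv_op G m l j i x"
  by (simp add: curv_op_split)

lemma riem_antisym12: "riem G x i j k l = - riem G x j i k l"
  unfolding riem_def by (subst curv_op_antisym) (simp add: sum_negf)

text \<open>
  The Ricci identity for the metric: its covariant derivatives vanish, and the curvature acts on it by
  symmetrising the lowered tensor in the last two indices.
\<close>

lemma riem_antisym34:
  assumes "x \<in> U"
  shows "riem G x i j k l = - riem G x i j l k"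
proof -
  have s: "smooth_on U (field2 G as)" for as
    by (simp add: field2_def[abs_def] smooth_G_entry)
  have 0: "nabla G (nabla G (field2 G)) [i, j, l, k] x = 0" for i j
  proof -
    have "nabla G (nabla G (field2 G)) [i, j, l, k] x = nabla G (\<lambda>as y. 0) [i, j, l, k] x"
    proof (rule nabla_cong_open[OF openU assms])
      fix bs :: "4 list" and y assume "Suc (length bs) = length [i, j, l, k]" "y \<in> U"
      then obtain a b c where "bs = [a, b, c]"
        by (auto simp: length_Suc_conv)
      then show "nabla G (field2 G) bs y = 0" using \<open>y \<in> U\<close> by (simp add: nabla_metric)
    qed
    then show ?thesis by (simp add: nabla_Cons)
  qed
  have "gl_act (\<lambda>p a. curv_op G p a i j x) (\<lambda>bs. field2 G bs x) [l, k] = 0"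
    using ricci_identity[where T = "field2 G" and as = "[l, k]" and i = i and j = j, OF s assms] 0[of i j] 0[of j i] by linarith
  then show ?thesis
    using symG[OF assms] by (simp add: riem_def mult.commute)
qed

lemma riem_bianchi1:
  assumes "x \<in> U"
  shows "riem G x i j k l + riem G x j l k i + riem G x l i k j = 0"
proof -
  have "pd i (Gam m a b) x = pd i (Gam m b a) x" for i m a b
    using Gam_sym by (intro pd_cong_open[OF openU assms])
  then have "curv_op G m l i j x + curv_op G m i j l x + curv_op G m j l i x = 0" for m
    unfolding curv_op_split using Gam_sym[OF assms] by simp
  then have "(\<Sum>m\<in>UNIV. G x $ k $ m * (curv_op G m l i j x + curv_op G m i j l x + curv_op G m j l i x)) = 0"
    by simp
  then show ?thesis by (simp add: riem_def distrib_left sum.distrib)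
qed

text \<open>
  Pure algebra: the sum of the first Bianchi identity over the four cyclic orders of the indices.
\<close>

lemma riem_pair_sym:
  assumes "x \<in> U"
  shows "riem G x i j k l = riem G x k l i j"
  using riem_antisym12[of x] riem_antisym34[OF assms] riem_bianchi1[OF assms]
  by (smt (verit))

lemma smooth_curv_op: "smooth_on U (curv_op G m l i j)"
  unfolding curv_op_def[abs_def]
  by (intro smooth_on_intros smooth_Gam openU)

lemma smooth_riem: "smooth_on U (\<lambda>x. riem G x i j k l)"
  unfolding riem_def by (intro smooth_on_intros smooth_curv_op smooth_G_entry openU)

abbreviation Rm :: "4 list \<Rightarrow> real^4 \<Rightarrow> real" where
  "Rm \<equiv> field4 (riem G)"

lemma smooth_Rm: "smooth_on U (Rm as)"
  unfolding field4_def[abs_def] by (rule smooth_riem)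

lemma smooth_nabla_Rm: "smooth_on U (nabla G Rm as)"
  by (rule smooth_nabla) (rule smooth_Rm)

text \<open>
  The connection on the indices \<open>i\<close> and \<open>j\<close> of the form is left out; its terms cancel in cyclic sums since
  the Christoffel symbols are symmetric.
\<close>

definition dcurv :: "4 \<Rightarrow> 4 \<Rightarrow> 4 \<Rightarrow> 4 \<Rightarrow> 4 \<Rightarrow> real^4 \<Rightarrow> real" where
  "dcurv e m l i j x = pd e (curv_op G m l i j) x
     + (\<Sum>p\<in>UNIV. Gam m e p x * curv_op G p l i j x) - (\<Sum>p\<in>UNIV. curv_op G m p i j x * Gam p e l x)"

lemma pd_curv_op:
  assumes "x \<in> U"
  shows "pd e (curv_op G m l i j) x = pd e (pd i (Gam m j l)) x - pd e (pd j (Gam m i l)) x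
     + (\<Sum>p\<in>UNIV. pd e (Gam m i p) x * Gam p j l x) + (\<Sum>p\<in>UNIV. Gam m i p x * pd e (Gam p j l) x)
     - (\<Sum>p\<in>UNIV. pd e (Gam m j p) x * Gam p i l x) - (\<Sum>p\<in>UNIV. Gam m j p x * pd e (Gam p i l) x)"
proof -
  have d: "Gam p i a differentiable (at x)" "pd b (Gam p i a) differentiable (at x)" for p i a b
    using smooth_Gam assms smooth_on_differentiable smooth_on_pd by blast+
  have *: "curv_op G m l i j = (\<lambda>x. (pd i (Gam m j l) x - pd j (Gam m i l) x)
     + ((\<Sum>p\<in>UNIV. Gam m i p x * Gam p j l x) - (\<Sum>p\<in>UNIV. Gam m j p x * Gam p i l x)))"
    by (rule ext) (rule curv_op_split)
  show ?thesis
    unfolding * using d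
    by (simp add: pd_add pd_diff pd_sum pd_mult differentiable_sum sum.distrib)
qed

lemma dcurv_bianchi:
  assumes "x \<in> U"
  shows "dcurv e m l i j x + dcurv i m l j e x + dcurv j m l e i x = 0"
proof -
  have c: "pd a (pd b (Gam m c l)) x = pd b (pd a (Gam m c l)) x" for a b c
    by (rule pd_commute[OF openU assms smooth_Gam])
  let ?P = "\<lambda>a b c. \<Sum>p\<in>UNIV. \<Sum>q\<in>UNIV. Gam m a p x * (Gam p b q x * Gam q c l x)"
  have 1: "(\<Sum>p\<in>UNIV. Gam m e p x * curv_op G p l i j x)
    = (\<Sum>p\<in>UNIV. Gam m e p x * pd i (Gam p j l) x) - (\<Sum>p\<in>UNIV. Gam m e p x * pd j (Gam p i l) x)
      + ?P e i j - ?P e j i" for e i j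
    unfolding curv_op_split
    by (simp add: algebra_simps sum.distrib sum_subtractf sum_distrib_left)
  have 2: "(\<Sum>p\<in>UNIV. curv_op G m p i j x * Gam p e l x)
    = (\<Sum>p\<in>UNIV. pd i (Gam m j p) x * Gam p e l x) - (\<Sum>p\<in>UNIV. pd j (Gam m i p) x * Gam p e l x)
      + ?P i j e - ?P j i e" for e i j
  proof -
    have "(\<Sum>p\<in>UNIV. (\<Sum>q\<in>UNIV. Gam m i q x * Gam q j p x) * Gam p e l x) = ?P i j e" for i j
      by (subst sum.swap) (simp add: sum_distrib_right mult.assoc)
    note * = this
    show ?thesis
      unfolding curv_op_split ring_distribs sum.distrib sum_subtractf * by simp
  qed
  show ?thesis
    unfolding dcurv_def pd_curv_op[OF assms] 1 2
    using c[of e i j] c[of e j i] c[of i j e] by simp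
qed

text \<open>
  Lowering an index commutes with the covariant derivative, since the metric is parallel.
\<close>

lemma nabla_Rm_eq:
  assumes "x \<in> U"
  shows "nabla G Rm [e, i, j, k, l] x = (\<Sum>m\<in>UNIV. G x $ k $ m * dcurv e m l i j x)
    - (\<Sum>p\<in>UNIV. Gam p e i x * riem G x p j k l) - (\<Sum>p\<in>UNIV. Gam p e j x * riem G x i p k l)"
proof -
  have d: "curv_op G m l i j differentiable (at x)" "(\<lambda>y. G y $ k $ m) differentiable (at x)" for m l i j k
    using smooth_curv_op smooth_G_entry assms smooth_on_differentiable by blast+
  have "pd e (\<lambda>y. riem G y i j k l) x = (\<Sum>m\<in>UNIV. pd e (\<lambda>y. G y $ k $ m) x * curv_op G m l i j x)
      + (\<Sum>m\<in>UNIV. G x $ k $ m * pd e (curv_op G m l i j) x)"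
    unfolding riem_def using d by (simp add: pd_sum pd_mult sum.distrib)
  moreover have "(\<Sum>m\<in>UNIV. pd e (\<lambda>y. G y $ k $ m) x * curv_op G m l i j x)
      = (\<Sum>p\<in>UNIV. Gam p e k x * riem G x i j p l)
        + (\<Sum>m\<in>UNIV. G x $ k $ m * (\<Sum>p\<in>UNIV. Gam m e p x * curv_op G p l i j x))"
  proof -
    have "(\<Sum>m\<in>UNIV. \<Sum>p\<in>UNIV. Gam p e k x * G x $ p $ m * curv_op G m l i j x)
        = (\<Sum>p\<in>UNIV. Gam p e k x * riem G x i j p l)"
      by (subst sum.swap) (simp add: riem_def sum_distrib_left mult.assoc)
    moreover have "(\<Sum>m\<in>UNIV. \<Sum>p\<in>UNIV. Gam p e m x * G x $ k $ p * curv_op G m l i j x)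
        = (\<Sum>m\<in>UNIV. G x $ k $ m * (\<Sum>p\<in>UNIV. Gam m e p x * curv_op G p l i j x))"
      by (subst sum.swap) (simp add: sum_distrib_left mult_ac)
    ultimately show ?thesis
      by (simp add: metric_compatible[OF assms] distrib_right sum.distrib sum_distrib_right)
  qed
  moreover have "(\<Sum>p\<in>UNIV. Gam p e l x * riem G x i j k p)
      = (\<Sum>m\<in>UNIV. G x $ k $ m * (\<Sum>p\<in>UNIV. curv_op G m p i j x * Gam p e l x))"
    unfolding riem_def sum_distrib_left by (subst sum.swap) (simp add: mult_ac)
  ultimately show ?thesis
    by (simp add: nabla_Cons dcurv_def distrib_left right_diff_distrib sum.distrib sum_subtractf)
qed

lemma riem_bianchi2:
  assumes "x \<in> U"
  shows "nabla G Rm [e, i, j, k, l] x + nabla G Rm [i, j, e, k, l] x + nabla G Rm [j, e, i, k, l] x = 0"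
proof -
  have "(\<Sum>m\<in>UNIV. G x $ k $ m * (dcurv e m l i j x + dcurv i m l j e x + dcurv j m l e i x)) = 0"
    by (simp add: dcurv_bianchi[OF assms])
  then have "(\<Sum>m\<in>UNIV. G x $ k $ m * dcurv e m l i j x) + (\<Sum>m\<in>UNIV. G x $ k $ m * dcurv i m l j e x)
      + (\<Sum>m\<in>UNIV. G x $ k $ m * dcurv j m l e i x) = 0"
    by (simp add: distrib_left sum.distrib)
  moreover have "(\<Sum>p\<in>UNIV. Gam p a b x * riem G x p c k l) = - (\<Sum>p\<in>UNIV. Gam p b a x * riem G x c p k l)" for a b c
    by (subst riem_antisym12) (simp add: Gam_sym[OF assms, of _ a b] sum_negf)
  ultimately show ?thesis
    unfolding nabla_Rm_eq[OF assms] by simp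
qed

end

section \<open>Components with respect to a frame\<close>

text \<open>
  \<open>frame_comp e T [a\<^sub>1, \<dots>, a\<^sub>k]\<close> is \<open>T(e a\<^sub>1, \<dots>, e a\<^sub>k)\<close>.
\<close>

fun frame_comp :: "('n::finite \<Rightarrow> real^'n) \<Rightarrow> ('n list \<Rightarrow> real) \<Rightarrow> 'n list \<Rightarrow> real" where
  "frame_comp e T [] = T []"
| "frame_comp e T (a # as) = (\<Sum>i\<in>UNIV. e a $ i * frame_comp e (\<lambda>bs. T (i # bs)) as)"

lemma frame_comp_cong:
  assumes "\<And>bs. length bs = length as \<Longrightarrow> S bs = T bs"
  shows "frame_comp e S as = frame_comp e T as"
  using assms
proof (induction as arbitrary: S T)
  case (Cons a as)
  have "frame_comp e (\<lambda>bs. S (p # bs)) as = frame_comp e (\<lambda>bs. T (p # bs)) as" for p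
    by (rule Cons.IH) (rule Cons.prems, simp)
  then show ?case by simp
qed simp

lemma frame_comp_add: "frame_comp e (\<lambda>as. S as + T as) as = frame_comp e S as + frame_comp e T as"
  by (induction as arbitrary: S T) (simp_all add: sum.distrib algebra_simps)

lemma frame_comp_diff: "frame_comp e (\<lambda>as. S as - T as) as = frame_comp e S as - frame_comp e T as"
  by (induction as arbitrary: S T) (simp_all add: right_diff_distrib sum_subtractf)

lemma frame_comp_cmult: "frame_comp e (\<lambda>as. c * T as) as = c * frame_comp e T as"
  by (induction as arbitrary: T) (simp_all add: sum_distrib_left algebra_simps)

lemma frame_comp_zero: "frame_comp e (\<lambda>as. 0) as = 0"
  by (induction as) simp_all

lemma frame_comp_sum:
  assumes "finite A"
  shows "frame_comp e (\<lambda>as. \<Sum>q\<in>A. T q as) as = (\<Sum>q\<in>A. frame_comp e (T q) as)"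
  using assms by (induction A) (simp_all add: frame_comp_zero frame_comp_add)

lemma frame_comp_frame_comp: "frame_comp o' (frame_comp e T) as = frame_comp (\<lambda>a. \<Sum>p\<in>UNIV. o' a $ p *\<^sub>R e p) T as"
proof (induction as arbitrary: T)
  case (Cons a as)
  have "frame_comp o' (frame_comp e T) (a # as)
      = (\<Sum>p\<in>UNIV. \<Sum>i\<in>UNIV. o' a $ p * (e p $ i * frame_comp o' (frame_comp e (\<lambda>bs. T (i # bs))) as))"
    by (simp add: frame_comp_sum frame_comp_cmult sum_distrib_left)
  also have "\<dots> = (\<Sum>i\<in>UNIV. (\<Sum>p\<in>UNIV. o' a $ p * e p $ i) * frame_comp o' (frame_comp e (\<lambda>bs. T (i # bs))) as)"
    by (subst sum.swap) (simp add: sum_distrib_right mult.assoc)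
  finally show ?case by (simp add: Cons.IH)
qed simp

lemma frame_comp_axis: "frame_comp (\<lambda>a. axis a 1) T as = T as"
proof (induction as arbitrary: T)
  case (Cons a as)
  have "axis a 1 $ i * T (i # as) = (if i = a then T (i # as) else 0)" for i
    by (simp add: axis_def)
  then show ?case by (simp add: Cons.IH)
qed simp

lemma frame_comp_differentiable:
  assumes "\<And>a i. (\<lambda>y. e y a $ i) differentiable (at x)" "\<And>as. T as differentiable (at x)"
  shows "(\<lambda>y. frame_comp (e y) (\<lambda>bs. T bs y) as) differentiable (at x)"
  using assms(2)
proof (induction as arbitrary: T)
  case (Cons a as)
  have "(\<lambda>y. frame_comp (e y) (\<lambda>bs. T (i # bs) y) as) differentiable (at x)" for i
    by (rule Cons.IH) (rule Cons.prems)
  then show ?case using assms(1)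
    by (auto intro!: differentiable_sum differentiable_mult)
qed simp

lemma sum_kronecker:
  fixes i :: "'a::finite" and f :: "'a \<Rightarrow> real"
  shows "(\<Sum>j\<in>UNIV. (if i = j then 1 else 0) * f j) = f i"
    and "(\<Sum>j\<in>UNIV. (if j = i then 1 else 0) * f j) = f i"
proof -
  have "(if i = j then 1 else 0) * f j = (if i = j then f j else 0)"
    "(if j = i then 1 else 0) * f j = (if j = i then f j else 0)" for j by simp_all
  then show "(\<Sum>j\<in>UNIV. (if i = j then 1 else 0) * f j) = f i"
    "(\<Sum>j\<in>UNIV. (if j = i then 1 else 0) * f j) = f i" by simp_all
qed

text \<open>
  The sum over all lists of length \<open>n\<close>, that is, the full contraction of a tensor product in
  orthonormal components.
\<close>

fun list_sum :: "nat \<Rightarrow> ('n::finite list \<Rightarrow> real) \<Rightarrow> real" where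
  "list_sum 0 f = f []"
| "list_sum (Suc n) f = (\<Sum>a\<in>UNIV. list_sum n (\<lambda>as. f (a # as)))"


lemma list_sum_cmult: "list_sum n (\<lambda>as. c * f as) = c * list_sum n f"
  by (induction n arbitrary: f) (simp_all add: sum_distrib_left)


lemma list_sum_sum: "list_sum n (\<lambda>as. \<Sum>i\<in>(UNIV::'a::finite set). f i as) = (\<Sum>i\<in>UNIV. list_sum n (f i))"
  by (induction n arbitrary: f) (simp_all add: sum.swap[of _ UNIV "UNIV :: 'a set"])

lemma list_sum_frame_comp_orthogonal:
  fixes o' :: "'n::finite \<Rightarrow> real^'n"
  assumes o': "\<And>i j. (\<Sum>a\<in>UNIV. o' a $ i * o' a $ j) = (if i = j then 1 else 0)"
  shows "list_sum n (\<lambda>as. frame_comp o' T as * frame_comp o' V as) = list_sum n (\<lambda>as. T as * V as)"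
proof (induction n arbitrary: T V)
  case (Suc n)
  let ?P = "\<lambda>i j. list_sum n (\<lambda>as. T (i # as) * V (j # as))"
  have "list_sum (Suc n) (\<lambda>as. frame_comp o' T as * frame_comp o' V as)
      = (\<Sum>a\<in>UNIV. \<Sum>i\<in>UNIV. \<Sum>j\<in>UNIV. o' a $ i * o' a $ j *
          list_sum n (\<lambda>as. frame_comp o' (\<lambda>bs. T (i # bs)) as * frame_comp o' (\<lambda>bs. V (j # bs)) as))"
    by (simp add: sum_product list_sum_sum list_sum_cmult[symmetric] mult_ac)
  also have "\<dots> = (\<Sum>a\<in>UNIV. \<Sum>i\<in>UNIV. \<Sum>j\<in>UNIV. o' a $ i * o' a $ j * ?P i j)"
    by (simp add: Suc.IH)
  also have "\<dots> = (\<Sum>i\<in>UNIV. \<Sum>j\<in>UNIV. \<Sum>a\<in>UNIV. o' a $ i * o' a $ j * ?P i j)"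
    by (subst sum.swap) (rule sum.cong[OF refl], rule sum.swap)
  also have "\<dots> = (\<Sum>i\<in>UNIV. \<Sum>j\<in>UNIV. (if i = j then 1 else 0) * ?P i j)"
    by (simp only: sum_distrib_right[symmetric] o')
  also have "\<dots> = (\<Sum>i\<in>UNIV. ?P i i)"
    by (simp only: sum_kronecker)
  finally show ?case by simp
qed simp

section \<open>Orthonormal frames\<close>

definition metric_ip :: "real^'n^'n \<Rightarrow> real^'n \<Rightarrow> real^'n \<Rightarrow> real" where
  "metric_ip A u v = u \<bullet> (A *v v)"

lemma metric_ip_expand: "metric_ip A u v = (\<Sum>i\<in>UNIV. \<Sum>j\<in>UNIV. u $ i * A $ i $ j * v $ j)"
  by (simp add: metric_ip_def inner_vec_def matrix_vector_mult_def sum_distrib_left mult.assoc)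

lemma metric_ip_diff_left: "metric_ip A (u - w) v = metric_ip A u v - metric_ip A w v"
  by (simp add: metric_ip_def inner_diff_left)

lemma metric_ip_scaleR_left: "metric_ip A (c *\<^sub>R u) v = c * metric_ip A u v"
  by (simp add: metric_ip_def)

lemma metric_ip_scaleR_right: "metric_ip A u (c *\<^sub>R v) = c * metric_ip A u v"
  by (simp add: metric_ip_def matrix_vector_mult_scaleR)

lemma metric_ip_sum_left: "metric_ip A (\<Sum>a\<in>B. f a) v = (\<Sum>a\<in>B. metric_ip A (f a) v)"
  by (simp add: metric_ip_def inner_sum_left)

definition positive_frame :: "(real^4 \<Rightarrow> real^4^4) \<Rightarrow> real^4 \<Rightarrow> (4 \<Rightarrow> real^4) \<Rightarrow> bool" where
  "positive_frame G x e \<longleftrightarrow> orthonormal_frame G x e \<and> det (\<chi> a i. e a $ i) > 0"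

lemma orthonormal_frame_metric_ip:
  "orthonormal_frame G x e \<longleftrightarrow> (\<forall>a b. metric_ip (G x) (e a) (e b) = (if a = b then 1 else 0))"
  by (simp add: orthonormal_frame_def metric_ip_def)

lemma pd_chain:
  assumes "(g has_real_derivative g') (at (f x))" "f differentiable (at x)"
  shows "pd i (\<lambda>y. g (f y)) x = g' * pd i f x" "(\<lambda>y. g (f y)) differentiable (at x)"
proof -
  have "((\<lambda>y. g (f y)) has_derivative (\<lambda>v. g' * frechet_derivative f (at x) v)) (at x)"
    using has_derivative_compose[of f "frechet_derivative f (at x)" x UNIV g "\<lambda>h. g' * h"] assms
    by (simp add: frechet_derivative_works has_field_derivative_def)
  then show "pd i (\<lambda>y. g (f y)) x = g' * pd i f x" "(\<lambda>y. g (f y)) differentiable (at x)"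
    by (auto simp: pd_eqI differentiable_def) (simp add: pd_def)
qed

lemma eventually_nhds_gt:
  fixes f :: "real^'n \<Rightarrow> real"
  assumes "f differentiable (at x)" "c < f x"
  shows "eventually (\<lambda>y. c < f y) (nhds x)"
proof -
  have "(f \<longlongrightarrow> f x) (nhds x)"
    using differentiable_imp_continuous_within[OF assms(1)]
    by (simp add: isCont_def tendsto_at_iff_tendsto_nhds)
  then show ?thesis using assms(2) by (rule order_tendstoD)
qed

context metric_on
begin

lemma metric_ip_sym: "x \<in> U \<Longrightarrow> metric_ip (G x) u v = metric_ip (G x) v u"
  unfolding metric_ip_expand by (subst sum.swap) (simp add: symG[of x] mult_ac)

definition parallel_at :: "real^4 \<Rightarrow> (real^4 \<Rightarrow> real^4) \<Rightarrow> bool" where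
  "parallel_at x u \<longleftrightarrow> (\<forall>i. (\<lambda>y. u y $ i) differentiable (at x)
     \<and> (\<forall>m. pd m (\<lambda>y. u y $ i) x = - (\<Sum>p\<in>UNIV. Gam i m p x * u x $ p)))"

lemma parallel_at_scaleR:
  assumes "c differentiable (at x)" "\<And>m. pd m c x = 0" "parallel_at x u"
  shows "parallel_at x (\<lambda>y. c y *\<^sub>R u y)"
  using assms unfolding parallel_at_def
  by (simp add: pd_mult differentiable_mult sum_distrib_left mult_ac)

lemma parallel_at_diff:
  assumes "parallel_at x u" "parallel_at x v"
  shows "parallel_at x (\<lambda>y. u y - v y)"
  using assms unfolding parallel_at_def
  by (simp add: pd_diff right_diff_distrib sum_subtractf)

lemma parallel_at_sum:
  assumes "\<And>a. a \<in> A \<Longrightarrow> parallel_at x (u a)"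
  shows "parallel_at x (\<lambda>y. \<Sum>a\<in>A. u a y)"
proof -
  have "(\<Sum>a\<in>A. \<Sum>p\<in>UNIV. Gam i m p x * u a x $ p) = (\<Sum>p\<in>UNIV. Gam i m p x * (\<Sum>a\<in>A. u a x $ p))" for i m
    by (subst sum.swap) (simp add: sum_distrib_left)
  then show ?thesis
    using assms unfolding parallel_at_def
    by (cases "finite A") (simp_all add: pd_sum sum_negf differentiable_sum)
qed

text \<open>
  Only the value and the first derivatives at \<open>x\<close> are prescribed, so an affine field will do.
\<close>

lemma parallel_at_exists: "\<exists>u. parallel_at x u \<and> u x = e"
proof -
  define u where "u y = (\<chi> i. e $ i - (\<Sum>k\<in>UNIV. (y $ k - x $ k) * (\<Sum>p\<in>UNIV. Gam i k p x * e $ p)))" for y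
  have d: "(\<lambda>y. y $ k) differentiable (at x)" "pd m (\<lambda>y. y $ k) x = (if k = m then 1 else 0)" for m k
  proof -
    have D: "((\<lambda>y. y $ k) has_derivative (\<lambda>v. v $ k)) (at x)"
      by (intro bounded_linear_imp_has_derivative bounded_linear_vec_nth)
    then show "(\<lambda>y. y $ k) differentiable (at x)" unfolding differentiable_def by blast
    show "pd m (\<lambda>y. y $ k) x = (if k = m then 1 else 0)"
      by (subst pd_eqI[OF D]) (simp add: axis_def)
  qed
  have d': "(\<lambda>y. y $ k - x $ k) differentiable (at x)" "pd m (\<lambda>y. y $ k - x $ k) x = (if k = m then 1 else 0)" for m k
    using d by (simp_all add: pd_diff)
  let ?c = "\<lambda>i k. \<Sum>p\<in>UNIV. Gam i k p x * e $ p"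
  have s: "(\<lambda>y. \<Sum>k\<in>UNIV. (y $ k - x $ k) * c k) differentiable (at x)" for c :: "4 \<Rightarrow> real"
    using d' by (intro differentiable_sum differentiable_mult) simp_all
  have p: "pd m (\<lambda>y. \<Sum>k\<in>UNIV. (y $ k - x $ k) * c k) x = c m" for m and c :: "4 \<Rightarrow> real"
  proof -
    have "pd m (\<lambda>y. \<Sum>k\<in>UNIV. (y $ k - x $ k) * c k) x = (\<Sum>k\<in>UNIV. (if k = m then 1 else 0) * c k)"
      using d' by (subst pd_sum) (simp_all add: pd_mult differentiable_mult)
    then show ?thesis by (simp only: sum_kronecker)
  qed
  have "parallel_at x u"
    unfolding parallel_at_def u_def using s p by (simp add: pd_diff)
  moreover have "u x = e" by (simp add: u_def vec_eq_iff)
  ultimately show ?thesis by blast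
qed

text \<open>
  The derivative of a parallel frame supplies exactly the connection terms of the covariant derivative.
\<close>

lemma pd_frame_comp_parallel:
  assumes "\<And>a. parallel_at x (\<lambda>y. e y a)" "\<And>as. T as differentiable (at x)"
  shows "pd m (\<lambda>y. frame_comp (e y) (\<lambda>bs. T bs y) as) x = frame_comp (e x) (\<lambda>bs. nabla G T (m # bs) x) as"
  using assms(2)
proof (induction as arbitrary: T)
  case (Cons a as)
  have de: "(\<lambda>y. e y a $ i) differentiable (at x)" for a i
    using assms(1) unfolding parallel_at_def by blast
  have pe: "pd m (\<lambda>y. e y a $ i) x = - (\<Sum>p\<in>UNIV. Gam i m p x * e x a $ p)" for a i
    using assms(1) unfolding parallel_at_def by blast
  have IH: "pd m (\<lambda>y. frame_comp (e y) (\<lambda>bs. T (i # bs) y) as) x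
      = frame_comp (e x) (\<lambda>bs. nabla G (\<lambda>cs. T (i # cs)) (m # bs) x) as" for i
    by (rule Cons.IH) (rule Cons.prems)
  have df: "(\<lambda>y. frame_comp (e y) (\<lambda>bs. T (i # bs) y) as) differentiable (at x)" for i
    by (rule frame_comp_differentiable) (rule de Cons.prems)+
  let ?F = "\<lambda>i. frame_comp (e x) (\<lambda>bs. T (i # bs) x) as"
  have "nabla G T (m # i # bs) x = nabla G (\<lambda>cs. T (i # cs)) (m # bs) x - (\<Sum>p\<in>UNIV. Gam p m i x * T (p # bs) x)" for i bs
    by (simp add: nabla_Cons)
  then have "frame_comp (e x) (\<lambda>bs. nabla G T (m # bs) x) (a # as)
      = (\<Sum>i\<in>UNIV. e x a $ i * (frame_comp (e x) (\<lambda>bs. nabla G (\<lambda>cs. T (i # cs)) (m # bs) x) as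
          - (\<Sum>p\<in>UNIV. Gam p m i x * ?F p)))"
    by (simp add: frame_comp_diff frame_comp_sum frame_comp_cmult)
  also have "\<dots> = (\<Sum>i\<in>UNIV. e x a $ i * frame_comp (e x) (\<lambda>bs. nabla G (\<lambda>cs. T (i # cs)) (m # bs) x) as)
      - (\<Sum>i\<in>UNIV. (\<Sum>p\<in>UNIV. Gam i m p x * e x a $ p) * ?F i)"
  proof -
    have "(\<Sum>i\<in>UNIV. e x a $ i * (\<Sum>p\<in>UNIV. Gam p m i x * ?F p))
        = (\<Sum>i\<in>UNIV. (\<Sum>p\<in>UNIV. Gam i m p x * e x a $ p) * ?F i)"
      unfolding sum_distrib_left sum_distrib_right by (subst sum.swap) (simp add: mult_ac)
    then show ?thesis by (simp add: right_diff_distrib sum_subtractf)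
  qed
  also have "\<dots> = pd m (\<lambda>y. frame_comp (e y) (\<lambda>bs. T bs y) (a # as)) x"
    using de df by (simp add: pd_sum pd_mult differentiable_mult pe IH sum.distrib sum_negf sum_subtractf)
  finally show ?case by simp
qed (simp add: nabla_Cons)

text \<open>
  The metric is parallel. To apply the rule for frames, \<open>u\<close> and \<open>v\<close> are made members of an auxiliary
  frame, which need not consist of independent fields.
\<close>

lemma metric_ip_parallel:
  assumes "x \<in> U" "parallel_at x u" "parallel_at x v"
  shows "(\<lambda>y. metric_ip (G y) (u y) (v y)) differentiable (at x)" "pd m (\<lambda>y. metric_ip (G y) (u y) (v y)) x = 0"
proof -
  \<comment> \<open>The slots 1 and 2 carry \<open>u\<close> and \<open>v\<close>.\<close>
  define e where "e y a = (if a = 1 then u y else v y)" for y and a :: 4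
  have e: "parallel_at x (\<lambda>y. e y a)" for a
    using assms by (cases "a = 1") (simp_all add: e_def)
  have G: "field2 G as differentiable (at x)" for as
    using smooth_on_differentiable[OF smooth_G_entry assms(1)] by (simp add: field2_def[abs_def])
  have *: "metric_ip (G y) (u y) (v y) = frame_comp (e y) (\<lambda>bs. field2 G bs y) [1, 2]" for y
    by (simp add: metric_ip_expand e_def sum_distrib_left mult_ac)
  show "(\<lambda>y. metric_ip (G y) (u y) (v y)) differentiable (at x)"
    unfolding * by (rule frame_comp_differentiable) (use e G in \<open>auto simp: parallel_at_def\<close>)
  show "pd m (\<lambda>y. metric_ip (G y) (u y) (v y)) x = 0"
    unfolding * by (subst pd_frame_comp_parallel[OF e G]) (simp add: nabla_metric[OF assms(1)])
qed

lemma eventually_in_U: "x \<in> U \<Longrightarrow> eventually (\<lambda>y. y \<in> U) (nhds x)"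
  using openU by (rule eventually_nhds_in_open)

text \<open>
  Gram--Schmidt orthonormalisation of fields that are parallel at \<open>x\<close> and orthonormal at \<open>x\<close>. Their inner
  products have vanishing derivative at \<open>x\<close>, so that the process keeps them parallel at \<open>x\<close>.
\<close>

lemma orthonormal_fields_exist:
  assumes x: "x \<in> U" and e: "orthonormal_frame G x e"
  shows "finite A \<Longrightarrow> \<exists>v. (\<forall>a\<in>A. parallel_at x (v a) \<and> v a x = e a)
     \<and> eventually (\<lambda>y. \<forall>a\<in>A. \<forall>b\<in>A. metric_ip (G y) (v a y) (v b y) = (if a = b then 1 else 0)) (nhds x)"
proof (induction A rule: finite_induct)
  case (insert c A)
  then obtain v where v: "\<And>a. a \<in> A \<Longrightarrow> parallel_at x (v a)" "\<And>a. a \<in> A \<Longrightarrow> v a x = e a"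
    and on: "eventually (\<lambda>y. \<forall>a\<in>A. \<forall>b\<in>A. metric_ip (G y) (v a y) (v b y) = (if a = b then 1 else 0)) (nhds x)"
    by blast
  have ee: "metric_ip (G x) (e a) (e b) = (if a = b then 1 else 0)" for a b
    using e by (simp add: orthonormal_frame_metric_ip)
  obtain b where b: "parallel_at x b" "b x = e c" using parallel_at_exists by blast
  define w where "w y = b y - (\<Sum>a\<in>A. metric_ip (G y) (b y) (v a y) *\<^sub>R v a y)" for y
  have weyl_matrix: "parallel_at x w"
    unfolding w_def using metric_ip_parallel[OF x b(1)] v(1)
    by (intro parallel_at_diff b(1) parallel_at_sum parallel_at_scaleR) auto
  have wx: "w x = e c"
  proof -
    have "metric_ip (G x) (e c) (e a) = 0" if "a \<in> A" for a
      using that insert.hyps ee by auto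
    then show ?thesis by (simp add: w_def b v(2))
  qed
  define n where "n y = metric_ip (G y) (w y) (w y)" for y
  have n: "n differentiable (at x)" "pd m n x = 0" "n x = 1" for m
    using metric_ip_parallel[OF x weyl_matrix weyl_matrix] ee wx by (simp_all add: n_def[abs_def])
  have n_pos: "eventually (\<lambda>y. 0 < n y) (nhds x)"
    by (rule eventually_nhds_gt) (use n in simp_all)
  have D: "((\<lambda>t. 1 / sqrt t) has_real_derivative (- 1/2)) (at (n x))"
    unfolding n(3) by (auto intro!: derivative_eq_intros)
  \<comment> \<open>\<open>n\<close> has value 1 and vanishing derivative at \<open>x\<close>, so normalising keeps \<open>w\<close> parallel there.\<close>
  define v' where "v' a = (if a = c then (\<lambda>y. (1 / sqrt (n y)) *\<^sub>R w y) else v a)" for a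
  have v': "v' a = v a" if "a \<in> A" for a using that insert.hyps by (auto simp: v'_def)
  have "parallel_at x (v' c)"
    using pd_chain[OF D n(1)] n(2) weyl_matrix by (auto simp: v'_def intro!: parallel_at_scaleR)
  moreover have "v' c x = e c" by (simp add: v'_def n wx)
  moreover have "eventually (\<lambda>y. \<forall>a\<in>insert c A. \<forall>b\<in>insert c A.
      metric_ip (G y) (v' a y) (v' b y) = (if a = b then 1 else 0)) (nhds x)"
    using on eventually_in_U[OF x] n_pos
  proof (eventually_elim)
    case (elim y)
    then have ny: "0 < n y" by simp
    have 0: "metric_ip (G y) (w y) (v a y) = 0" if "a \<in> A" for a
    proof -
      have "(\<Sum>a'\<in>A. metric_ip (G y) (b y) (v a' y) * metric_ip (G y) (v a' y) (v a y))
          = (\<Sum>a'\<in>A. if a' = a then metric_ip (G y) (b y) (v a' y) else 0)"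
        using elim that by (intro sum.cong) auto
      then show ?thesis
        using that insert.hyps
        by (simp add: w_def metric_ip_diff_left metric_ip_sum_left metric_ip_scaleR_left)
    qed
    have 1: "metric_ip (G y) (v' c y) (v' c y) = 1"
      using ny by (simp add: v'_def metric_ip_scaleR_left metric_ip_scaleR_right n_def[symmetric])
    have 2: "metric_ip (G y) (v' c y) (v a y) = 0" "metric_ip (G y) (v a y) (v' c y) = 0" if "a \<in> A" for a
      using 0[OF that] metric_ip_sym[of y] elim by (simp_all add: v'_def metric_ip_scaleR_left metric_ip_scaleR_right)
    show ?case using 1 2 elim insert.hyps by (auto simp: v')
  qed
  ultimately show ?case using v v' by (intro exI[of _ v']) auto
qed simp

text \<open>
  Fewer than four vectors \<open>G e\<^sub>a\<close> do not span, so there is a further vector orthogonal to all of them.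
\<close>

lemma orthonormal_frame_exists:
  assumes x: "x \<in> U"
  shows "\<exists>e. orthonormal_frame G x e"
proof -
  have "\<exists>e. \<forall>a\<in>A. \<forall>b\<in>A. metric_ip (G x) (e a) (e b) = (if a = b then 1 else 0)" if "finite A" for A :: "4 set"
    using that
  proof (induction A rule: finite_induct)
    case (insert c A)
    then obtain e where e: "\<And>a b. a \<in> A \<Longrightarrow> b \<in> A \<Longrightarrow> metric_ip (G x) (e a) (e b) = (if a = b then 1 else 0)"
      by blast
    let ?W = "(\<lambda>a. G x *v e a) ` A"
    have "card A < 4"
      using insert.hyps psubset_card_mono[of UNIV A] by auto
    then have "dim ?W < DIM(real^4)"
      using dim_le_card'[of ?W] card_image_le[of A "\<lambda>a. G x *v e a"] insert.hyps by simp
    then obtain u where u: "u \<noteq> 0" "\<And>z. z \<in> span ?W \<Longrightarrow> orthogonal u z"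
      using orthogonal_to_subspace_exists[of ?W] by blast
    define n where "n = metric_ip (G x) u u"
    have n: "n > 0" using posG[OF x u(1)] by (simp add: n_def metric_ip_def)
    have 0: "metric_ip (G x) u (e a) = 0" "metric_ip (G x) (e a) u = 0" if "a \<in> A" for a
      using u(2)[of "G x *v e a"] that metric_ip_sym[OF x] by (simp_all add: metric_ip_def orthogonal_def span_base)
    define e' where "e' a = (if a = c then (1 / sqrt n) *\<^sub>R u else e a)" for a
    have "metric_ip (G x) (e' c) (e' c) = 1"
      using n by (simp add: e'_def metric_ip_scaleR_left metric_ip_scaleR_right n_def[symmetric])
    then show ?case
      using 0 e insert.hyps
      by (intro exI[of _ e']) (auto simp: e'_def metric_ip_scaleR_left metric_ip_scaleR_right)
  qed simp
  from this[of UNIV] show ?thesis by (simp add: orthonormal_frame_metric_ip)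
qed

lemma orthonormal_frame_frame: "x \<in> U \<Longrightarrow> orthonormal_frame G x (frame G x)"
  unfolding frame_def using orthonormal_frame_exists by (rule someI_ex)

lemma orthonormal_frame_matrix:
  assumes "orthonormal_frame G x e"
  shows "(\<chi> a i. e a $ i) ** (G x ** transpose (\<chi> a i. e a $ i)) = mat 1"
proof -
  have "(\<Sum>i\<in>UNIV. e a $ i * (\<Sum>j\<in>UNIV. G x $ i $ j * e b $ j)) = (if a = b then 1 else 0)" for a b
    using assms by (simp add: orthonormal_frame_def inner_vec_def matrix_vector_mult_def)
  then show ?thesis
    by (simp add: vec_eq_iff matrix_matrix_mult_def transpose_def mat_def)
qed

lemma ginv_frame:
  assumes "x \<in> U" "orthonormal_frame G x e"
  shows "ginv G x $ i $ j = (\<Sum>a\<in>UNIV. e a $ i * e a $ j)"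
proof -
  let ?E = "(\<chi> a i. e a $ i) :: real^4^4"
  have "(G x ** transpose ?E) ** ?E = mat 1"
    using orthonormal_frame_matrix[OF assms(2)] matrix_left_right_inverse by blast
  then have "G x ** (transpose ?E ** ?E) = mat 1"
    by (simp add: matrix_mul_assoc)
  then have "(transpose ?E ** ?E) ** G x = mat 1"
    using matrix_left_right_inverse by blast
  moreover have "G x ** ginv G x = mat 1"
    using det_G_nonzero[OF assms(1)] unfolding ginv_def by (simp add: invertible_det_nz matrix_inv_right)
  ultimately have "transpose ?E ** ?E = (transpose ?E ** ?E) ** (G x ** ginv G x)"
    by simp
  also have "\<dots> = ((transpose ?E ** ?E) ** G x) ** ginv G x"
    by (simp only: matrix_mul_assoc)
  finally have "transpose ?E ** ?E = ginv G x"
    using \<open>(transpose ?E ** ?E) ** G x = mat 1\<close> by simp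
  then have "ginv G x $ i $ j = (transpose ?E ** ?E) $ i $ j" by simp
  then show ?thesis by (simp add: matrix_matrix_mult_def transpose_def)
qed

lemma det_frame:
  assumes "positive_frame G x e"
  shows "det (G x) > 0" "sqrt (det (G x)) * det (\<chi> a i. e a $ i) = 1"
proof -
  let ?d = "det ((\<chi> a i. e a $ i) :: real^4^4)"
  have "(\<chi> a i. e a $ i) ** (G x ** transpose (\<chi> a i. e a $ i)) = mat 1"
    using assms by (intro orthonormal_frame_matrix) (simp add: positive_frame_def)
  from arg_cong[OF this, of det] have "?d * (det (G x) * ?d) = 1"
    by (simp add: det_mul del: det_transpose) (simp add: det_transpose)
  moreover have d: "?d > 0" using assms by (simp add: positive_frame_def)
  ultimately have *: "det (G x) = (inverse ?d)\<^sup>2"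
    by (simp add: field_simps power2_eq_square)
  then show "det (G x) > 0" using d by simp
  show "sqrt (det (G x)) * ?d = 1" using d by (simp add: *)
qed

text \<open>
  Two orthonormal frames differ by an orthogonal matrix, which drops out of full contractions. Thus the
  unspecified frame in the definition of the norms can be replaced by any other one.
\<close>

lemma list_sum_frame_comp_invariant:
  assumes x: "x \<in> U" and e: "orthonormal_frame G x e" and e': "orthonormal_frame G x e'"
  shows "list_sum n (\<lambda>as. frame_comp e' T as * frame_comp e' V as) = list_sum n (\<lambda>as. frame_comp e T as * frame_comp e V as)"
proof -
  define o' where "o' a = (\<chi> b. metric_ip (G x) (e' a) (e b))" for a
  have gg: "(\<Sum>i\<in>UNIV. G x $ i $ j * ginv G x $ i $ k) = (if j = k then 1 else 0)" for j k
    using G_ginv[OF x, of j k] symG[OF x] by simp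
  have eq: "e' a = (\<Sum>b\<in>UNIV. o' a $ b *\<^sub>R e b)" for a
  proof -
    have "(\<Sum>b\<in>UNIV. o' a $ b * e b $ k) = e' a $ k" for k
    proof -
      have "(\<Sum>b\<in>UNIV. o' a $ b * e b $ k)
          = (\<Sum>i\<in>UNIV. \<Sum>j\<in>UNIV. \<Sum>b\<in>UNIV. e' a $ i * G x $ i $ j * (e b $ j * e b $ k))"
        unfolding o'_def metric_ip_expand vec_lambda_beta sum_distrib_right
        by (subst sum.swap, rule sum.cong[OF refl], subst sum.swap) (simp add: mult_ac)
      also have "\<dots> = (\<Sum>i\<in>UNIV. e' a $ i * (\<Sum>j\<in>UNIV. G x $ i $ j * ginv G x $ j $ k))"
        by (simp add: ginv_frame[OF x e] sum_distrib_left mult_ac)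
      also have "\<dots> = (\<Sum>i\<in>UNIV. if i = k then e' a $ i else 0)"
        by (intro sum.cong) (auto simp: G_ginv[OF x])
      finally show ?thesis by simp
    qed
    then show ?thesis by (simp add: vec_eq_iff)
  qed
  have "frame_comp e' T as = frame_comp o' (frame_comp e T) as" for T as
    unfolding frame_comp_frame_comp eq[symmetric] ..
  moreover have "(\<Sum>a\<in>UNIV. o' a $ b * o' a $ c) = (if b = c then 1 else 0)" for b c
  proof -
    define v where "v b i = (\<Sum>j\<in>UNIV. G x $ i $ j * e b $ j)" for b i
    let ?v = v
    have o: "o' a $ b = (\<Sum>i\<in>UNIV. e' a $ i * ?v b i)" for a b
      by (simp add: o'_def metric_ip_expand v_def sum_distrib_left mult.assoc)
    have "(\<Sum>a\<in>UNIV. o' a $ b * o' a $ c)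
        = (\<Sum>a\<in>UNIV. \<Sum>i\<in>UNIV. \<Sum>k\<in>UNIV. (e' a $ i * e' a $ k) * (?v b i * ?v c k))"
      unfolding o sum_product by (simp add: mult_ac)
    also have "\<dots> = (\<Sum>i\<in>UNIV. \<Sum>k\<in>UNIV. \<Sum>a\<in>UNIV. (e' a $ i * e' a $ k) * (?v b i * ?v c k))"
      by (subst sum.swap) (rule sum.cong[OF refl], rule sum.swap)
    also have "\<dots> = (\<Sum>i\<in>UNIV. \<Sum>k\<in>UNIV. ginv G x $ i $ k * (?v b i * ?v c k))"
      by (simp only: ginv_frame[OF x e'] sum_distrib_right)
    also have "\<dots> = (\<Sum>k\<in>UNIV. ?v c k * (\<Sum>i\<in>UNIV. \<Sum>j\<in>UNIV. ginv G x $ i $ k * G x $ i $ j * e b $ j))"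
      unfolding v_def[of b] by (subst sum.swap) (simp add: sum_distrib_left sum_distrib_right mult_ac)
    also have "\<dots> = (\<Sum>k\<in>UNIV. ?v c k * e b $ k)"
    proof (intro sum.cong[OF refl])
      fix k
      have "(\<Sum>i\<in>UNIV. \<Sum>j\<in>UNIV. ginv G x $ i $ k * G x $ i $ j * e b $ j)
          = (\<Sum>j\<in>UNIV. (\<Sum>i\<in>UNIV. G x $ i $ j * ginv G x $ i $ k) * e b $ j)"
        by (subst sum.swap) (simp add: sum_distrib_right sum_distrib_left mult_ac)
      also have "\<dots> = (\<Sum>j\<in>UNIV. if j = k then e b $ j else 0)"
        unfolding gg by (intro sum.cong) auto
      finally show "?v c k * (\<Sum>i\<in>UNIV. \<Sum>j\<in>UNIV. ginv G x $ i $ k * G x $ i $ j * e b $ j) = ?v c k * e b $ k"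
        by simp
    qed
    also have "\<dots> = metric_ip (G x) (e b) (e c)"
      by (simp add: metric_ip_expand v_def sum_distrib_left sum_distrib_right mult_ac)
    finally show ?thesis using e by (simp add: orthonormal_frame_metric_ip)
  qed
  ultimately show ?thesis using list_sum_frame_comp_orthogonal[of o' n] by simp
qed

lemma positive_frame_exists:
  assumes x: "x \<in> U"
  shows "\<exists>e. positive_frame G x e"
proof -
  obtain e where e: "orthonormal_frame G x e" using orthonormal_frame_exists[OF x] by blast
  let ?E = "\<lambda>e. (\<chi> a i. e a $ i) :: real^4^4"
  have nz: "det (?E e) \<noteq> 0"
    using arg_cong[OF orthonormal_frame_matrix[OF e], of det] by (auto simp: det_mul)
  show ?thesis
  proof (cases "det (?E e) > 0")
    case True
    then show ?thesis using e by (auto simp: positive_frame_def)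
  next
    case False
    \<comment> \<open>Reversing one vector changes the orientation.\<close>
    define e' where "e' a = (if a = 1 then - e a else e a)" for a
    have "orthonormal_frame G x e'"
    proof -
      have "e' a = (if a = 1 then -1 else 1) *\<^sub>R e a" for a by (simp add: e'_def)
      then show ?thesis
        using e by (simp add: orthonormal_frame_metric_ip metric_ip_scaleR_left metric_ip_scaleR_right)
    qed
    moreover have "det (?E e') = - det (?E e)"
    proof -
      have "?E e' = (\<chi> a. if a = 1 then (-1) *s e a else e a)"
        by (simp add: e'_def vec_eq_iff)
      moreover have "?E e = (\<chi> a. if a = 1 then e a else e a)"
        by (simp add: vec_eq_iff)
      ultimately show ?thesis using det_row_mul[of 1 "-1" e e] by simp
    qed
    ultimately show ?thesis using False nz unfolding positive_frame_def by (intro exI[of _ e']) auto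
  qed
qed

text \<open>
  Parallel at \<open>x\<close> only: orthonormal frames that are parallel near \<open>x\<close> exist just for flat metrics.
\<close>

definition adapted_frame :: "real^4 \<Rightarrow> (real^4 \<Rightarrow> 4 \<Rightarrow> real^4) \<Rightarrow> bool" where
  "adapted_frame x e \<longleftrightarrow> (\<forall>a. parallel_at x (\<lambda>y. e y a)) \<and> eventually (\<lambda>y. positive_frame G y (e y)) (nhds x)"

lemma adapted_frame_exists:
  assumes x: "x \<in> U" and e: "positive_frame G x e"
  shows "\<exists>v. adapted_frame x v \<and> v x = e"
proof -
  obtain v where v: "\<And>a. parallel_at x (v a)" "\<And>a. v a x = e a"
    and on: "eventually (\<lambda>y. \<forall>a b. metric_ip (G y) (v a y) (v b y) = (if a = b then 1 else 0)) (nhds x)"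
    using orthonormal_fields_exist[OF x, of e UNIV] e unfolding positive_frame_def by auto
  define w where "w y a = v a y" for y a
  have "(\<lambda>y. det ((\<chi> a i. w y a $ i) :: real^4^4)) differentiable (at x)"
  proof -
    have "(\<lambda>y. \<Prod>i\<in>UNIV. w y i $ p i) differentiable (at x)" for p :: "4 \<Rightarrow> 4"
    proof -
      have "(\<lambda>y. \<Prod>i\<in>A. w y i $ p i) differentiable (at x)" if "finite A" for A
        using that v(1) unfolding parallel_at_def w_def
        by (induction A) (auto intro!: differentiable_mult)
      then show ?thesis by simp
    qed
    then show ?thesis
      unfolding det_def by (intro differentiable_sum differentiable_mult) simp_all
  qed
  moreover have "0 < det ((\<chi> a i. w x a $ i) :: real^4^4)"
    using e v(2) by (simp add: w_def positive_frame_def)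
  ultimately have "eventually (\<lambda>y. 0 < det ((\<chi> a i. w y a $ i) :: real^4^4)) (nhds x)"
    by (rule eventually_nhds_gt)
  with on have "eventually (\<lambda>y. positive_frame G y (w y)) (nhds x)"
    by eventually_elim (simp add: positive_frame_def orthonormal_frame_metric_ip w_def)
  then show ?thesis
    using v by (intro exI[of _ w]) (auto simp: adapted_frame_def w_def)
qed

end

section \<open>Self-dual bivectors in an orthonormal frame\<close>

lemma vector_4_nth:
  "(vector [a, b, c, d] :: ('a::zero)^4) $ 1 = a" "(vector [a, b, c, d] :: ('a::zero)^4) $ 2 = b"
  "(vector [a, b, c, d] :: ('a::zero)^4) $ 3 = c" "(vector [a, b, c, d] :: ('a::zero)^4) $ 4 = d"
  unfolding vector_def by simp_all

lemma det_vector_swap: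
  fixes a b c d :: "real^4"
  shows "det (vector [b, a, c, d] :: real^4^4) = - det (vector [a, b, c, d] :: real^4^4)"
    and "det (vector [a, c, b, d] :: real^4^4) = - det (vector [a, b, c, d] :: real^4^4)"
    and "det (vector [a, b, d, c] :: real^4^4) = - det (vector [a, b, c, d] :: real^4^4)"
proof -
  let ?A = "vector [a, b, c, d] :: real^4^4"
  have swap: "det (\<chi> r. ?A $ Transposition.transpose i j r) = - det ?A" if "i \<noteq> j" for i j
    using det_permute_rows[of "Transposition.transpose i j" ?A] that
    by (simp add: sign_swap_id permutes_swap_id)
  have "vector [b, a, c, d] = (\<chi> r. ?A $ Transposition.transpose 1 2 r)"
    "vector [a, c, b, d] = (\<chi> r. ?A $ Transposition.transpose 2 3 r)"
    "vector [a, b, d, c] = (\<chi> r. ?A $ Transposition.transpose 3 4 r)"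
    by (simp_all add: vec_eq_iff forall_4 vector_4_nth Transposition.transpose_def)
  then show "det (vector [b, a, c, d] :: real^4^4) = - det ?A"
    "det (vector [a, c, b, d] :: real^4^4) = - det ?A"
    "det (vector [a, b, d, c] :: real^4^4) = - det ?A"
    using swap[of 1 2] swap[of 2 3] swap[of 3 4] by simp_all
qed

text \<open>
  The Levi-Civita symbol.
\<close>

definition eps :: "4 \<Rightarrow> 4 \<Rightarrow> 4 \<Rightarrow> 4 \<Rightarrow> real" where
  "eps i j k l = det (vector [axis i 1, axis j 1, axis k 1, axis l 1] :: real^4^4)"

lemma eps_swap:
  "eps j i k l = - eps i j k l" "eps i k j l = - eps i j k l" "eps i j l k = - eps i j k l"
  unfolding eps_def by (rule det_vector_swap)+

lemma eps_same [simp]: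
  "eps i i k l = 0" "eps i j i l = 0" "eps i j k i = 0" "eps i j j l = 0" "eps i j k j = 0" "eps i j k k = 0"
proof -
  show *: "eps i i k l = 0" "eps i j j l = 0" "eps i j k k = 0" for i j k l
    using eps_swap(1)[of i i k l] eps_swap(2)[of i j j l] eps_swap(3)[of i j k k] by simp_all
  show **: "eps i j i l = 0" "eps i j k j = 0" for i j k l
    using eps_swap(2)[of i i j l] eps_swap(3)[of i j j k] * by simp_all
  show "eps i j k i = 0"
    using eps_swap(3)[of i j i k] ** by simp
qed

lemma eps_1234: "eps 1 2 3 4 = 1"
proof -
  have "(vector [axis 1 1, axis 2 1, axis 3 1, axis 4 1] :: real^4^4) = mat 1"
    by (simp add: vec_eq_iff forall_4 vector_4_nth mat_def axis_def)
  then show ?thesis by (simp add: eps_def)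
qed

lemma eps_values [simp]:
  "eps 1 2 3 4 = 1" "eps 1 2 4 3 = -1" "eps 1 3 2 4 = -1" "eps 1 3 4 2 = 1" "eps 1 4 2 3 = 1" "eps 1 4 3 2 = -1"
  "eps 2 1 3 4 = -1" "eps 2 1 4 3 = 1" "eps 2 3 1 4 = 1" "eps 2 3 4 1 = -1" "eps 2 4 1 3 = -1" "eps 2 4 3 1 = 1"
  "eps 3 1 2 4 = 1" "eps 3 1 4 2 = -1" "eps 3 2 1 4 = -1" "eps 3 2 4 1 = 1" "eps 3 4 1 2 = 1" "eps 3 4 2 1 = -1"
  "eps 4 1 2 3 = -1" "eps 4 1 3 2 = 1" "eps 4 2 1 3 = 1" "eps 4 2 3 1 = -1" "eps 4 3 1 2 = -1" "eps 4 3 2 1 = 1"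
proof -
  show 1: "eps 1 2 3 4 = 1" by (rule eps_1234)
  show 2: "eps 1 2 4 3 = -1" "eps 1 3 2 4 = -1" "eps 2 1 3 4 = -1"
    using 1 eps_swap(3)[of 1 2 3 4] eps_swap(2)[of 1 2 3 4] eps_swap(1)[of 1 2 3 4] by simp_all
  show 3: "eps 1 3 4 2 = 1" "eps 3 1 2 4 = 1" "eps 1 4 2 3 = 1" "eps 2 1 4 3 = 1" "eps 2 3 1 4 = 1"
    using 2 eps_swap(3)[of 1 3 2 4] eps_swap(1)[of 1 3 2 4] eps_swap(2)[of 1 2 4 3]
      eps_swap(1)[of 1 2 4 3] eps_swap(2)[of 2 1 3 4] by simp_all
  show 4: "eps 1 4 3 2 = -1" "eps 3 1 4 2 = -1" "eps 3 2 1 4 = -1" "eps 4 1 2 3 = -1" "eps 2 4 1 3 = -1" "eps 2 3 4 1 = -1"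
    using 3 eps_swap(2)[of 1 3 4 2] eps_swap(1)[of 1 3 4 2] eps_swap(2)[of 3 1 2 4]
      eps_swap(1)[of 1 4 2 3] eps_swap(2)[of 2 1 4 3] eps_swap(3)[of 2 3 1 4] by simp_all
  show 5: "eps 4 1 3 2 = 1" "eps 3 4 1 2 = 1" "eps 3 2 4 1 = 1" "eps 4 2 1 3 = 1" "eps 2 4 3 1 = 1"
    using 4 eps_swap(1)[of 1 4 3 2] eps_swap(2)[of 3 1 4 2] eps_swap(3)[of 3 2 1 4]
      eps_swap(2)[of 4 1 2 3] eps_swap(3)[of 2 4 1 3] by simp_all
  show 6: "eps 4 3 1 2 = -1" "eps 3 4 2 1 = -1" "eps 4 2 3 1 = -1"
    using 5 eps_swap(2)[of 4 1 3 2] eps_swap(3)[of 3 4 1 2] eps_swap(3)[of 4 2 1 3] by simp_all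
  show "eps 4 3 2 1 = 1" using 6 eps_swap(3)[of 4 3 1 2] by simp
qed

text \<open>
  The forms \<open>phi p = e\<^sub>p \<and> e\<^sub>4 + \<star>(e\<^sub>p \<and> e\<^sub>4)\<close> span the self-dual bivectors and have length \<open>\<surd>2\<close>.
\<close>

definition phi :: "3 \<Rightarrow> 4 \<Rightarrow> 4 \<Rightarrow> real" where
  "phi p a b = (let q = (if p = 1 then 1 else if p = 2 then 2 else 3) in
     (if q = a \<and> b = 4 then 1 else 0) - (if q = b \<and> a = 4 then 1 else 0) + eps q 4 a b)"

lemma phi_antisym: "phi p b a = - phi p a b"
  unfolding phi_def Let_def by (subst eps_swap(3)) simp

lemma phi_sum:
  "(\<Sum>a\<in>UNIV. \<Sum>b\<in>UNIV. X a b * phi 1 a b) = X 1 4 - X 4 1 + X 2 3 - X 3 2"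
  "(\<Sum>a\<in>UNIV. \<Sum>b\<in>UNIV. X a b * phi 2 a b) = X 2 4 - X 4 2 + X 3 1 - X 1 3"
  "(\<Sum>a\<in>UNIV. \<Sum>b\<in>UNIV. X a b * phi 3 a b) = X 3 4 - X 4 3 + X 1 2 - X 2 1"
  by (simp_all add: phi_def sum_4 del: One_nat_def)

text \<open>
  Up to a factor both sides are the components of the projection \<open>(1 + \<star>)/2\<close>.
\<close>

lemma phi_complete:
  "(\<Sum>p\<in>UNIV. phi p a b * phi p c d)
    = (if a = c \<and> b = d then 1 else 0) - (if a = d \<and> b = c then 1 else 0) + eps a b c d"
proof -
  have "\<forall>a b c d. (\<Sum>p\<in>UNIV. phi p a b * phi p c d)
    = (if a = c \<and> b = d then 1 else 0) - (if a = d \<and> b = c then 1 else 0) + eps a b c d"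
    by (simp add: forall_4 sum_3 phi_def)
  then show ?thesis by blast
qed

lemma phi_orthogonal: "(\<Sum>a\<in>UNIV. \<Sum>b\<in>UNIV. phi p a b * phi q a b) = (if p = q then 4 else 0)"
proof -
  have "\<forall>p q. (\<Sum>a\<in>UNIV. \<Sum>b\<in>UNIV. phi p a b * phi q a b) = (if p = q then 4 else 0)"
    by (simp add: forall_3 phi_sum) (simp add: phi_def)
  then show ?thesis by blast
qed

text \<open>
  The \<open>\<Lambda>\<^sub>2\<^sup>+\<close> block of the operator of \<open>T\<close> in the orthonormal basis \<open>\<phi>\<^sub>p / \<surd>2\<close>. The full sum counts both
  pairs of indices twice, and normalising both basis vectors gives another factor \<open>1/2\<close>.
\<close>

definition sd_pairing :: "tensor4 \<Rightarrow> 3 \<Rightarrow> 3 \<Rightarrow> real" where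
  "sd_pairing T p q = (\<Sum>a\<in>UNIV. \<Sum>b\<in>UNIV. \<Sum>c\<in>UNIV. \<Sum>d\<in>UNIV. T a b c d * phi p a b * phi q c d) / 8"

lemma sd_pairing_add: "sd_pairing (\<lambda>a b c d. S a b c d + T a b c d) p q = sd_pairing S p q + sd_pairing T p q"
  by (simp add: sd_pairing_def sum.distrib distrib_right add_divide_distrib)

lemma sd_pairing_cmult: "sd_pairing (\<lambda>a b c d. k * T a b c d) p q = k * sd_pairing T p q"
  by (simp add: sd_pairing_def sum_distrib_left mult_ac)

lemma sd_pairing_diff: "sd_pairing (\<lambda>a b c d. S a b c d - T a b c d) p q = sd_pairing S p q - sd_pairing T p q"
  using sd_pairing_add[of S "\<lambda>a b c d. (-1) * T a b c d"] sd_pairing_cmult[of "-1" T] by simp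

definition antisym_pairs :: "tensor4 \<Rightarrow> bool" where
  "antisym_pairs T \<longleftrightarrow> (\<forall>a b c d. T a b c d = - T b a c d \<and> T a b c d = - T a b d c)"

lemma antisym_pairsD:
  "antisym_pairs T \<Longrightarrow> T a b c d = - T b a c d" "antisym_pairs T \<Longrightarrow> T a b c d = - T a b d c"
  unfolding antisym_pairs_def by blast+

lemma sd_pairing_eq:
  assumes T: "antisym_pairs T"
  shows "sd_pairing T 1 1 = (T 1 4 1 4 + T 1 4 2 3 + T 2 3 1 4 + T 2 3 2 3) / 2"
    and "sd_pairing T 1 2 = (T 1 4 2 4 - T 1 4 1 3 + T 2 3 2 4 - T 2 3 1 3) / 2"
    and "sd_pairing T 1 3 = (T 1 4 3 4 + T 1 4 1 2 + T 2 3 3 4 + T 2 3 1 2) / 2"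
    and "sd_pairing T 2 1 = (T 2 4 1 4 + T 2 4 2 3 - T 1 3 1 4 - T 1 3 2 3) / 2"
    and "sd_pairing T 2 2 = (T 2 4 2 4 - T 2 4 1 3 - T 1 3 2 4 + T 1 3 1 3) / 2"
    and "sd_pairing T 2 3 = (T 2 4 3 4 + T 2 4 1 2 - T 1 3 3 4 - T 1 3 1 2) / 2"
    and "sd_pairing T 3 1 = (T 3 4 1 4 + T 3 4 2 3 + T 1 2 1 4 + T 1 2 2 3) / 2"
    and "sd_pairing T 3 2 = (T 3 4 2 4 - T 3 4 1 3 + T 1 2 2 4 - T 1 2 1 3) / 2"
    and "sd_pairing T 3 3 = (T 3 4 3 4 + T 3 4 1 2 + T 1 2 3 4 + T 1 2 1 2) / 2"
proof -
  note [simp] = T[THEN antisym_pairsD(1), of 2 1] T[THEN antisym_pairsD(1), of 3 1] T[THEN antisym_pairsD(1), of 4 1]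
    T[THEN antisym_pairsD(1), of 3 2] T[THEN antisym_pairsD(1), of 4 2] T[THEN antisym_pairsD(1), of 4 3]
    T[THEN antisym_pairsD(2), of _ _ 2 1] T[THEN antisym_pairsD(2), of _ _ 3 1] T[THEN antisym_pairsD(2), of _ _ 4 1]
    T[THEN antisym_pairsD(2), of _ _ 3 2] T[THEN antisym_pairsD(2), of _ _ 4 2] T[THEN antisym_pairsD(2), of _ _ 4 3]
  have *: "sd_pairing T p q = (\<Sum>c\<in>UNIV. \<Sum>d\<in>UNIV. (\<Sum>a\<in>UNIV. \<Sum>b\<in>UNIV. T a b c d * phi p a b) * phi q c d) / 8" for p q
  proof -
    have "(\<Sum>c\<in>UNIV. \<Sum>d\<in>UNIV. (\<Sum>a\<in>UNIV. \<Sum>b\<in>UNIV. T a b c d * phi p a b) * phi q c d)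
      = (\<Sum>c\<in>UNIV. \<Sum>a\<in>UNIV. \<Sum>b\<in>UNIV. \<Sum>d\<in>UNIV. T a b c d * phi p a b * phi q c d)"
      unfolding sum_distrib_right
      by (rule sum.cong[OF refl], subst sum.swap, rule sum.cong[OF refl], rule sum.swap)
    also have "\<dots> = (\<Sum>a\<in>UNIV. \<Sum>b\<in>UNIV. \<Sum>c\<in>UNIV. \<Sum>d\<in>UNIV. T a b c d * phi p a b * phi q c d)"
      by (subst sum.swap, rule sum.cong[OF refl], rule sum.swap)
    finally show ?thesis unfolding sd_pairing_def by simp
  qed
  show "sd_pairing T 1 1 = (T 1 4 1 4 + T 1 4 2 3 + T 2 3 1 4 + T 2 3 2 3) / 2"
    "sd_pairing T 1 2 = (T 1 4 2 4 - T 1 4 1 3 + T 2 3 2 4 - T 2 3 1 3) / 2"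
    "sd_pairing T 1 3 = (T 1 4 3 4 + T 1 4 1 2 + T 2 3 3 4 + T 2 3 1 2) / 2"
    "sd_pairing T 2 1 = (T 2 4 1 4 + T 2 4 2 3 - T 1 3 1 4 - T 1 3 2 3) / 2"
    "sd_pairing T 2 2 = (T 2 4 2 4 - T 2 4 1 3 - T 1 3 2 4 + T 1 3 1 3) / 2"
    "sd_pairing T 2 3 = (T 2 4 3 4 + T 2 4 1 2 - T 1 3 3 4 - T 1 3 1 2) / 2"
    "sd_pairing T 3 1 = (T 3 4 1 4 + T 3 4 2 3 + T 1 2 1 4 + T 1 2 2 3) / 2"
    "sd_pairing T 3 2 = (T 3 4 2 4 - T 3 4 1 3 + T 1 2 2 4 - T 1 2 1 3) / 2"
    "sd_pairing T 3 3 = (T 3 4 3 4 + T 3 4 1 2 + T 1 2 3 4 + T 1 2 1 2) / 2"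
    unfolding * phi_sum by simp_all
qed

definition Ric :: "tensor4 \<Rightarrow> 4 \<Rightarrow> 4 \<Rightarrow> real" where
  "Ric T a c = (\<Sum>b\<in>UNIV. T a b c b)"

definition Sc :: "tensor4 \<Rightarrow> real" where
  "Sc T = (\<Sum>a\<in>UNIV. Ric T a a)"

definition kn_product :: "(4 \<Rightarrow> 4 \<Rightarrow> real) \<Rightarrow> (4 \<Rightarrow> 4 \<Rightarrow> real) \<Rightarrow> tensor4" where
  "kn_product A B i j k l = A i k * B j l + A j l * B i k - A i l * B j k - A j k * B i l"

lemma antisym_pairs_kn_product: "antisym_pairs (kn_product A B)"
  unfolding antisym_pairs_def kn_product_def by simp

text \<open>
  For a curvature tensor \<open>T\<close> this is the matrix of \<open>W\<^sup>+\<close> in the same basis.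
\<close>

definition weyl_matrix :: "tensor4 \<Rightarrow> 3 \<Rightarrow> 3 \<Rightarrow> real" where
  "weyl_matrix T p q = sd_pairing T p q - (if p = q then Sc T / 12 else 0)"

text \<open>
  The quadratic terms that the commutator of two covariant derivatives produces in the Laplacian of the
  curvature, except for those with the Ricci tensor.
\<close>

definition curv_quadratic :: "tensor4 \<Rightarrow> tensor4" where
  "curv_quadratic R a b c d = (\<Sum>e\<in>UNIV. \<Sum>m\<in>UNIV. R e a b m * R e m c d + R e a c m * R e b m d + R e a d m * R e b c m)"

definition curvature_like :: "tensor4 \<Rightarrow> bool" where
  "curvature_like R \<longleftrightarrow> antisym_pairs R \<and> (\<forall>a b c d. R a b c d = R c d a b)"

lemma sd_pairing_kn_product_delta:
  assumes h: "\<And>a b. h a b = h b a"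
  shows "sd_pairing (kn_product h (\<lambda>a b. if a = b then 1 else 0)) p q = (if p = q then (\<Sum>a\<in>UNIV. h a a) / 2 else 0)"
proof -
  have "\<forall>p q. sd_pairing (kn_product h (\<lambda>a b. if a = b then 1 else 0)) p q = (if p = q then (\<Sum>a\<in>UNIV. h a a) / 2 else 0)"
    unfolding forall_3 sd_pairing_eq[OF antisym_pairs_kn_product]
    by (simp add: kn_product_def sum_4 h[of 2 1] h[of 3 1] h[of 4 1] h[of 3 2] h[of 4 2] h[of 4 3])
  then show ?thesis by blast
qed

section \<open>The cubic identity\<close>

text \<open>
  Rules that reduce all components to the twenty independent ones; the Bianchi identity eliminates
  \<open>R\<^sub>1\<^sub>4\<^sub>2\<^sub>3\<close>.
\<close>

lemma curvature_normal_forms: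
  assumes R: "curvature_like R" and B: "\<And>i j k l. R i j k l + R j l k i + R l i k j = 0"
  shows "R 1 4 2 3 = R 1 3 2 4 - R 1 2 3 4"
    and "R 1 3 1 2 = R 1 2 1 3" and "R 1 4 1 2 = R 1 2 1 4" and "R 2 3 1 2 = R 1 2 2 3" and "R 2 4 1 2 = R 1 2 2 4"
    and "R 3 4 1 2 = R 1 2 3 4" and "R 1 4 1 3 = R 1 3 1 4" and "R 2 3 1 3 = R 1 3 2 3" and "R 2 4 1 3 = R 1 3 2 4"
    and "R 3 4 1 3 = R 1 3 3 4" and "R 2 3 1 4 = R 1 3 2 4 - R 1 2 3 4" and "R 2 4 1 4 = R 1 4 2 4" and "R 3 4 1 4 = R 1 4 3 4"
    and "R 2 4 2 3 = R 2 3 2 4" and "R 3 4 2 3 = R 2 3 3 4" and "R 3 4 2 4 = R 2 4 3 4"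
    and "R i i k l = 0" and "R i j k k = 0"
    and "R 2 1 k l = - R 1 2 k l" and "R 3 1 k l = - R 1 3 k l" and "R 4 1 k l = - R 1 4 k l"
    and "R 3 2 k l = - R 2 3 k l" and "R 4 2 k l = - R 2 4 k l" and "R 4 3 k l = - R 3 4 k l"
    and "R k l 2 1 = - R k l 1 2" and "R k l 3 1 = - R k l 1 3" and "R k l 4 1 = - R k l 1 4"
    and "R k l 3 2 = - R k l 2 3" and "R k l 4 2 = - R k l 2 4" and "R k l 4 3 = - R k l 3 4"
proof -
  have p: "R a b c d = R c d a b" and a1: "R a b c d = - R b a c d" and a2: "R a b c d = - R a b d c" for a b c d
    using R unfolding curvature_like_def antisym_pairs_def by blast+
  show *: "R 1 4 2 3 = R 1 3 2 4 - R 1 2 3 4"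
    using B[of 1 2 3 4] p[of 1 3 2 4] a1[of 3 1 2 4] a2[of 2 4 3 1] p[of 2 4 1 3] a1[of 4 1 3 2] a2[of 1 4 3 2] by linarith
  show "R 2 3 1 4 = R 1 3 2 4 - R 1 2 3 4" using * p[of 2 3 1 4] by simp
  show "R i i k l = 0" "R i j k k = 0" using a1[of i i k l] a2[of i j k k] by simp_all
qed (rule R[unfolded curvature_like_def, THEN conjunct2, rule_format] R[unfolded curvature_like_def, THEN conjunct1, THEN antisym_pairsD(1)] R[unfolded curvature_like_def, THEN conjunct1, THEN antisym_pairsD(2)])+

definition curv_reaction :: "tensor4 \<Rightarrow> tensor4" where
  "curv_reaction R a b c d = curv_quadratic R a b c d - curv_quadratic R b a c d"

lemma antisym_pairs_curv_reaction:
  assumes "antisym_pairs R"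
  shows "antisym_pairs (curv_reaction R)"
proof -
  note a = assms[THEN antisym_pairsD(2)]
  have "curv_quadratic R a b d c = - curv_quadratic R a b c d" for a b c d
  proof -
    have "curv_quadratic R a b d c = (\<Sum>e\<in>UNIV. \<Sum>m\<in>UNIV. - (R e a b m * R e m c d + R e a c m * R e b m d + R e a d m * R e b c m))"
      unfolding curv_quadratic_def
    proof (intro sum.cong refl)
      fix e m
      show "R e a b m * R e m d c + R e a d m * R e b m c + R e a c m * R e b d m
        = - (R e a b m * R e m c d + R e a c m * R e b m d + R e a d m * R e b c m)"
        unfolding a[of e m d c] a[of e b m c] a[of e b d m] by (simp add: algebra_simps)
    qed
    then show ?thesis unfolding curv_quadratic_def[of R a b c d] sum_negf .
  qed
  note * = this
  show ?thesis
    unfolding antisym_pairs_def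
  proof (intro allI conjI)
    fix a b c d
    show "curv_reaction R a b c d = - curv_reaction R b a c d" by (simp add: curv_reaction_def)
    show "curv_reaction R a b c d = - curv_reaction R a b d c"
      using *[of a b c d] *[of b a c d] by (simp add: curv_reaction_def)
  qed
qed

lemma trace_weyl_matrix:
  assumes R: "curvature_like R" and B: "\<And>i j k l. R i j k l + R j l k i + R l i k j = 0"
  shows "weyl_matrix R 1 1 + weyl_matrix R 2 2 + weyl_matrix R 3 3 = 0"
proof -
  note N = curvature_normal_forms[OF R B]
  have A: "antisym_pairs R" using R by (simp add: curvature_like_def)
  show ?thesis
    by (simp add: weyl_matrix_def sd_pairing_eq[OF A] Sc_def Ric_def sum_4 N field_simps del: One_nat_def)
qed

lemma weyl_matrix_sym:
  assumes "\<And>a b c d. R a b c d = R c d a b"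
  shows "weyl_matrix R p q = weyl_matrix R q p"
proof -
  have "sd_pairing R p q = sd_pairing R q p" for p q
  proof -
    have "(\<Sum>a\<in>UNIV. \<Sum>b\<in>UNIV. \<Sum>c\<in>UNIV. \<Sum>d\<in>UNIV. R a b c d * phi p a b * phi q c d)
        = (\<Sum>a\<in>UNIV. \<Sum>c\<in>UNIV. \<Sum>b\<in>UNIV. \<Sum>d\<in>UNIV. R a b c d * phi p a b * phi q c d)"
      by (rule sum.cong[OF refl], rule sum.swap)
    also have "\<dots> = (\<Sum>c\<in>UNIV. \<Sum>a\<in>UNIV. \<Sum>d\<in>UNIV. \<Sum>b\<in>UNIV. R a b c d * phi p a b * phi q c d)"
      by (subst sum.swap, rule sum.cong[OF refl], rule sum.cong[OF refl], rule sum.swap)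
    also have "\<dots> = (\<Sum>c\<in>UNIV. \<Sum>d\<in>UNIV. \<Sum>a\<in>UNIV. \<Sum>b\<in>UNIV. R c d a b * phi q c d * phi p a b)"
      by (rule sum.cong[OF refl], subst sum.swap, intro sum.cong[OF refl], subst assms) simp
    finally show ?thesis by (simp add: sd_pairing_def)
  qed
  then show ?thesis by (auto simp: weyl_matrix_def)
qed

text \<open>
  The symmetric matrix \<open>F + 12 w\<^sup>2\<close> is a multiple of the identity: its off-diagonal entries vanish and its
  diagonal entries agree. Each of these claims is an identity between quadratic polynomials in the twenty
  independent components of \<open>R\<close>. The curvature of \<open>\<Lambda>\<^sub>2\<^sup>-\<close> has cancelled, and the mixed block, which is the
  trace-free Ricci tensor, is absorbed by \<open>Rc \<circ> Rc\<close>.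
\<close>

lemma quadratic_identities:
  assumes R: "curvature_like R" and B: "\<And>i j k l. R i j k l + R j l k i + R l i k j = 0"
  defines "F \<equiv> \<lambda>p q. 2 * sd_pairing (curv_reaction R) p q + sd_pairing (kn_product (Ric R) (Ric R)) p q"
  defines "w \<equiv> weyl_matrix R"
  shows "F 1 2 = -12 * (w 1 1 * w 1 2 + w 1 2 * w 2 2 + w 1 3 * w 2 3)" (is ?G1)
    and "F 1 3 = -12 * (w 1 1 * w 1 3 + w 1 2 * w 2 3 + w 1 3 * w 3 3)" (is ?G2)
    and "F 2 3 = -12 * (w 1 2 * w 1 3 + w 2 2 * w 2 3 + w 2 3 * w 3 3)" (is ?G3)
    and "F 2 1 = F 1 2" (is ?S1) and "F 3 1 = F 1 3" (is ?S2) and "F 3 2 = F 2 3" (is ?S3)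
    and "F 2 2 - F 1 1 = -12 * ((w 1 2)\<^sup>2 + (w 2 2)\<^sup>2 + (w 2 3)\<^sup>2 - (w 1 1)\<^sup>2 - (w 1 2)\<^sup>2 - (w 1 3)\<^sup>2)" (is ?D2)
    and "F 3 3 - F 1 1 = -12 * ((w 1 3)\<^sup>2 + (w 2 3)\<^sup>2 + (w 3 3)\<^sup>2 - (w 1 1)\<^sup>2 - (w 1 2)\<^sup>2 - (w 1 3)\<^sup>2)" (is ?D3)
proof -
  note N = curvature_normal_forms[OF R B]
  have A: "antisym_pairs R" using R by (simp add: curvature_like_def)
  note E = sd_pairing_eq[OF A] sd_pairing_eq[OF antisym_pairs_curv_reaction[OF A]] sd_pairing_eq[OF antisym_pairs_kn_product]
  note D = F_def w_def weyl_matrix_def E Sc_def curv_reaction_def kn_product_def Ric_def curv_quadratic_def sum_4 power2_eq_square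
  show ?G1 unfolding D by (simp add: N del: One_nat_def) (simp add: field_simps)
  show ?G2 unfolding D by (simp add: N del: One_nat_def) (simp add: field_simps)
  show ?G3 unfolding D by (simp add: N del: One_nat_def) (simp add: field_simps)
  show ?S1 unfolding D by (simp add: N del: One_nat_def) (simp add: field_simps)
  show ?S2 unfolding D by (simp add: N del: One_nat_def) (simp add: field_simps)
  show ?S3 unfolding D by (simp add: N del: One_nat_def) (simp add: field_simps)
  show ?D2 unfolding D by (simp add: N del: One_nat_def) (simp add: field_simps)
  show ?D3 unfolding D by (simp add: N del: One_nat_def) (simp add: field_simps)
qed

text \<open>
  The unknown multiple of the identity in \<open>F = -12 w\<^sup>2 + c I\<close> is orthogonal to the trace-free \<open>w\<close>, for
  which \<open>tr w\<^sup>3 = 3 det w\<close>.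
\<close>

lemma cubic_identity:
  assumes R: "curvature_like R" and B: "\<And>i j k l. R i j k l + R j l k i + R l i k j = 0"
  shows "2 * (\<Sum>p\<in>UNIV. \<Sum>q\<in>UNIV. weyl_matrix R p q * sd_pairing (curv_reaction R) p q)
    = - 36 * det (\<chi> p q. weyl_matrix R p q) - (\<Sum>p\<in>UNIV. \<Sum>q\<in>UNIV. weyl_matrix R p q * sd_pairing (kn_product (Ric R) (Ric R)) p q)"
proof -
  define F where "F p q = 2 * sd_pairing (curv_reaction R) p q + sd_pairing (kn_product (Ric R) (Ric R)) p q" for p q
  define w where "w = weyl_matrix R"
  note Q = quadratic_identities[OF R B, folded F_def w_def]
  have s: "w 2 1 = w 1 2" "w 3 1 = w 1 3" "w 3 2 = w 2 3"
    using R weyl_matrix_sym[of R] by (auto simp: w_def curvature_like_def)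
  have t: "w 3 3 = - w 1 1 - w 2 2"
    using trace_weyl_matrix[OF R B] by (simp add: w_def)
  have D: "F 2 2 = F 1 1 - 12 * ((w 1 2)\<^sup>2 + (w 2 2)\<^sup>2 + (w 2 3)\<^sup>2 - (w 1 1)\<^sup>2 - (w 1 2)\<^sup>2 - (w 1 3)\<^sup>2)"
    "F 3 3 = F 1 1 - 12 * ((w 1 3)\<^sup>2 + (w 2 3)\<^sup>2 + (w 3 3)\<^sup>2 - (w 1 1)\<^sup>2 - (w 1 2)\<^sup>2 - (w 1 3)\<^sup>2)"
    using Q(7,8) by linarith+
  have "(\<Sum>p\<in>UNIV. \<Sum>q\<in>UNIV. w p q * F p q) = - 36 * det (\<chi> p q. w p q)"
    unfolding sum_3 det_3 Q(1-6) D by (simp add: s t) (simp add: algebra_simps power2_eq_square)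
  moreover have "(\<Sum>p\<in>UNIV. \<Sum>q\<in>UNIV. w p q * F p q)
      = 2 * (\<Sum>p\<in>UNIV. \<Sum>q\<in>UNIV. w p q * sd_pairing (curv_reaction R) p q)
        + (\<Sum>p\<in>UNIV. \<Sum>q\<in>UNIV. w p q * sd_pairing (kn_product (Ric R) (Ric R)) p q)"
    by (simp add: F_def distrib_left sum.distrib sum_distrib_left mult_ac)
  ultimately show ?thesis by (simp add: w_def)
qed

section \<open>Determinants of endomorphisms of three-dimensional spaces\<close>

lemma basis_coefficients_unique:
  fixes b :: "'n::finite \<Rightarrow> 'a::real_vector"
  assumes "inj b" "independent (range b)" "(\<Sum>i\<in>UNIV. c i *\<^sub>R b i) = (\<Sum>i\<in>UNIV. d i *\<^sub>R b i)"
  shows "c = d"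
proof -
  have "(\<Sum>i\<in>UNIV. (c i - d i) *\<^sub>R b i) = 0"
    using assms(3) by (simp add: scaleR_left_diff_distrib sum_subtractf)
  then have 0: "(\<Sum>v\<in>range b. (c (inv b v) - d (inv b v)) *\<^sub>R v) = 0"
    using assms(1) by (simp add: sum.reindex)
  have "c (inv b v) - d (inv b v) = 0" if "v \<in> range b" for v
    using assms(2) 0 that independentD[of "range b" "range b" "\<lambda>v. c (inv b v) - d (inv b v)" v] by simp
  then have "c i = d i" for i using assms(1) by (metis eq_iff_diff_eq_0 inv_f_f rangeI)
  then show ?thesis by blast
qed

lemma basis_expansion_exists:
  fixes b :: "'n::finite \<Rightarrow> 'a::real_vector"
  assumes "inj b" "v \<in> span (range b)"
  shows "\<exists>c. v = (\<Sum>i\<in>UNIV. c i *\<^sub>R b i)"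
proof -
  obtain u where "v = (\<Sum>w\<in>range b. u w *\<^sub>R w)"
    using assms(2) by (auto simp: span_finite)
  then have "v = (\<Sum>i\<in>UNIV. u (b i) *\<^sub>R b i)" using assms(1) by (simp add: sum.reindex)
  then show ?thesis by (rule exI[of _ "\<lambda>i. u (b i)"])
qed

text \<open>Matrices of the same endomorphism with respect to two bases are similar.\<close>

lemma det_basis_independent:
  fixes b b' :: "'n::finite \<Rightarrow> 'a::real_vector"
  assumes L: "linear L"
    and b: "inj b" "independent (range b)" and b': "inj b'" "span (range b') = span (range b)"
    and A: "\<And>j. L (b j) = (\<Sum>i\<in>UNIV. A $ i $ j *\<^sub>R b i)"
    and A': "\<And>j. L (b' j) = (\<Sum>i\<in>UNIV. A' $ i $ j *\<^sub>R b' i)"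
  shows "det A' = det (A :: real^'n^'n)"
proof -
  have "\<exists>c. b' j = (\<Sum>i\<in>UNIV. c i *\<^sub>R b i)" for j
    using b(1) b'(2) by (intro basis_expansion_exists) (auto intro: span_base)
  then obtain p where p: "\<And>j. b' j = (\<Sum>i\<in>UNIV. p j i *\<^sub>R b i)" by metis
  have "\<exists>c. b j = (\<Sum>i\<in>UNIV. c i *\<^sub>R b' i)" for j
    using b'(1) b'(2)[symmetric] by (intro basis_expansion_exists) (auto intro: span_base)
  then obtain q where q: "\<And>j. b j = (\<Sum>i\<in>UNIV. q j i *\<^sub>R b' i)" by metis
  define P Q :: "real^'n^'n" where "P = (\<chi> i j. p j i)" and "Q = (\<chi> i j. q j i)"
  have comb: "(\<Sum>i\<in>UNIV. c i *\<^sub>R (\<Sum>k\<in>UNIV. d i k *\<^sub>R b k)) = (\<Sum>k\<in>UNIV. (\<Sum>i\<in>UNIV. c i * d i k) *\<^sub>R b k)" for c d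
    unfolding scaleR_sum_right scaleR_scaleR scaleR_sum_left by (rule sum.swap)
  have "P ** Q = mat 1"
  proof -
    have "(\<Sum>k\<in>UNIV. (\<Sum>i\<in>UNIV. q j i * p i k) *\<^sub>R b k) = (\<Sum>k\<in>UNIV. (if k = j then 1 else 0) *\<^sub>R b k)" for j
    proof -
      have "(\<Sum>k\<in>UNIV. (if k = j then 1 else 0) *\<^sub>R b k) = (\<Sum>k\<in>UNIV. if k = j then b k else 0)"
        by (rule sum.cong) auto
      then have "(\<Sum>k\<in>UNIV. (if k = j then 1 else 0) *\<^sub>R b k) = b j" by simp
      then show ?thesis using q[of j] unfolding p comb by simp
    qed
    then have "(\<lambda>k. \<Sum>i\<in>UNIV. q j i * p i k) = (\<lambda>k. if k = j then 1 else 0)" for j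
      by (rule basis_coefficients_unique[OF b])
    then have *: "(\<Sum>i\<in>UNIV. q j i * p i k) = (if k = j then 1 else 0)" for j k
      by (rule fun_cong)
    show ?thesis
    proof -
      have "(\<Sum>i\<in>UNIV. p i k * q j i) = (if k = j then 1 else 0)" for j k
        unfolding *[of j k, symmetric] by (rule sum.cong) (simp_all only: mult.commute)
      then show ?thesis
        unfolding vec_eq_iff matrix_matrix_mult_def P_def Q_def mat_def vec_lambda_beta by blast
    qed
  qed
  from arg_cong[OF this, of det] have "det P * det Q = 1" by (simp add: det_mul)
  then have P0: "det P \<noteq> 0" by auto
  have "A ** P = P ** A'"
  proof -
    have "(\<Sum>k\<in>UNIV. (\<Sum>i\<in>UNIV. p j i * A $ k $ i) *\<^sub>R b k) = (\<Sum>k\<in>UNIV. (\<Sum>i\<in>UNIV. A' $ i $ j * p i k) *\<^sub>R b k)" for j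
    proof -
      have "L (b' j) = (\<Sum>i\<in>UNIV. p j i *\<^sub>R L (b i))"
        unfolding p linear_sum[OF L] linear_scale[OF L] ..
      then have "(\<Sum>k\<in>UNIV. (\<Sum>i\<in>UNIV. p j i * A $ k $ i) *\<^sub>R b k) = L (b' j)"
        unfolding A comb by simp
      also have "\<dots> = (\<Sum>i\<in>UNIV. A' $ i $ j *\<^sub>R b' i)" by (rule A')
      also have "\<dots> = (\<Sum>k\<in>UNIV. (\<Sum>i\<in>UNIV. A' $ i $ j * p i k) *\<^sub>R b k)"
        unfolding p comb ..
      finally show ?thesis .
    qed
    then have "(\<lambda>k. \<Sum>i\<in>UNIV. p j i * A $ k $ i) = (\<lambda>k. \<Sum>i\<in>UNIV. A' $ i $ j * p i k)" for j
      by (rule basis_coefficients_unique[OF b])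
    then have *: "(\<Sum>i\<in>UNIV. p j i * A $ k $ i) = (\<Sum>i\<in>UNIV. A' $ i $ j * p i k)" for j k
      by (rule fun_cong)
    have "(\<Sum>i\<in>UNIV. A $ k $ i * p j i) = (\<Sum>i\<in>UNIV. p i k * A' $ i $ j)" for j k
      using *[of j k] by (simp add: mult.commute)
    then show ?thesis
      by (simp add: vec_eq_iff matrix_matrix_mult_def P_def)
  qed
  from arg_cong[OF this, of det] have "det A * det P = det P * det A'" by (simp only: det_mul)
  then show ?thesis using P0 by simp
qed

lemma endo_det3_eq:
  fixes b :: "3 \<Rightarrow> 'a::real_vector"
  assumes L: "linear L" and b: "inj b" "independent (range b)" "span (range b) = V"
    and A: "\<And>j. L (b j) = (\<Sum>i\<in>UNIV. A $ i $ j *\<^sub>R b i)"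
  shows "endo_det3 V L = det A"
  unfolding endo_det3_def
proof (rule the_equality)
  show "\<forall>(b' :: 3 \<Rightarrow> 'a) (A' :: real^3^3). inj b' \<and> independent (range b') \<and> span (range b') = V \<and>
     (\<forall>j. L (b' j) = (\<Sum>i\<in>UNIV. A' $ i $ j *\<^sub>R b' i)) \<longrightarrow> det A = det A'"
  proof (intro allI impI)
    fix b' :: "3 \<Rightarrow> 'a" and A' :: "real^3^3"
    assume "inj b' \<and> independent (range b') \<and> span (range b') = V \<and>
     (\<forall>j. L (b' j) = (\<Sum>i\<in>UNIV. A' $ i $ j *\<^sub>R b' i))"
    then show "det A = det A'"
      using b(3) A by (intro det_basis_independent[OF L b(1,2), of b' A A', symmetric]) auto
  qed
next
  fix d
  assume "\<forall>(b' :: 3 \<Rightarrow> 'a) (A' :: real^3^3). inj b' \<and> independent (range b') \<and> span (range b') = V \<and>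
     (\<forall>j. L (b' j) = (\<Sum>i\<in>UNIV. A' $ i $ j *\<^sub>R b' i)) \<longrightarrow> d = det A'"
  from this[rule_format, of b A] show "d = det A" using b A by blast
qed

lemma sum_swap4:
  "(\<Sum>i\<in>A. \<Sum>j\<in>B. \<Sum>k\<in>C. \<Sum>l\<in>D. \<Sum>m\<in>E. f i j k l m)
    = (\<Sum>m\<in>E. \<Sum>i\<in>A. \<Sum>j\<in>B. \<Sum>k\<in>C. \<Sum>l\<in>D. f i j k l m)"
proof -
  have "(\<Sum>i\<in>A. \<Sum>j\<in>B. \<Sum>k\<in>C. \<Sum>l\<in>D. \<Sum>m\<in>E. f i j k l m)
      = (\<Sum>i\<in>A. \<Sum>j\<in>B. \<Sum>k\<in>C. \<Sum>m\<in>E. \<Sum>l\<in>D. f i j k l m)"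
    by (intro sum.cong[OF refl], rule sum.swap)
  also have "\<dots> = (\<Sum>i\<in>A. \<Sum>j\<in>B. \<Sum>m\<in>E. \<Sum>k\<in>C. \<Sum>l\<in>D. f i j k l m)"
    by (rule sum.cong[OF refl], rule sum.cong[OF refl], rule sum.swap)
  also have "\<dots> = (\<Sum>i\<in>A. \<Sum>m\<in>E. \<Sum>j\<in>B. \<Sum>k\<in>C. \<Sum>l\<in>D. f i j k l m)"
    by (rule sum.cong[OF refl], rule sum.swap)
  also have "\<dots> = (\<Sum>m\<in>E. \<Sum>i\<in>A. \<Sum>j\<in>B. \<Sum>k\<in>C. \<Sum>l\<in>D. f i j k l m)"
    by (rule sum.swap)
  finally show ?thesis .
qed

section \<open>Components of the self-dual Weyl tensor\<close>

lemma linear_det_row1: "linear (\<lambda>u. det (vector [u, v, w, z] :: real^4^4))"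
proof (rule linearI)
  let ?c = "\<lambda>i::4. if i = 2 then v else if i = 3 then w else z"
  have *: "(vector [u, v, w, z] :: real^4^4) = (\<chi> i. if i = 1 then u else ?c i)" for u
    by (simp add: vec_eq_iff forall_4 vector_4_nth)
  show "det (vector [u + u', v, w, z] :: real^4^4) = det (vector [u, v, w, z] :: real^4^4) + det (vector [u', v, w, z] :: real^4^4)" for u u'
    unfolding * by (rule det_row_add)
  show "det (vector [k *\<^sub>R u, v, w, z] :: real^4^4) = k *\<^sub>R det (vector [u, v, w, z] :: real^4^4)" for k u
    unfolding * using det_row_mul[of 1 k "\<lambda>i. u" ?c, unfolded scalar_mult_eq_scaleR] by simp
qed

lemma vec_axis_expansion: "u = (\<Sum>i\<in>UNIV. u $ i *\<^sub>R axis i (1::real))"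
  using basis_expansion[of u] by (simp add: scalar_mult_eq_scaleR)

lemma det_row1_expand:
  "det (vector [u, v, w, z] :: real^4^4) = (\<Sum>i\<in>UNIV. u $ i * det (vector [axis i 1, v, w, z] :: real^4^4))"
  by (subst vec_axis_expansion[of u])
    (simp add: linear_sum[OF linear_det_row1] linear_scale[OF linear_det_row1])

lemma det_eps:
  "det (vector [u, v, w, z] :: real^4^4)
    = (\<Sum>i\<in>UNIV. \<Sum>j\<in>UNIV. \<Sum>k\<in>UNIV. \<Sum>l\<in>UNIV. eps i j k l * u $ i * v $ j * w $ k * z $ l)"
proof -
  have 2: "det (vector [a, v, w, z] :: real^4^4) = (\<Sum>j\<in>UNIV. v $ j * det (vector [a, axis j 1, w, z] :: real^4^4))" for a v w z
    using det_row1_expand[of v a w z] by (simp add: det_vector_swap(1)[of _ a] sum_negf)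
  have 3: "det (vector [a, b, w, z] :: real^4^4) = (\<Sum>j\<in>UNIV. w $ j * det (vector [a, b, axis j 1, z] :: real^4^4))" for a b w z
    using 2[of a w b z] by (simp add: det_vector_swap(2)[of a _ b] sum_negf)
  have 4: "det (vector [a, b, c, z] :: real^4^4) = (\<Sum>j\<in>UNIV. z $ j * det (vector [a, b, c, axis j 1] :: real^4^4))" for a b c z
    using 3[of a b z c] by (simp add: det_vector_swap(3)[of a b _ c] sum_negf)
  show ?thesis
    by (subst det_row1_expand, subst 2, subst 3, subst 4)
      (simp add: eps_def sum_distrib_left sum_distrib_right mult_ac)
qed

text \<open>
  Stacking frame vectors is multiplying a matrix of unit vectors by the matrix of the frame.
\<close>

lemma det_frame_eps:
  "det (vector [e a, e b, e c, e d] :: real^4^4) = eps a b c d * det (\<chi> a i. e a $ i)"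
proof -
  have ax: "(\<Sum>k\<in>UNIV. axis a 1 $ k * e k $ j) = e a $ j" for a j
    using sum_kronecker(1)[of a "\<lambda>k. e k $ j"] by (simp add: axis_def eq_commute)
  have "(vector [e a, e b, e c, e d] :: real^4^4)
      = vector [axis a 1, axis b 1, axis c 1, axis d 1] ** (\<chi> a i. e a $ i)"
    by (simp add: vec_eq_iff forall_4 vector_4_nth matrix_matrix_mult_def ax)
  then show ?thesis by (simp add: det_mul eps_def)
qed

definition outer :: "real^4 \<Rightarrow> real^4 \<Rightarrow> real^4^4" where
  "outer u v = (\<chi> i j. u $ i * v $ j)"

lemma linear_hodge: "linear (hodge G x)"
  by (rule linearI) (simp_all add: hodge_def vec_eq_iff sum.distrib sum_distrib_left algebra_simps add_divide_distrib)

lemma linear_self_dual_part: "linear (self_dual_part G x)"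
  unfolding self_dual_part_def
  by (rule linearI) (simp_all add: linear_add[OF linear_hodge] linear_scale[OF linear_hodge] algebra_simps)

lemma linear_bivector_form_left: "linear (\<lambda>\<alpha>. bivector_form T \<alpha> \<beta>)"
  by (rule linearI) (simp_all add: bivector_form_def sum.distrib sum_distrib_left algebra_simps add_divide_distrib)

lemma linear_bivector_form_right: "linear (\<lambda>\<beta>. bivector_form T \<alpha> \<beta>)"
  by (rule linearI) (simp_all add: bivector_form_def sum.distrib sum_distrib_left algebra_simps add_divide_distrib)

lemma linear_bivector_endo: "linear (bivector_endo G x T)"
  by (rule linearI) (simp_all add: bivector_endo_def vec_eq_iff sum.distrib sum_distrib_left algebra_simps add_divide_distrib)

lemma wedge_outer: "wedge u v = outer u v - outer v u"
  by (simp add: wedge_def outer_def vec_eq_iff)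

lemma wedge_bilinear:
  "wedge (\<Sum>i\<in>UNIV. c i *\<^sub>R u i) (\<Sum>j\<in>UNIV. d j *\<^sub>R v j) = (\<Sum>i\<in>UNIV. \<Sum>j\<in>UNIV. (c i * d j) *\<^sub>R wedge (u i) (v j))"
proof -
  have l: "linear (\<lambda>u. wedge u w)" "linear (\<lambda>v. wedge w v)" for w
    by (rule linearI; simp add: wedge_def vec_eq_iff algebra_simps)+
  show ?thesis
    by (simp only: linear_sum[OF l(1)] linear_scale[OF l(1)])
      (simp add: linear_sum[OF l(2)] linear_scale[OF l(2)] scaleR_sum_right)
qed

lemma bivector_form_outer:
  "bivector_form T (outer (e a) (e b)) (outer (e c) (e d)) = in_frame e T a b c d / 4"
  by (simp add: bivector_form_def outer_def in_frame_def mult_ac)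

text \<open>
  The bivector with components \<open>\<phi>\<^sub>p\<close> in the frame \<open>e\<close>, given by its coordinate components.
\<close>

definition Phi :: "(4 \<Rightarrow> real^4) \<Rightarrow> 3 \<Rightarrow> real^4^4" where
  "Phi e p = (\<Sum>a\<in>UNIV. \<Sum>b\<in>UNIV. phi p a b *\<^sub>R outer (e a) (e b))"

lemma bivector_form_Phi: "bivector_form T (Phi e p) (Phi e q) = 2 * sd_pairing (in_frame e T) p q"
  unfolding Phi_def sd_pairing_def
  by (simp only: linear_sum[OF linear_bivector_form_left] linear_scale[OF linear_bivector_form_left])
    (simp add: linear_sum[OF linear_bivector_form_right] linear_scale[OF linear_bivector_form_right]
      bivector_form_outer sum_distrib_left mult_ac sum_divide_distrib)

definition list_tensor :: "tensor4 \<Rightarrow> 4 list \<Rightarrow> real" where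
  "list_tensor T as = T (as ! 0) (as ! 1) (as ! 2) (as ! 3)"

lemma list_tensor_simp [simp]: "list_tensor T [i, j, k, l] = T i j k l"
  by (simp add: list_tensor_def)

lemma in_frame_frame_comp: "in_frame e T a b c d = frame_comp e (list_tensor T) [a, b, c, d]"
  by (simp add: in_frame_def sum_distrib_left mult_ac)

lemma in_frame_add: "in_frame e (\<lambda>a b c d. S a b c d + T a b c d) i j k l = in_frame e S i j k l + in_frame e T i j k l"
  by (simp add: in_frame_def sum.distrib distrib_right)

lemma in_frame_cmult: "in_frame e (\<lambda>a b c d. r * T a b c d) i j k l = r * in_frame e T i j k l"
  by (simp add: in_frame_def sum_distrib_left mult.assoc)

lemma in_frame_diff: "in_frame e (\<lambda>a b c d. S a b c d - T a b c d) i j k l = in_frame e S i j k l - in_frame e T i j k l"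
  by (simp add: in_frame_def sum_subtractf left_diff_distrib)

lemma in_frame_swap12: "in_frame e T b a c d = in_frame e (\<lambda>i j k l. T j i k l) a b c d"
  unfolding in_frame_def by (subst sum.swap) (simp add: mult_ac)

lemma in_frame_swap34: "in_frame e T a b d c = in_frame e (\<lambda>i j k l. T i j l k) a b c d"
  unfolding in_frame_def
  by (rule sum.cong[OF refl], rule sum.cong[OF refl], subst sum.swap) (simp add: mult_ac)

lemma antisym_pairs_in_frame:
  assumes "antisym_pairs T"
  shows "antisym_pairs (in_frame e T)"
  unfolding antisym_pairs_def
proof (intro allI conjI)
  fix a b c d
  have "(\<lambda>i j k l. T j i k l) = (\<lambda>i j k l. (-1) * T i j k l)" "(\<lambda>i j k l. T i j l k) = (\<lambda>i j k l. (-1) * T i j k l)"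
    using assms unfolding antisym_pairs_def fun_eq_iff by (metis mult_minus1)+
  then show "in_frame e T a b c d = - in_frame e T b a c d" "in_frame e T a b c d = - in_frame e T a b d c"
    by (simp_all only: in_frame_swap12[of e T b a] in_frame_swap34[of e T a b d c] in_frame_cmult)
qed

definition in_frame2 :: "(4 \<Rightarrow> real^4) \<Rightarrow> real^4^4 \<Rightarrow> 4 \<Rightarrow> 4 \<Rightarrow> real" where
  "in_frame2 e A a b = (\<Sum>i\<in>UNIV. \<Sum>j\<in>UNIV. A $ i $ j * e a $ i * e b $ j)"

lemma in_frame_kulkarni_nomizu:
  "in_frame e (kulkarni_nomizu A B) a b c d = kn_product (in_frame2 e A) (in_frame2 e B) a b c d"
proof -
  have 1: "in_frame e (\<lambda>i j k l. A $ i $ k * B $ j $ l) a b c d = in_frame2 e A a c * in_frame2 e B b d" for A B a b c d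
  proof -
    have "in_frame e (\<lambda>i j k l. A $ i $ k * B $ j $ l) a b c d
        = (\<Sum>i\<in>UNIV. \<Sum>k\<in>UNIV. \<Sum>j\<in>UNIV. \<Sum>l\<in>UNIV. (A $ i $ k * e a $ i * e c $ k) * (B $ j $ l * e b $ j * e d $ l))"
      unfolding in_frame_def by (rule sum.cong[OF refl], subst sum.swap) (simp add: mult_ac)
    also have "\<dots> = in_frame2 e A a c * in_frame2 e B b d"
      by (simp only: in_frame2_def sum_distrib_right) (simp only: sum_distrib_left)
    finally show ?thesis .
  qed
  have 2: "in_frame e (\<lambda>i j k l. A $ j $ l * B $ i $ k) a b c d = in_frame2 e A b d * in_frame2 e B a c"
    using 1[of B A a b c d] by (simp add: mult.commute)
  have 3: "in_frame e (\<lambda>i j k l. A $ i $ l * B $ j $ k) a b c d = in_frame2 e A a d * in_frame2 e B b c"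
    using in_frame_swap34[of e "\<lambda>i j k l. A $ i $ k * B $ j $ l" a b d c] 1[of A B a b d c] by simp
  have 4: "in_frame e (\<lambda>i j k l. A $ j $ k * B $ i $ l) a b c d = in_frame2 e A b c * in_frame2 e B a d"
    using in_frame_swap34[of e "\<lambda>i j k l. A $ j $ l * B $ i $ k" a b d c] 1[of B A a b d c] by (simp add: mult.commute)
  show ?thesis
    unfolding kulkarni_nomizu_def kn_product_def
    by (simp only: in_frame_add in_frame_diff 1 2 3 4)
qed

context metric_on
begin

definition ric_of :: "real^4 \<Rightarrow> tensor4 \<Rightarrow> real^4^4" where
  "ric_of x T = (\<chi> i k. \<Sum>j\<in>UNIV. \<Sum>l\<in>UNIV. ginv G x $ j $ l * T i j k l)"

definition weyl_of :: "real^4 \<Rightarrow> tensor4 \<Rightarrow> tensor4" where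
  "weyl_of x T i j k l = T i j k l - kulkarni_nomizu (ric_of x T) (G x) i j k l / 2
     + gtrace G x (ric_of x T) * kulkarni_nomizu (G x) (G x) i j k l / 12"

text \<open>
  The tensor \<open>W\<^sup>+\<close> at a point as a function of the curvature tensor \<open>T\<close> there.
\<close>

definition weyl_plus_of :: "real^4 \<Rightarrow> tensor4 \<Rightarrow> tensor4" where
  "weyl_plus_of x T i j k l = bivector_form (weyl_of x T)
     (self_dual_part G x (wedge (axis i 1) (axis j 1)))
     (self_dual_part G x (wedge (axis k 1) (axis l 1)))"

lemma ricci_eq: "ricci G x = ric_of x (riem G x)"
  by (simp add: ricci_def ric_of_def)

lemma weyl_plus_eq: "weyl_plus G x = weyl_plus_of x (riem G x)"
proof -
  have "weyl G x = weyl_of x (riem G x)"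
    by (simp add: fun_eq_iff weyl_def weyl_of_def scal_def ricci_eq)
  then show ?thesis by (intro ext) (simp only: weyl_plus_def weyl_plus_of_def)
qed

lemma in_frame2_metric: "orthonormal_frame G x e \<Longrightarrow> in_frame2 e (G x) = (\<lambda>a b. if a = b then 1 else 0)"
  by (simp add: fun_eq_iff in_frame2_def orthonormal_frame_metric_ip metric_ip_expand mult_ac)

lemma gtrace_frame:
  assumes "x \<in> U" "orthonormal_frame G x e"
  shows "gtrace G x A = (\<Sum>a\<in>UNIV. in_frame2 e A a a)"
proof -
  have "gtrace G x A = (\<Sum>i\<in>UNIV. \<Sum>j\<in>UNIV. \<Sum>a\<in>UNIV. A $ i $ j * e a $ i * e a $ j)"
    by (simp add: gtrace_def ginv_frame[OF assms] sum_distrib_left sum_distrib_right mult_ac)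
  also have "\<dots> = (\<Sum>a\<in>UNIV. in_frame2 e A a a)"
    unfolding in_frame2_def by (subst sum.swap, rule sum.cong[OF refl], subst sum.swap) simp
  finally show ?thesis .
qed

lemma ric_of_frame:
  assumes "x \<in> U" "orthonormal_frame G x e"
  shows "in_frame2 e (ric_of x T) a c = Ric (in_frame e T) a c"
proof -
  have "in_frame2 e (ric_of x T) a c
      = (\<Sum>i\<in>UNIV. \<Sum>k\<in>UNIV. \<Sum>j\<in>UNIV. \<Sum>l\<in>UNIV. \<Sum>b\<in>UNIV. T i j k l * e a $ i * e b $ j * e c $ k * e b $ l)"
    by (simp add: in_frame2_def ric_of_def ginv_frame[OF assms] sum_distrib_left sum_distrib_right mult_ac)
  also have "\<dots> = (\<Sum>i\<in>UNIV. \<Sum>j\<in>UNIV. \<Sum>k\<in>UNIV. \<Sum>l\<in>UNIV. \<Sum>b\<in>UNIV. T i j k l * e a $ i * e b $ j * e c $ k * e b $ l)"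
    by (rule sum.cong[OF refl], rule sum.swap)
  also have "\<dots> = (\<Sum>i\<in>UNIV. \<Sum>j\<in>UNIV. \<Sum>k\<in>UNIV. \<Sum>b\<in>UNIV. \<Sum>l\<in>UNIV. T i j k l * e a $ i * e b $ j * e c $ k * e b $ l)"
    by (rule sum.cong[OF refl], rule sum.cong[OF refl], rule sum.cong[OF refl], rule sum.swap)
  also have "\<dots> = (\<Sum>i\<in>UNIV. \<Sum>j\<in>UNIV. \<Sum>b\<in>UNIV. \<Sum>k\<in>UNIV. \<Sum>l\<in>UNIV. T i j k l * e a $ i * e b $ j * e c $ k * e b $ l)"
    by (rule sum.cong[OF refl], rule sum.cong[OF refl], rule sum.swap)
  also have "\<dots> = (\<Sum>i\<in>UNIV. \<Sum>b\<in>UNIV. \<Sum>j\<in>UNIV. \<Sum>k\<in>UNIV. \<Sum>l\<in>UNIV. T i j k l * e a $ i * e b $ j * e c $ k * e b $ l)"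
    by (rule sum.cong[OF refl], rule sum.swap)
  also have "\<dots> = (\<Sum>b\<in>UNIV. \<Sum>i\<in>UNIV. \<Sum>j\<in>UNIV. \<Sum>k\<in>UNIV. \<Sum>l\<in>UNIV. T i j k l * e a $ i * e b $ j * e c $ k * e b $ l)"
    by (rule sum.swap)
  finally show ?thesis by (simp only: Ric_def in_frame_def)
qed

text \<open>
  The volume form has the components \<open>eps\<close> in a positive orthonormal frame, and the two inverse metrics in the
  definition of \<open>\<star>\<close> are resolved into the frame.
\<close>

lemma hodge_wedge_frame:
  assumes x: "x \<in> U" and e: "positive_frame G x e"
  shows "hodge G x (wedge (e a) (e b)) = (\<Sum>c\<in>UNIV. \<Sum>d\<in>UNIV. eps a b c d *\<^sub>R outer (e c) (e d))"
proof -
  have on: "orthonormal_frame G x e" using e by (simp add: positive_frame_def)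
  let ?s = "sqrt (det (G x))"
  have vol: "(\<Sum>i\<in>UNIV. \<Sum>j\<in>UNIV. \<Sum>p\<in>UNIV. \<Sum>q\<in>UNIV. eps i j p q * e a $ i * e b $ j * e c $ p * e d $ q) * ?s = eps a b c d"
    for a b c d
  proof -
    have "det (\<chi> a i. e a $ i) * ?s = 1" using det_frame(2)[OF e] by (simp only: mult.commute)
    then show ?thesis
      unfolding det_eps[symmetric] det_frame_eps by (simp only: mult.assoc mult_1_right)
  qed
  have "hodge G x (wedge (e a) (e b)) $ k $ l
      = (\<Sum>c\<in>UNIV. \<Sum>d\<in>UNIV. eps a b c d * (e c $ k * e d $ l))" for k l
  proof -
    define H where "H i j p q = eps i j p q * ?s * ginv G x $ p $ k * ginv G x $ q $ l" for i j p q
    have H: "H j i p q = - H i j p q" for i j p q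
      by (simp add: H_def eps_swap(1)[of j i])
    have "hodge G x (wedge (e a) (e b)) $ k $ l
        = ((\<Sum>i\<in>UNIV. \<Sum>j\<in>UNIV. \<Sum>p\<in>UNIV. \<Sum>q\<in>UNIV. e a $ i * e b $ j * H i j p q)
          - (\<Sum>i\<in>UNIV. \<Sum>j\<in>UNIV. \<Sum>p\<in>UNIV. \<Sum>q\<in>UNIV. e a $ j * e b $ i * H i j p q)) / 2"
      by (simp add: hodge_def wedge_def vol_form_def eps_def[symmetric] H_def sum_subtractf algebra_simps)
    also have "(\<Sum>i\<in>UNIV. \<Sum>j\<in>UNIV. \<Sum>p\<in>UNIV. \<Sum>q\<in>UNIV. e a $ j * e b $ i * H i j p q)
        = - (\<Sum>i\<in>UNIV. \<Sum>j\<in>UNIV. \<Sum>p\<in>UNIV. \<Sum>q\<in>UNIV. e a $ i * e b $ j * H i j p q)"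
      by (subst sum.swap, subst H) (simp add: sum_negf)
    finally have "hodge G x (wedge (e a) (e b)) $ k $ l
        = (\<Sum>i\<in>UNIV. \<Sum>j\<in>UNIV. \<Sum>p\<in>UNIV. \<Sum>q\<in>UNIV. e a $ i * e b $ j * H i j p q)"
      by simp
    also have "\<dots> = (\<Sum>i\<in>UNIV. \<Sum>j\<in>UNIV. \<Sum>p\<in>UNIV. \<Sum>q\<in>UNIV. \<Sum>c\<in>UNIV. \<Sum>d\<in>UNIV.
        (eps i j p q * e a $ i * e b $ j * e c $ p * e d $ q) * ?s * (e c $ k * e d $ l))"
      by (simp add: H_def ginv_frame[OF x on] sum_product sum_distrib_left sum_distrib_right mult_ac)
    also have "\<dots> = (\<Sum>c\<in>UNIV. \<Sum>d\<in>UNIV. \<Sum>i\<in>UNIV. \<Sum>j\<in>UNIV. \<Sum>p\<in>UNIV. \<Sum>q\<in>UNIV.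
        (eps i j p q * e a $ i * e b $ j * e c $ p * e d $ q) * ?s * (e c $ k * e d $ l))"
      by (subst sum_swap4[symmetric], subst sum_swap4[symmetric]) (rule refl)
    also have "\<dots> = (\<Sum>c\<in>UNIV. \<Sum>d\<in>UNIV. eps a b c d * (e c $ k * e d $ l))"
      unfolding sum_distrib_right[symmetric] vol ..
    finally show ?thesis .
  qed
  then show ?thesis by (simp add: vec_eq_iff outer_def)
qed

text \<open>
  Both sides are \<open>(1 + \<star>)/2\<close> applied to \<open>e\<^sub>a \<and> e\<^sub>b\<close>, by the completeness relation of the \<open>\<phi>\<^sub>p\<close>.
\<close>

lemma self_dual_part_wedge_frame:
  assumes x: "x \<in> U" and e: "positive_frame G x e"
  shows "self_dual_part G x (wedge (e a) (e b)) = (\<Sum>p\<in>UNIV. (phi p a b / 2) *\<^sub>R Phi e p)"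
proof -
  have "(\<Sum>p\<in>UNIV. phi p a b *\<^sub>R Phi e p)
      = (\<Sum>p\<in>UNIV. \<Sum>c\<in>UNIV. \<Sum>d\<in>UNIV. (phi p a b * phi p c d) *\<^sub>R outer (e c) (e d))"
    by (simp add: Phi_def scaleR_sum_right)
  also have "\<dots> = (\<Sum>c\<in>UNIV. \<Sum>d\<in>UNIV. (\<Sum>p\<in>UNIV. phi p a b * phi p c d) *\<^sub>R outer (e c) (e d))"
    unfolding scaleR_sum_left by (subst sum.swap, rule sum.cong[OF refl], rule sum.swap)
  also have "\<dots> = (\<Sum>c\<in>UNIV. \<Sum>d\<in>UNIV. ((if a = c \<and> b = d then 1 else 0) - (if a = d \<and> b = c then 1 else 0)) *\<^sub>R outer (e c) (e d))
      + (\<Sum>c\<in>UNIV. \<Sum>d\<in>UNIV. eps a b c d *\<^sub>R outer (e c) (e d))"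
    unfolding phi_complete by (simp add: scaleR_left_distrib sum.distrib)
  also have "(\<Sum>c\<in>UNIV. \<Sum>d\<in>UNIV. ((if a = c \<and> b = d then 1 else 0) - (if a = d \<and> b = c then 1 else 0)) *\<^sub>R outer (e c) (e d))
      = wedge (e a) (e b)"
  proof -
    have "(\<Sum>c\<in>UNIV. \<Sum>d\<in>UNIV. (if a = c \<and> b = d then 1 else 0) *\<^sub>R outer (e c) (e d)) = outer (e a) (e b)" for a b
    proof -
      have "(\<Sum>d\<in>UNIV. (if a = c \<and> b = d then 1 else 0) *\<^sub>R outer (e c) (e d))
          = (if a = c then outer (e c) (e b) else 0)" for c
      proof -
        have "(\<Sum>d\<in>UNIV. (if a = c \<and> b = d then 1 else 0) *\<^sub>R outer (e c) (e d))
            = (\<Sum>d\<in>UNIV. if b = d then (if a = c then outer (e c) (e d) else 0) else 0)"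
          by (rule sum.cong) auto
        then show ?thesis by simp
      qed
      then show ?thesis by simp
    qed
    from this[of a b] this[of b a] show ?thesis
      by (simp add: wedge_outer scaleR_left_diff_distrib sum_subtractf conj_commute)
  qed
  finally have "self_dual_part G x (wedge (e a) (e b)) = (1/2) *\<^sub>R (\<Sum>p\<in>UNIV. phi p a b *\<^sub>R Phi e p)"
    by (simp add: self_dual_part_def hodge_wedge_frame[OF x e])
  then show ?thesis by (simp add: scaleR_sum_right)
qed


lemma in_frame_bivector_form:
  "in_frame e (\<lambda>i j k l. bivector_form T
     (self_dual_part G x (wedge (axis i 1) (axis j 1))) (self_dual_part G x (wedge (axis k 1) (axis l 1)))) a b c d
   = bivector_form T (self_dual_part G x (wedge (e a) (e b))) (self_dual_part G x (wedge (e c) (e d)))"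
proof -
  have *: "self_dual_part G x (wedge (e a) (e b))
      = (\<Sum>i\<in>UNIV. \<Sum>j\<in>UNIV. (e a $ i * e b $ j) *\<^sub>R self_dual_part G x (wedge (axis i 1) (axis j 1)))" for a b
    by (subst vec_axis_expansion[of "e a"], subst vec_axis_expansion[of "e b"])
      (simp only: wedge_bilinear linear_sum[OF linear_self_dual_part] linear_scale[OF linear_self_dual_part])
  have l: "bivector_form T (self_dual_part G x (wedge (e a) (e b))) \<beta> = (\<Sum>i\<in>UNIV. \<Sum>j\<in>UNIV. (e a $ i * e b $ j) *
      bivector_form T (self_dual_part G x (wedge (axis i 1) (axis j 1))) \<beta>)" for \<beta>
    by (simp only: * linear_sum[OF linear_bivector_form_left] linear_scale[OF linear_bivector_form_left] real_scaleR_def)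
  have r: "bivector_form T \<alpha> (self_dual_part G x (wedge (e c) (e d))) = (\<Sum>k\<in>UNIV. \<Sum>l\<in>UNIV. (e c $ k * e d $ l) *
      bivector_form T \<alpha> (self_dual_part G x (wedge (axis k 1) (axis l 1))))" for \<alpha>
    by (simp only: * linear_sum[OF linear_bivector_form_right] linear_scale[OF linear_bivector_form_right] real_scaleR_def)
  show ?thesis
    unfolding l unfolding r by (simp add: in_frame_def sum_distrib_left mult_ac)
qed

text \<open>
  The Kulkarni--Nomizu products with the metric contribute multiples of the identity to the \<open>\<Lambda>\<^sub>2\<^sup>+\<close> block;
  together they subtract \<open>S/12\<close>.
\<close>

lemma weyl_plus_of_frame:
  assumes x: "x \<in> U" and e: "positive_frame G x e" and T: "curvature_like (in_frame e T)"
  shows "in_frame e (weyl_plus_of x T) a b c d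
    = (\<Sum>p\<in>UNIV. \<Sum>q\<in>UNIV. weyl_matrix (in_frame e T) p q * phi p a b * phi q c d) / 2"
proof -
  have on: "orthonormal_frame G x e" using e by (simp add: positive_frame_def)
  have W: "in_frame e (weyl_of x T) i j k l = in_frame e T i j k l
      - (1/2) * kn_product (Ric (in_frame e T)) (\<lambda>a b. if a = b then 1 else 0) i j k l
      + (Sc (in_frame e T) / 12) * kn_product (\<lambda>a b. if a = b then 1 else 0) (\<lambda>a b. if a = b then 1 else 0) i j k l" for i j k l
  proof -
    have 1: "in_frame2 e (ric_of x T) = Ric (in_frame e T)"
      by (simp add: fun_eq_iff ric_of_frame[OF x on])
    have 2: "gtrace G x (ric_of x T) = Sc (in_frame e T)"
      by (simp add: gtrace_frame[OF x on] 1 Sc_def)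
    have "weyl_of x T = (\<lambda>i j k l. T i j k l - (1/2) * kulkarni_nomizu (ric_of x T) (G x) i j k l
       + (gtrace G x (ric_of x T) / 12) * kulkarni_nomizu (G x) (G x) i j k l)"
      by (simp add: fun_eq_iff weyl_of_def)
    then show ?thesis
      by (simp only: in_frame_add in_frame_diff in_frame_cmult in_frame_kulkarni_nomizu 1 2 in_frame2_metric[OF on])
  qed
  have Rs: "Ric (in_frame e T) a c = Ric (in_frame e T) c a" for a c
    using T unfolding Ric_def curvature_like_def by (intro sum.cong) blast+
  have pw: "sd_pairing (in_frame e (weyl_of x T)) p q = weyl_matrix (in_frame e T) p q" for p q
  proof -
    have "in_frame e (weyl_of x T) = (\<lambda>i j k l. in_frame e T i j k l
      - (1/2) * kn_product (Ric (in_frame e T)) (\<lambda>a b. if a = b then 1 else 0) i j k l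
      + (Sc (in_frame e T) / 12) * kn_product (\<lambda>a b. if a = b then 1 else 0) (\<lambda>a b. if a = b then 1 else 0) i j k l)"
      by (simp add: fun_eq_iff W)
    then have "sd_pairing (in_frame e (weyl_of x T)) p q = sd_pairing (in_frame e T) p q
      - (1/2) * sd_pairing (kn_product (Ric (in_frame e T)) (\<lambda>a b. if a = b then 1 else 0)) p q
      + (Sc (in_frame e T) / 12) * sd_pairing (kn_product (\<lambda>a b. if a = b then 1 else 0) (\<lambda>a b. if a = b then 1 else 0)) p q"
      by (simp only: sd_pairing_add sd_pairing_diff sd_pairing_cmult)
    moreover have "sd_pairing (kn_product (Ric (in_frame e T)) (\<lambda>a b. if a = b then 1 else 0)) p q = (if p = q then Sc (in_frame e T) / 2 else 0)"
      unfolding Sc_def by (rule sd_pairing_kn_product_delta) (rule Rs)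
    moreover have "sd_pairing (kn_product (\<lambda>a b. if a = b then 1 else 0) (\<lambda>a b. if a = b then 1 else 0)) p q = (if p = q then 2 else 0)"
      by (subst sd_pairing_kn_product_delta) auto
    ultimately show ?thesis by (simp add: weyl_matrix_def)
  qed
  have "in_frame e (weyl_plus_of x T) a b c d
      = bivector_form (weyl_of x T) (self_dual_part G x (wedge (e a) (e b))) (self_dual_part G x (wedge (e c) (e d)))"
    unfolding weyl_plus_of_def[abs_def] by (rule in_frame_bivector_form)
  also have "\<dots> = (\<Sum>p\<in>UNIV. \<Sum>q\<in>UNIV. (phi p a b / 2) * ((phi q c d / 2) * (2 * weyl_matrix (in_frame e T) p q)))"
    unfolding self_dual_part_wedge_frame[OF x e]
    by (simp only: linear_sum[OF linear_bivector_form_left] linear_scale[OF linear_bivector_form_left])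
      (simp only: linear_sum[OF linear_bivector_form_right] linear_scale[OF linear_bivector_form_right]
        bivector_form_Phi pw real_scaleR_def sum_distrib_left)
  also have "\<dots> = (\<Sum>p\<in>UNIV. \<Sum>q\<in>UNIV. weyl_matrix (in_frame e T) p q * phi p a b * phi q c d) / 2"
    by (simp add: sum_divide_distrib mult_ac)
  finally show ?thesis .
qed

end

section \<open>Norms and the determinant of the self-dual Weyl tensor\<close>

lemma sum_less_half:
  fixes F :: "'a::{finite,linorder} \<Rightarrow> 'a \<Rightarrow> real"
  assumes "\<And>i j. F j i = F i j" "\<And>i. F i i = 0"
  shows "(\<Sum>(i, j)\<in>{(i, j). i < j}. F i j) = (\<Sum>i\<in>UNIV. \<Sum>j\<in>UNIV. F i j) / 2"
proof -
  have s: "(\<Sum>(i, j)\<in>{(i, j). i < j}. F i j) = (\<Sum>i\<in>UNIV. \<Sum>j\<in>UNIV. if i < j then F i j else 0)"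
  proof -
    have "(\<Sum>i\<in>UNIV. \<Sum>j\<in>UNIV. if i < j then F i j else 0) = (\<Sum>z\<in>UNIV \<times> UNIV. if fst z < snd z then F (fst z) (snd z) else 0)"
      by (simp add: sum.cartesian_product case_prod_beta)
    also have "\<dots> = (\<Sum>z\<in>{z \<in> UNIV \<times> UNIV. fst z < snd z}. F (fst z) (snd z))"
      by (rule sum.inter_filter[symmetric]) simp
    also have "{z \<in> UNIV \<times> UNIV. fst z < snd z} = {(i, j). i < (j :: 'a)}" by auto
    finally show ?thesis by (simp add: case_prod_beta)
  qed
  have "(\<Sum>i\<in>UNIV. \<Sum>j\<in>UNIV. F i j)
      = (\<Sum>i\<in>UNIV. \<Sum>j\<in>UNIV. (if i < j then F i j else 0) + (if j < i then F j i else 0))"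
    using assms by (intro sum.cong refl) (auto simp: not_less_iff_gr_or_eq)
  also have "\<dots> = (\<Sum>i\<in>UNIV. \<Sum>j\<in>UNIV. if i < j then F i j else 0) + (\<Sum>i\<in>UNIV. \<Sum>j\<in>UNIV. if j < i then F j i else 0)"
    by (simp add: sum.distrib)
  also have "(\<Sum>i\<in>UNIV. \<Sum>j\<in>UNIV. if j < i then F j i else 0) = (\<Sum>i\<in>UNIV. \<Sum>j\<in>UNIV. if i < j then F i j else 0)"
    by (rule sum.swap)
  finally show ?thesis unfolding s by simp
qed

lemma sum_less_pairs:
  fixes F :: "4 \<Rightarrow> 4 \<Rightarrow> 4 \<Rightarrow> 4 \<Rightarrow> real"
  assumes "\<And>i j k l. F j i k l = F i j k l" "\<And>i k l. F i i k l = 0"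
    "\<And>i j k l. F i j l k = F i j k l" "\<And>i j k. F i j k k = 0"
  shows "(\<Sum>(i, j)\<in>{(i, j). i < j}. \<Sum>(k, l)\<in>{(k, l). k < l}. F i j k l)
    = (\<Sum>i\<in>UNIV. \<Sum>j\<in>UNIV. \<Sum>k\<in>UNIV. \<Sum>l\<in>UNIV. F i j k l) / 4"
proof -
  have "(\<Sum>(k, l)\<in>{(k, l). k < l}. F i j k l) = (\<Sum>k\<in>UNIV. \<Sum>l\<in>UNIV. F i j k l) / 2" for i j
    using assms by (intro sum_less_half)
  moreover have "(\<Sum>(i, j)\<in>{(i, j). i < j}. (\<Sum>k\<in>UNIV. \<Sum>l\<in>UNIV. F i j k l) / 2)
      = (\<Sum>i\<in>UNIV. \<Sum>j\<in>UNIV. (\<Sum>k\<in>UNIV. \<Sum>l\<in>UNIV. F i j k l) / 2) / 2"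
    using assms by (intro sum_less_half) simp_all
  ultimately show ?thesis by (simp add: sum_divide_distrib)
qed

lemma antisym_pairs_same: "antisym_pairs T \<Longrightarrow> T i i k l = 0" "antisym_pairs T \<Longrightarrow> T i j k k = 0"
  using antisym_pairsD(1)[of T i i k l] antisym_pairsD(2)[of T i j k k] by simp_all

lemma sum_less_pairs_product:
  assumes "antisym_pairs S" "antisym_pairs T"
  shows "(\<Sum>(i, j)\<in>{(i, j). i < j}. \<Sum>(k, l)\<in>{(k, l). k < l}. S i j k l * T i j k l)
    = (\<Sum>i\<in>UNIV. \<Sum>j\<in>UNIV. \<Sum>k\<in>UNIV. \<Sum>l\<in>UNIV. S i j k l * T i j k l) / 4"
proof (rule sum_less_pairs)
  fix i j k l
  show "S j i k l * T j i k l = S i j k l * T i j k l"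
    using antisym_pairsD(1)[OF assms(1), of j i] antisym_pairsD(1)[OF assms(2), of j i] by simp
  show "S i j l k * T i j l k = S i j k l * T i j k l"
    using antisym_pairsD(2)[OF assms(1), of i j l k] antisym_pairsD(2)[OF assms(2), of i j l k] by simp
qed (simp_all add: antisym_pairs_same[OF assms(1)])

text \<open>
  The tensor with \<open>\<Lambda>\<^sub>2\<^sup>+\<close> block \<open>w\<close> and all other blocks zero.
\<close>

definition phi_tensor :: "(3 \<Rightarrow> 3 \<Rightarrow> real) \<Rightarrow> tensor4" where
  "phi_tensor w a b c d = (\<Sum>p\<in>UNIV. \<Sum>q\<in>UNIV. w p q * phi p a b * phi q c d) / 2"

lemma sum_phi_tensor:
  "(\<Sum>a\<in>UNIV. \<Sum>b\<in>UNIV. \<Sum>c\<in>UNIV. \<Sum>d\<in>UNIV. T a b c d * phi_tensor w a b c d) / 4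
    = (\<Sum>p\<in>UNIV. \<Sum>q\<in>UNIV. w p q * sd_pairing T p q)"
proof -
  have "(\<Sum>a\<in>UNIV. \<Sum>b\<in>UNIV. \<Sum>c\<in>UNIV. \<Sum>d\<in>UNIV. T a b c d * phi_tensor w a b c d) / 4
      = (\<Sum>a\<in>UNIV. \<Sum>b\<in>UNIV. \<Sum>c\<in>UNIV. \<Sum>d\<in>UNIV. \<Sum>p\<in>UNIV. \<Sum>q\<in>UNIV.
          w p q * (T a b c d * phi p a b * phi q c d) / 8)"
    by (simp add: phi_tensor_def sum_distrib_left sum_divide_distrib mult_ac)
  also have "\<dots> = (\<Sum>p\<in>UNIV. \<Sum>q\<in>UNIV. \<Sum>a\<in>UNIV. \<Sum>b\<in>UNIV. \<Sum>c\<in>UNIV. \<Sum>d\<in>UNIV.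
          w p q * (T a b c d * phi p a b * phi q c d) / 8)"
    by (subst sum_swap4[symmetric], subst sum_swap4[symmetric]) (rule refl)
  also have "\<dots> = (\<Sum>p\<in>UNIV. \<Sum>q\<in>UNIV. w p q * sd_pairing T p q)"
    by (simp add: sd_pairing_def sum_distrib_left sum_divide_distrib)
  finally show ?thesis .
qed

lemma sd_pairing_phi_tensor: "sd_pairing (phi_tensor w) p q = w p q"
proof -
  have "sd_pairing (phi_tensor w) p q
      = (\<Sum>a\<in>UNIV. \<Sum>b\<in>UNIV. \<Sum>c\<in>UNIV. \<Sum>d\<in>UNIV. \<Sum>r\<in>UNIV. \<Sum>s\<in>UNIV.
          w r s / 16 * ((phi p a b * phi r a b) * (phi q c d * phi s c d)))"
    by (simp add: sd_pairing_def phi_tensor_def sum_distrib_left sum_distrib_right sum_divide_distrib mult_ac)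
  also have "\<dots> = (\<Sum>r\<in>UNIV. \<Sum>s\<in>UNIV. \<Sum>a\<in>UNIV. \<Sum>b\<in>UNIV. \<Sum>c\<in>UNIV. \<Sum>d\<in>UNIV.
          w r s / 16 * ((phi p a b * phi r a b) * (phi q c d * phi s c d)))"
    by (subst sum_swap4[symmetric], subst sum_swap4[symmetric]) (rule refl)
  also have "\<dots> = (\<Sum>r\<in>UNIV. \<Sum>s\<in>UNIV. w r s / 16 *
      ((\<Sum>a\<in>UNIV. \<Sum>b\<in>UNIV. phi p a b * phi r a b) * (\<Sum>c\<in>UNIV. \<Sum>d\<in>UNIV. phi q c d * phi s c d)))"
    by (simp only: sum_distrib_left[symmetric]) (simp only: sum_distrib_right[symmetric])
  also have "\<dots> = (\<Sum>r\<in>UNIV. \<Sum>s\<in>UNIV. if p = r then (if q = s then w r s else 0) else 0)"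
    unfolding phi_orthogonal by (intro sum.cong refl) simp
  also have "\<dots> = (\<Sum>r\<in>UNIV. if p = r then w r q else 0)"
    by (intro sum.cong refl) simp
  finally show ?thesis by simp
qed

context metric_on
begin

lemma phi_tensor_weyl_plus:
  assumes "x \<in> U" "positive_frame G x e" "curvature_like (in_frame e T)"
  shows "in_frame e (weyl_plus_of x T) = phi_tensor (weyl_matrix (in_frame e T))"
  by (simp add: fun_eq_iff weyl_plus_of_frame[OF assms] phi_tensor_def)

lemma antisym_pairs_weyl_plus_of: "antisym_pairs (weyl_plus_of x T)"
proof -
  have "wedge v u = (-1) *\<^sub>R wedge u v" for u v
    by (simp add: wedge_def vec_eq_iff)
  then have *: "self_dual_part G x (wedge v u) = (-1) *\<^sub>R self_dual_part G x (wedge u v)" for u v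
    by (metis linear_scale[OF linear_self_dual_part])
  show ?thesis
    unfolding antisym_pairs_def weyl_plus_of_def
  proof (intro allI conjI)
    fix i j k l :: 4
    show "bivector_form (weyl_of x T) (self_dual_part G x (wedge (axis i 1) (axis j 1))) (self_dual_part G x (wedge (axis k 1) (axis l 1)))
      = - bivector_form (weyl_of x T) (self_dual_part G x (wedge (axis j 1) (axis i 1))) (self_dual_part G x (wedge (axis k 1) (axis l 1)))"
      unfolding *[of "axis j 1" "axis i 1"] linear_scale[OF linear_bivector_form_left] by simp
    show "bivector_form (weyl_of x T) (self_dual_part G x (wedge (axis i 1) (axis j 1))) (self_dual_part G x (wedge (axis k 1) (axis l 1)))
      = - bivector_form (weyl_of x T) (self_dual_part G x (wedge (axis i 1) (axis j 1))) (self_dual_part G x (wedge (axis l 1) (axis k 1)))"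
      unfolding *[of "axis l 1" "axis k 1"] linear_scale[OF linear_bivector_form_right] by simp
  qed
qed

lemma antisym_pairs_weyl_plus: "antisym_pairs (weyl_plus G x)"
  unfolding weyl_plus_eq by (rule antisym_pairs_weyl_plus_of)

lemma curv_inner_frame:
  assumes x: "x \<in> U" and e: "orthonormal_frame G x e" and "antisym_pairs S" "antisym_pairs T"
  shows "curv_inner G x S T
    = (\<Sum>a\<in>UNIV. \<Sum>b\<in>UNIV. \<Sum>c\<in>UNIV. \<Sum>d\<in>UNIV. in_frame e S a b c d * in_frame e T a b c d) / 4"
proof -
  have l: "list_sum 4 (\<lambda>as. frame_comp f (list_tensor S) as * frame_comp f (list_tensor T) as)
      = (\<Sum>a\<in>UNIV. \<Sum>b\<in>UNIV. \<Sum>c\<in>UNIV. \<Sum>d\<in>UNIV. in_frame f S a b c d * in_frame f T a b c d)" for f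
    by (simp only: numeral_eq_Suc pred_numeral_simps list_sum.simps in_frame_frame_comp BitM.simps Num.BitM.simps One_nat_def)
  have "curv_inner G x S T = (\<Sum>a\<in>UNIV. \<Sum>b\<in>UNIV. \<Sum>c\<in>UNIV. \<Sum>d\<in>UNIV.
      in_frame (frame G x) S a b c d * in_frame (frame G x) T a b c d) / 4"
    unfolding curv_inner_def using assms by (intro sum_less_pairs_product antisym_pairs_in_frame)
  then show ?thesis
    unfolding l[symmetric] using list_sum_frame_comp_invariant[OF x e orthonormal_frame_frame[OF x]] by simp
qed

lemma curv_inner_weyl_plus_of:
  assumes x: "x \<in> U" and e: "positive_frame G x e" and "curvature_like (in_frame e T)" "antisym_pairs S"
  shows "curv_inner G x S (weyl_plus_of x T)
    = (\<Sum>p\<in>UNIV. \<Sum>q\<in>UNIV. weyl_matrix (in_frame e T) p q * sd_pairing (in_frame e S) p q)"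
proof -
  have "orthonormal_frame G x e" using e by (simp add: positive_frame_def)
  from curv_inner_frame[OF x this assms(4) antisym_pairs_weyl_plus_of[of x T]]
  show ?thesis
    unfolding phi_tensor_weyl_plus[OF assms(1-3)] sum_phi_tensor .
qed

definition coframe :: "real^4 \<Rightarrow> (4 \<Rightarrow> real^4) \<Rightarrow> 4 \<Rightarrow> real^4" where
  "coframe x e a = G x *v e a"

lemma coframe_frame: "orthonormal_frame G x e \<Longrightarrow> (\<Sum>i\<in>UNIV. e a $ i * coframe x e b $ i) = (if a = b then 1 else 0)"
  by (simp add: orthonormal_frame_def coframe_def inner_vec_def)

lemma axis_coframe:
  assumes "x \<in> U" "orthonormal_frame G x e"
  shows "axis i 1 = (\<Sum>a\<in>UNIV. coframe x e a $ i *\<^sub>R e a)"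
proof -
  have "(\<Sum>a\<in>UNIV. coframe x e a $ i * e a $ k) = axis i 1 $ k" for k
  proof -
    have "(\<Sum>a\<in>UNIV. coframe x e a $ i * e a $ k) = (\<Sum>j\<in>UNIV. G x $ i $ j * ginv G x $ j $ k)"
      unfolding coframe_def matrix_vector_mult_def vec_lambda_beta ginv_frame[OF assms] sum_distrib_left sum_distrib_right
      by (subst sum.swap) (simp add: mult_ac)
    then show ?thesis by (simp add: G_ginv[OF assms(1)] axis_def)
  qed
  then show ?thesis by (simp add: vec_eq_iff)
qed

text \<open>
  Frame components of a bivector: contraction with the dual frame. On the \<open>Phi e p\<close> they recover
  \<open>\<phi>\<^sub>p\<close>, which proves linear independence.
\<close>

definition bivector_comp :: "real^4 \<Rightarrow> (4 \<Rightarrow> real^4) \<Rightarrow> 4 \<Rightarrow> 4 \<Rightarrow> real^4^4 \<Rightarrow> real" where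
  "bivector_comp x e a b \<alpha> = (\<Sum>i\<in>UNIV. \<Sum>j\<in>UNIV. \<alpha> $ i $ j * (coframe x e a $ i * coframe x e b $ j))"

lemma linear_bivector_comp: "linear (bivector_comp x e a b)"
  by (rule linearI) (simp_all add: bivector_comp_def sum.distrib sum_distrib_left algebra_simps)

lemma bivector_comp_outer:
  assumes "orthonormal_frame G x e"
  shows "bivector_comp x e a b (outer (e c) (e d)) = (if a = c then 1 else 0) * (if b = d then 1 else 0)"
proof -
  have "bivector_comp x e a b (outer (e c) (e d))
      = (\<Sum>i\<in>UNIV. e c $ i * coframe x e a $ i) * (\<Sum>j\<in>UNIV. e d $ j * coframe x e b $ j)"
    by (simp add: bivector_comp_def outer_def sum_product mult_ac)
  then show ?thesis by (simp add: coframe_frame[OF assms] eq_commute)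
qed

lemma bivector_comp_Phi:
  assumes "orthonormal_frame G x e"
  shows "bivector_comp x e a b (Phi e p) = phi p a b"
proof -
  have "bivector_comp x e a b (Phi e p) = (\<Sum>c\<in>UNIV. (if a = c then 1 else 0) * (\<Sum>d\<in>UNIV. (if b = d then 1 else 0) * phi p c d))"
    unfolding Phi_def linear_sum[OF linear_bivector_comp] linear_scale[OF linear_bivector_comp] bivector_comp_outer[OF assms]
    by (simp add: sum_distrib_left mult_ac)
  then show ?thesis by (simp only: sum_kronecker)
qed

lemma Phi_coefficients:
  assumes "orthonormal_frame G x e" "(\<Sum>p\<in>UNIV. c p *\<^sub>R Phi e p) = (\<Sum>p\<in>UNIV. d p *\<^sub>R Phi e p)"
  shows "c q = d q"
proof -
  have *: "(\<Sum>a\<in>UNIV. \<Sum>b\<in>UNIV. phi q a b * bivector_comp x e a b (\<Sum>p\<in>UNIV. c p *\<^sub>R Phi e p)) = 4 * c q" for c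
  proof -
    have "(\<Sum>a\<in>UNIV. \<Sum>b\<in>UNIV. phi q a b * bivector_comp x e a b (\<Sum>p\<in>UNIV. c p *\<^sub>R Phi e p))
        = (\<Sum>a\<in>UNIV. \<Sum>b\<in>UNIV. \<Sum>p\<in>UNIV. c p * (phi q a b * phi p a b))"
      by (simp add: linear_sum[OF linear_bivector_comp] linear_scale[OF linear_bivector_comp] bivector_comp_Phi[OF assms(1)] sum_distrib_left mult_ac)
    also have "\<dots> = (\<Sum>p\<in>UNIV. \<Sum>a\<in>UNIV. \<Sum>b\<in>UNIV. c p * (phi q a b * phi p a b))"
      by (subst sum.swap, rule sum.cong[OF refl], subst sum.swap) (rule refl)
    also have "\<dots> = (\<Sum>p\<in>UNIV. c p * (if q = p then 4 else 0))"
      by (simp only: sum_distrib_left[symmetric] phi_orthogonal)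
    also have "\<dots> = (\<Sum>p\<in>UNIV. if q = p then 4 * c p else 0)"
      by (rule sum.cong) auto
    finally show ?thesis by simp
  qed
  show ?thesis using *[of c] *[of d] unfolding assms(2) by simp
qed

lemma inj_Phi:
  assumes "orthonormal_frame G x e"
  shows "inj (Phi e)"
proof (rule injI)
  fix p q assume eq: "Phi e p = Phi e q"
  have s: "(\<Sum>r\<in>UNIV. (if r = p then 1 else 0) *\<^sub>R Phi e r) = Phi e p" for p
  proof -
    have "(\<Sum>r\<in>UNIV. (if r = p then 1 else 0) *\<^sub>R Phi e r) = (\<Sum>r\<in>UNIV. if r = p then Phi e r else 0)"
      by (rule sum.cong) auto
    then show ?thesis by simp
  qed
  have "(\<Sum>r\<in>UNIV. (if r = p then 1 else 0) *\<^sub>R Phi e r) = (\<Sum>r\<in>UNIV. (if r = q then 1 else 0) *\<^sub>R Phi e r)"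
    unfolding s by (rule eq)
  from Phi_coefficients[OF assms this, of p] show "p = q" by (simp split: if_splits)
qed

lemma independent_Phi:
  assumes "orthonormal_frame G x e"
  shows "independent (range (Phi e))"
proof (rule independent_if_scalars_zero)
  fix u v assume s: "(\<Sum>w\<in>range (Phi e). u w *\<^sub>R w) = 0" and v: "v \<in> range (Phi e)"
  have "(\<Sum>p\<in>UNIV. u (Phi e p) *\<^sub>R Phi e p) = (\<Sum>p\<in>UNIV. 0 *\<^sub>R Phi e p)"
    using s inj_Phi[OF assms] by (simp add: sum.reindex)
  from Phi_coefficients[OF assms this] v show "u v = 0" by auto
qed simp

text \<open>
  A self-dual bivector is its own self-dual part, and bivectors are combinations of the \<open>e\<^sub>a \<and> e\<^sub>b\<close>, whose
  self-dual parts are combinations of the \<open>Phi e p\<close>. Conversely each \<open>Phi e p\<close> is fixed by \<open>(1 + \<star>)/2\<close>, as the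
  \<open>\<phi>\<^sub>p\<close> are orthogonal.
\<close>

lemma self_dual_bivectors_eq_span:
  assumes x: "x \<in> U" and e: "positive_frame G x e"
  shows "span (range (Phi e)) = self_dual_bivectors G x"
proof -
  have on: "orthonormal_frame G x e" using e by (simp add: positive_frame_def)
  note lin = linear_sum[OF linear_self_dual_part] linear_scale[OF linear_self_dual_part]
  have sd: "self_dual_part G x \<alpha> \<in> span (range (Phi e))" if \<alpha>: "\<alpha> \<in> bivectors" for \<alpha>
  proof -
    have w: "self_dual_part G x (wedge (axis i 1) (axis j 1)) \<in> span (range (Phi e))" for i j
      unfolding axis_coframe[OF x on, of i] axis_coframe[OF x on, of j] wedge_bilinear lin self_dual_part_wedge_frame[OF x e]
      by (intro span_sum span_scale span_base) auto
    have "\<alpha> $ l $ k = - \<alpha> $ k $ l" for k l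
    proof -
      have "transpose \<alpha> $ k $ l = (- \<alpha>) $ k $ l" using \<alpha> by (simp add: bivectors_def)
      then show ?thesis by (simp add: transpose_def)
    qed
    note anti = this
    have ax: "axis i 1 $ k = (if i = k then 1 else 0)" for i k :: 4
      by (simp add: axis_def)
    have "\<alpha> = (\<Sum>i\<in>UNIV. \<Sum>j\<in>UNIV. (\<alpha> $ i $ j / 2) *\<^sub>R wedge (axis i 1) (axis j 1))"
    proof -
      have "(\<Sum>i\<in>UNIV. \<Sum>j\<in>UNIV. \<alpha> $ i $ j / 2 * (axis i 1 $ k * axis j 1 $ l - axis i 1 $ l * axis j 1 $ k)) = \<alpha> $ k $ l" for k l
      proof -
        have 1: "(\<Sum>i\<in>UNIV. \<Sum>j\<in>UNIV. \<alpha> $ i $ j / 2 * (axis i 1 $ k * axis j 1 $ l)) = \<alpha> $ k $ l / 2" for k l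
        proof -
          have "(\<Sum>i\<in>UNIV. \<Sum>j\<in>UNIV. \<alpha> $ i $ j / 2 * (axis i 1 $ k * axis j 1 $ l))
              = (\<Sum>i\<in>UNIV. (if i = k then 1 else 0) * (\<Sum>j\<in>UNIV. (if j = l then 1 else 0) * (\<alpha> $ i $ j / 2)))"
            unfolding ax by (simp only: sum_distrib_left mult_ac)
          then show ?thesis by (simp only: sum_kronecker)
        qed
        have "(\<Sum>i\<in>UNIV. \<Sum>j\<in>UNIV. \<alpha> $ i $ j / 2 * (axis i 1 $ k * axis j 1 $ l - axis i 1 $ l * axis j 1 $ k))
            = \<alpha> $ k $ l / 2 - \<alpha> $ l $ k / 2"
          unfolding right_diff_distrib sum_subtractf 1 ..
        then show ?thesis using anti[of l k] by simp
      qed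
      then show ?thesis by (simp add: vec_eq_iff wedge_def)
    qed
    from arg_cong[OF this, of "self_dual_part G x"]
    have "self_dual_part G x \<alpha> = (\<Sum>i\<in>UNIV. \<Sum>j\<in>UNIV. (\<alpha> $ i $ j / 2) *\<^sub>R self_dual_part G x (wedge (axis i 1) (axis j 1)))"
      unfolding lin .
    then show ?thesis using w by (simp add: span_sum span_scale)
  qed
  have Phi_biv: "Phi e p \<in> bivectors" for p
  proof -
    have "Phi e p $ l $ k = - Phi e p $ k $ l" for k l
    proof -
      have "Phi e p $ l $ k = (\<Sum>a\<in>UNIV. \<Sum>b\<in>UNIV. phi p b a * (e b $ l * e a $ k))"
        unfolding Phi_def outer_def by (subst sum.swap) simp
      also have "\<dots> = (\<Sum>a\<in>UNIV. \<Sum>b\<in>UNIV. - (phi p a b * (e a $ k * e b $ l)))"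
        by (subst phi_antisym) (simp add: mult_ac)
      finally show ?thesis by (simp add: Phi_def outer_def sum_negf)
    qed
    then show ?thesis
      unfolding bivectors_def mem_Collect_eq vec_eq_iff transpose_def vec_lambda_beta vector_uminus_component by blast
  qed
  have Phi_sd: "self_dual_part G x (Phi e p) = Phi e p" for p
  proof -
    have "Phi e p = (\<Sum>a\<in>UNIV. \<Sum>b\<in>UNIV. (phi p a b / 2) *\<^sub>R wedge (e a) (e b))"
    proof -
      have "(\<Sum>a\<in>UNIV. \<Sum>b\<in>UNIV. (phi p a b / 2) *\<^sub>R outer (e b) (e a)) = - (1/2) *\<^sub>R Phi e p"
      proof -
        have "(\<Sum>a\<in>UNIV. \<Sum>b\<in>UNIV. (phi p a b / 2) *\<^sub>R outer (e b) (e a)) = (\<Sum>a\<in>UNIV. \<Sum>b\<in>UNIV. (phi p b a / 2) *\<^sub>R outer (e a) (e b))"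
          by (rule sum.swap)
        also have "\<dots> = (\<Sum>a\<in>UNIV. \<Sum>b\<in>UNIV. (- (1/2) * phi p a b) *\<^sub>R outer (e a) (e b))"
          by (subst phi_antisym) simp
        finally show ?thesis unfolding Phi_def scaleR_sum_right scaleR_scaleR .
      qed
      moreover have "(\<Sum>a\<in>UNIV. \<Sum>b\<in>UNIV. (phi p a b / 2) *\<^sub>R outer (e a) (e b)) = (1/2) *\<^sub>R Phi e p"
        unfolding Phi_def scaleR_sum_right scaleR_scaleR by simp
      ultimately have "(\<Sum>a\<in>UNIV. \<Sum>b\<in>UNIV. (phi p a b / 2) *\<^sub>R wedge (e a) (e b)) = (1/2) *\<^sub>R Phi e p - (- (1/2)) *\<^sub>R Phi e p"
        unfolding wedge_outer scaleR_right_diff_distrib sum_subtractf by metis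
      then show ?thesis by (simp add: scaleR_left_diff_distrib[symmetric])
    qed
    from arg_cong[OF this, of "self_dual_part G x"]
    have "self_dual_part G x (Phi e p) = (\<Sum>a\<in>UNIV. \<Sum>b\<in>UNIV. (phi p a b / 2) *\<^sub>R (\<Sum>q\<in>UNIV. (phi q a b / 2) *\<^sub>R Phi e q))"
      unfolding lin self_dual_part_wedge_frame[OF x e] .
    also have "\<dots> = (\<Sum>a\<in>UNIV. \<Sum>b\<in>UNIV. \<Sum>q\<in>UNIV. ((phi p a b * phi q a b) / 4) *\<^sub>R Phi e q)"
      by (simp add: scaleR_sum_right)
    also have "\<dots> = (\<Sum>q\<in>UNIV. \<Sum>a\<in>UNIV. \<Sum>b\<in>UNIV. ((phi p a b * phi q a b) / 4) *\<^sub>R Phi e q)"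
      by (subst sum.swap, rule sum.cong[OF refl], subst sum.swap) (rule refl)
    also have "\<dots> = (\<Sum>q\<in>UNIV. ((if p = q then 4 else 0) / 4) *\<^sub>R Phi e q)"
      unfolding scaleR_sum_left[symmetric] sum_divide_distrib[symmetric] phi_orthogonal ..
    also have "\<dots> = (\<Sum>q\<in>UNIV. if p = q then Phi e q else 0)"
      by (rule sum.cong) auto
    finally show ?thesis by simp
  qed
  have fix_iff: "hodge G x \<alpha> = \<alpha> \<longleftrightarrow> self_dual_part G x \<alpha> = \<alpha>" for \<alpha>
  proof
    assume "self_dual_part G x \<alpha> = \<alpha>"
    then have "2 *\<^sub>R ((1/2) *\<^sub>R (\<alpha> + hodge G x \<alpha>)) = 2 *\<^sub>R \<alpha>" by (simp add: self_dual_part_def)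
    then show "hodge G x \<alpha> = \<alpha>" by (simp add: scaleR_2)
  next
    assume "hodge G x \<alpha> = \<alpha>"
    then show "self_dual_part G x \<alpha> = \<alpha>" by (simp add: self_dual_part_def scaleR_2[symmetric])
  qed
  have sub: "subspace (self_dual_bivectors G x)"
  proof -
    have "linear (\<lambda>\<alpha> :: real^4^4. transpose \<alpha> + \<alpha>)"
      by (rule linearI) (simp_all add: vec_eq_iff transpose_def algebra_simps)
    moreover have "linear (\<lambda>\<alpha>. hodge G x \<alpha> - \<alpha>)"
      by (rule linearI) (simp_all add: linear_add[OF linear_hodge] linear_scale[OF linear_hodge] algebra_simps)
    moreover have "self_dual_bivectors G x = {\<alpha>. transpose \<alpha> + \<alpha> = 0} \<inter> {\<alpha>. hodge G x \<alpha> - \<alpha> = 0}"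
      by (auto simp: self_dual_bivectors_def bivectors_def eq_neg_iff_add_eq_0)
    ultimately show ?thesis
      by (simp only: subspace_inter linear_subspace_kernel)
  qed
  show ?thesis
  proof
    show "span (range (Phi e)) \<subseteq> self_dual_bivectors G x"
      by (rule span_minimal[OF _ sub]) (auto simp: self_dual_bivectors_def Phi_biv fix_iff Phi_sd)
    show "self_dual_bivectors G x \<subseteq> span (range (Phi e))"
    proof
      fix \<alpha> assume "\<alpha> \<in> self_dual_bivectors G x"
      then have "\<alpha> \<in> bivectors" "self_dual_part G x \<alpha> = \<alpha>"
        by (simp_all add: self_dual_bivectors_def fix_iff)
      then show "\<alpha> \<in> span (range (Phi e))" using sd by metis
    qed
  qed
qed

lemma bivector_endo_Phi:
  assumes x: "x \<in> U" and e: "positive_frame G x e" and T: "in_frame e T = phi_tensor w"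
  shows "bivector_endo G x T (Phi e q) = (\<Sum>p\<in>UNIV. w p q *\<^sub>R Phi e p)"
proof -
  have on: "orthonormal_frame G x e" using e by (simp add: positive_frame_def)
  have o: "bivector_endo G x T (outer (e c) (e d))
      = (\<Sum>a\<in>UNIV. \<Sum>b\<in>UNIV. (in_frame e T a b c d / 2) *\<^sub>R outer (e a) (e b))" for c d
  proof -
    have "bivector_endo G x T (outer (e c) (e d)) $ i $ j
        = (\<Sum>a\<in>UNIV. \<Sum>b\<in>UNIV. in_frame e T a b c d / 2 * (e a $ i * e b $ j))" for i j
    proof -
      have "bivector_endo G x T (outer (e c) (e d)) $ i $ j
          = (\<Sum>p\<in>UNIV. \<Sum>q\<in>UNIV. \<Sum>k\<in>UNIV. \<Sum>l\<in>UNIV. \<Sum>b\<in>UNIV. \<Sum>a\<in>UNIV.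
             (T p q k l * e a $ p * e b $ q * e c $ k * e d $ l) / 2 * (e a $ i * e b $ j))"
        by (simp add: bivector_endo_def outer_def ginv_frame[OF x on] sum_product sum_distrib_left sum_distrib_right
            sum_divide_distrib mult_ac)
      also have "\<dots> = (\<Sum>a\<in>UNIV. \<Sum>b\<in>UNIV. \<Sum>p\<in>UNIV. \<Sum>q\<in>UNIV. \<Sum>k\<in>UNIV. \<Sum>l\<in>UNIV.
             (T p q k l * e a $ p * e b $ q * e c $ k * e d $ l) / 2 * (e a $ i * e b $ j))"
        by (subst sum_swap4[symmetric], subst sum_swap4[symmetric], rule sum.cong[OF refl], rule sum.cong[OF refl],
            rule sum.cong[OF refl], rule sum.cong[OF refl], rule sum.swap)
      finally show ?thesis
        unfolding sum_distrib_right[symmetric] sum_divide_distrib[symmetric] in_frame_def .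
    qed
    then show ?thesis by (simp add: vec_eq_iff) (simp add: outer_def)
  qed
  have c: "(\<Sum>c\<in>UNIV. \<Sum>d\<in>UNIV. phi q c d * (in_frame e T a b c d / 2)) = (\<Sum>p\<in>UNIV. w p q * phi p a b)" for a b
  proof -
    have "(\<Sum>c\<in>UNIV. \<Sum>d\<in>UNIV. phi q c d * (in_frame e T a b c d / 2))
        = (\<Sum>c\<in>UNIV. \<Sum>d\<in>UNIV. \<Sum>p\<in>UNIV. \<Sum>r\<in>UNIV. (w p r * phi p a b / 4) * (phi q c d * phi r c d))"
      by (simp add: T phi_tensor_def sum_distrib_left sum_divide_distrib mult_ac)
    also have "\<dots> = (\<Sum>p\<in>UNIV. \<Sum>c\<in>UNIV. \<Sum>d\<in>UNIV. \<Sum>r\<in>UNIV. (w p r * phi p a b / 4) * (phi q c d * phi r c d))"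
      by (subst sum.swap, rule sum.cong[OF refl], subst sum.swap) (rule refl)
    also have "\<dots> = (\<Sum>p\<in>UNIV. \<Sum>r\<in>UNIV. \<Sum>c\<in>UNIV. \<Sum>d\<in>UNIV. (w p r * phi p a b / 4) * (phi q c d * phi r c d))"
      by (rule sum.cong[OF refl], subst sum.swap, rule sum.cong[OF refl], subst sum.swap) (rule refl)
    also have "\<dots> = (\<Sum>p\<in>UNIV. \<Sum>r\<in>UNIV. (w p r * phi p a b / 4) * (if q = r then 4 else 0))"
      by (simp only: sum_distrib_left[symmetric] phi_orthogonal)
    also have "\<dots> = (\<Sum>p\<in>UNIV. \<Sum>r\<in>UNIV. if q = r then w p r * phi p a b else 0)"
      by (intro sum.cong refl) auto
    finally show ?thesis by simp
  qed
  have "bivector_endo G x T (Phi e q)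
      = (\<Sum>c\<in>UNIV. \<Sum>d\<in>UNIV. \<Sum>a\<in>UNIV. \<Sum>b\<in>UNIV. (phi q c d * (in_frame e T a b c d / 2)) *\<^sub>R outer (e a) (e b))"
    unfolding Phi_def linear_sum[OF linear_bivector_endo] linear_scale[OF linear_bivector_endo] o
    by (simp add: scaleR_sum_right)
  also have "\<dots> = (\<Sum>a\<in>UNIV. \<Sum>b\<in>UNIV. \<Sum>c\<in>UNIV. \<Sum>d\<in>UNIV. (phi q c d * (in_frame e T a b c d / 2)) *\<^sub>R outer (e a) (e b))"
  proof -
    have "(\<Sum>c\<in>UNIV. \<Sum>d\<in>UNIV. \<Sum>a\<in>UNIV. \<Sum>b\<in>UNIV. F c d a b) = (\<Sum>a\<in>UNIV. \<Sum>b\<in>UNIV. \<Sum>c\<in>UNIV. \<Sum>d\<in>UNIV. F c d a b)"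
      for F :: "4 \<Rightarrow> 4 \<Rightarrow> 4 \<Rightarrow> 4 \<Rightarrow> real^4^4"
    proof -
      have "(\<Sum>c\<in>UNIV. \<Sum>d\<in>UNIV. \<Sum>a\<in>UNIV. \<Sum>b\<in>UNIV. F c d a b) = (\<Sum>a\<in>UNIV. \<Sum>c\<in>UNIV. \<Sum>d\<in>UNIV. \<Sum>b\<in>UNIV. F c d a b)"
        by (rule trans[OF sum.cong[OF refl sum.swap] sum.swap])
      also have "\<dots> = (\<Sum>a\<in>UNIV. \<Sum>b\<in>UNIV. \<Sum>c\<in>UNIV. \<Sum>d\<in>UNIV. F c d a b)"
        by (rule sum.cong[OF refl], rule trans[OF sum.cong[OF refl sum.swap] sum.swap])
      finally show ?thesis .
    qed
    then show ?thesis .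
  qed
  also have "\<dots> = (\<Sum>a\<in>UNIV. \<Sum>b\<in>UNIV. (\<Sum>p\<in>UNIV. w p q * phi p a b) *\<^sub>R outer (e a) (e b))"
    unfolding scaleR_sum_left[symmetric] c ..
  also have "\<dots> = (\<Sum>a\<in>UNIV. \<Sum>b\<in>UNIV. \<Sum>p\<in>UNIV. (w p q * phi p a b) *\<^sub>R outer (e a) (e b))"
    unfolding scaleR_sum_left ..
  also have "\<dots> = (\<Sum>p\<in>UNIV. \<Sum>a\<in>UNIV. \<Sum>b\<in>UNIV. (w p q * phi p a b) *\<^sub>R outer (e a) (e b))"
    by (subst sum.swap, rule sum.cong[OF refl], subst sum.swap) (rule refl)
  finally show ?thesis by (simp add: Phi_def scaleR_sum_right)
qed

lemma det_weyl_plus_frame: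
  assumes x: "x \<in> U" and e: "positive_frame G x e" and R: "curvature_like (in_frame e (riem G x))"
  shows "det_weyl_plus G x = det (\<chi> p q. weyl_matrix (in_frame e (riem G x)) p q)"
  unfolding det_weyl_plus_def
proof (rule endo_det3_eq[where b = "Phi e"])
  show "span (range (Phi e)) = self_dual_bivectors G x"
    by (rule self_dual_bivectors_eq_span[OF x e])
  have on: "orthonormal_frame G x e" using e by (simp add: positive_frame_def)
  show "inj (Phi e)" "independent (range (Phi e))"
    using inj_Phi[OF on] independent_Phi[OF on] .
  have "in_frame e (weyl_plus G x) = phi_tensor (weyl_matrix (in_frame e (riem G x)))"
    unfolding weyl_plus_eq by (rule phi_tensor_weyl_plus[OF x e R])
  from bivector_endo_Phi[OF x e this]
  show "bivector_endo G x (weyl_plus G x) (Phi e j)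
      = (\<Sum>i\<in>UNIV. (\<chi> p q. weyl_matrix (in_frame e (riem G x)) p q) $ i $ j *\<^sub>R Phi e i)" for j
    by simp
qed (rule linear_bivector_endo)

end

section \<open>Derivatives along a frame that is parallel at a point\<close>

lemma gl_act_sum_matrix:
  "gl_act (\<lambda>p a. \<Sum>i\<in>(UNIV :: 'i::finite set). M i p a) T as = (\<Sum>i\<in>UNIV. gl_act (M i) T as)"
proof (induction as arbitrary: T)
  case (Cons a as)
  have "(\<Sum>p\<in>UNIV. (\<Sum>i\<in>UNIV. M i p a) * T (p # as)) = (\<Sum>i\<in>UNIV. \<Sum>p\<in>UNIV. M i p a * T (p # as))"
    unfolding sum_distrib_right by (rule sum.swap)
  then show ?case by (simp add: Cons.IH sum.distrib)
qed simp

lemma gl_act_cmult_matrix: "gl_act (\<lambda>p a. k * M p a) T as = k * gl_act M T as"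
  by (induction as arbitrary: T) (simp_all add: sum_distrib_left algebra_simps)

text \<open>
  The hypothesis says that \<open>N\<close> is the matrix of \<open>M\<close> in the frame \<open>e\<close>.
\<close>

lemma frame_comp_gl_act:
  assumes "\<And>a p. (\<Sum>q\<in>UNIV. N q a * e q $ p) = (\<Sum>i\<in>UNIV. M p i * e a $ i)"
  shows "frame_comp e (gl_act M T) as = gl_act N (frame_comp e T) as"
proof (induction as arbitrary: T)
  case (Cons a as)
  let ?F = "\<lambda>p. frame_comp e (\<lambda>bs. T (p # bs)) as"
  have "frame_comp e (gl_act M T) (a # as)
      = (\<Sum>i\<in>UNIV. \<Sum>p\<in>UNIV. M p i * e a $ i * ?F p) + (\<Sum>i\<in>UNIV. e a $ i * gl_act N (frame_comp e (\<lambda>bs. T (i # bs))) as)"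
    by (simp add: frame_comp_add frame_comp_sum frame_comp_cmult Cons.IH distrib_left sum.distrib sum_distrib_left mult_ac)
  also have "(\<Sum>i\<in>UNIV. \<Sum>p\<in>UNIV. M p i * e a $ i * ?F p) = (\<Sum>p\<in>UNIV. (\<Sum>q\<in>UNIV. N q a * e q $ p) * ?F p)"
    unfolding assms sum_distrib_right by (rule sum.swap)
  also have "\<dots> = (\<Sum>q\<in>UNIV. N q a * frame_comp e T (q # as))"
    by (simp add: sum_distrib_left sum_distrib_right mult.assoc) (rule sum.swap)
  also have "(\<Sum>i\<in>UNIV. e a $ i * gl_act N (frame_comp e (\<lambda>bs. T (i # bs))) as) = gl_act N (\<lambda>bs. frame_comp e T (a # bs)) as"
    by (simp add: gl_act_sum gl_act_cmult)
  finally show ?case by simp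
qed simp

lemma frm5_rotate:
  "frame_comp e T [b, c, a, d, f] = frame_comp e (\<lambda>bs. T [bs ! 1, bs ! 2, bs ! 0, bs ! 3, bs ! 4]) [a, b, c, d, f]"
proof -
  have "frame_comp e T [b, c, a, d, f] = (\<Sum>j\<in>UNIV. \<Sum>k\<in>UNIV. \<Sum>i\<in>UNIV. e a $ i * (e b $ j * (e c $ k * frame_comp e (\<lambda>bs. T (j # k # i # bs)) [d, f])))"
    by (simp add: sum_distrib_left mult_ac)
  also have "\<dots> = (\<Sum>i\<in>UNIV. \<Sum>j\<in>UNIV. \<Sum>k\<in>UNIV. e a $ i * (e b $ j * (e c $ k * frame_comp e (\<lambda>bs. T (j # k # i # bs)) [d, f])))"
    by (rule trans[OF sum.cong[OF refl sum.swap] sum.swap])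
  also have "\<dots> = frame_comp e (\<lambda>bs. T [bs ! 1, bs ! 2, bs ! 0, bs ! 3, bs ! 4]) [a, b, c, d, f]"
    by (simp add: sum_distrib_left)
  finally show ?thesis .
qed

lemma weyl_matrix_expand:
  "weyl_matrix T p q = (\<Sum>a\<in>UNIV. \<Sum>b\<in>UNIV. \<Sum>c\<in>UNIV. \<Sum>d\<in>UNIV. (phi p a b * phi q c d / 8) * T a b c d)
     - (\<Sum>a\<in>UNIV. \<Sum>b\<in>UNIV. (if p = q then 1 / 12 else 0) * T a b a b)"
  by (simp add: weyl_matrix_def sd_pairing_def Sc_def Ric_def sum_divide_distrib mult_ac)

lemma weyl_matrix_sum: "weyl_matrix (\<lambda>a b c d. \<Sum>i\<in>(UNIV :: 'i::finite set). k i * T i a b c d) p q = (\<Sum>i\<in>UNIV. k i * weyl_matrix (T i) p q)"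
proof -
  have "(\<Sum>a\<in>UNIV. \<Sum>b\<in>UNIV. \<Sum>c\<in>UNIV. \<Sum>d\<in>UNIV. (phi p a b * phi q c d / 8) * (\<Sum>i\<in>UNIV. k i * T i a b c d))
      = (\<Sum>i\<in>UNIV. k i * (\<Sum>a\<in>UNIV. \<Sum>b\<in>UNIV. \<Sum>c\<in>UNIV. \<Sum>d\<in>UNIV. (phi p a b * phi q c d / 8) * T i a b c d))"
    unfolding sum_distrib_left by (subst sum_swap4) (simp add: mult_ac)
  moreover have "(\<Sum>a\<in>UNIV. \<Sum>b\<in>UNIV. (if p = q then 1 / 12 else 0) * (\<Sum>i\<in>UNIV. k i * T i a b a b))
      = (\<Sum>i\<in>UNIV. k i * (\<Sum>a\<in>UNIV. \<Sum>b\<in>UNIV. (if p = q then 1 / 12 else 0) * T i a b a b))"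
    unfolding sum_distrib_left
    by (rule trans[OF sum.cong[OF refl sum.swap] trans[OF sum.swap]]) (simp add: mult_ac)
  ultimately show ?thesis
    unfolding weyl_matrix_expand right_diff_distrib sum_subtractf by simp
qed

lemma weyl_matrix_add: "weyl_matrix (\<lambda>a b c d. S a b c d + T a b c d) p q = weyl_matrix S p q + weyl_matrix T p q"
  by (simp add: weyl_matrix_def sd_pairing_add Sc_def Ric_def sum.distrib add_divide_distrib)

lemma weyl_matrix_cmult: "weyl_matrix (\<lambda>a b c d. k * T a b c d) p q = k * weyl_matrix T p q"
  by (simp add: weyl_matrix_def sd_pairing_cmult Sc_def Ric_def sum_distrib_left[symmetric] algebra_simps)

lemma pd_weyl_matrix:
  assumes "\<And>a b c d. (\<lambda>y. F y a b c d) differentiable (at x)"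
  shows "(\<lambda>y. weyl_matrix (F y) p q) differentiable (at x)"
    and "pd m (\<lambda>y. weyl_matrix (F y) p q) x = weyl_matrix (\<lambda>a b c d. pd m (\<lambda>y. F y a b c d) x) p q"
proof -
  have d: "(\<lambda>y. k * F y a b c d) differentiable (at x)" for k a b c d
    using assms by (intro differentiable_mult) simp_all
  define K where "K a b c d = phi p a b * phi q c d / 8" for a b c d
  define k :: real where "k = (if p = q then 1 / 12 else 0)"
  have w: "weyl_matrix T p q = (\<Sum>a\<in>UNIV. \<Sum>b\<in>UNIV. \<Sum>c\<in>UNIV. \<Sum>d\<in>UNIV. K a b c d * T a b c d)
     - (\<Sum>a\<in>UNIV. \<Sum>b\<in>UNIV. k * T a b a b)" for T
    unfolding K_def k_def by (rule weyl_matrix_expand)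
  show "(\<lambda>y. weyl_matrix (F y) p q) differentiable (at x)"
    unfolding w using d by (intro differentiable_diff differentiable_sum) simp_all
  show "pd m (\<lambda>y. weyl_matrix (F y) p q) x = weyl_matrix (\<lambda>a b c d. pd m (\<lambda>y. F y a b c d) x) p q"
    unfolding w using d
    by (simp add: pd_diff pd_sum pd_cmult assms differentiable_sum)
qed

context metric_on
begin

lemma curvature_like_in_frame:
  assumes "curvature_like T"
  shows "curvature_like (in_frame e T)"
  unfolding curvature_like_def
proof (intro conjI allI)
  show "antisym_pairs (in_frame e T)"
    using assms by (intro antisym_pairs_in_frame) (simp add: curvature_like_def)
  fix a b c d
  have T: "T i j k l = T k l i j" for i j k l
    using assms unfolding curvature_like_def by blast
  have "in_frame e T a b c d = (\<Sum>i\<in>UNIV. \<Sum>k\<in>UNIV. \<Sum>j\<in>UNIV. \<Sum>l\<in>UNIV. T k l i j * e a $ i * e b $ j * e c $ k * e d $ l)"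
    unfolding in_frame_def by (subst T, rule sum.cong[OF refl], rule sum.swap)
  also have "\<dots> = (\<Sum>k\<in>UNIV. \<Sum>i\<in>UNIV. \<Sum>l\<in>UNIV. \<Sum>j\<in>UNIV. T k l i j * e a $ i * e b $ j * e c $ k * e d $ l)"
    by (rule trans[OF sum.swap], rule sum.cong[OF refl], rule sum.cong[OF refl], rule sum.swap)
  also have "\<dots> = (\<Sum>k\<in>UNIV. \<Sum>l\<in>UNIV. \<Sum>i\<in>UNIV. \<Sum>j\<in>UNIV. T k l i j * e a $ i * e b $ j * e c $ k * e d $ l)"
    by (rule sum.cong[OF refl], rule sum.swap)
  finally show "in_frame e T a b c d = in_frame e T c d a b"
    by (simp add: in_frame_def mult_ac)
qed

lemma curvature_like_riem: "x \<in> U \<Longrightarrow> curvature_like (riem G x)"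
  unfolding curvature_like_def antisym_pairs_def
  by (intro conjI allI) (rule riem_antisym12 riem_antisym34 riem_pair_sym; assumption?)+

lemma in_frame_bianchi1:
  assumes "x \<in> U"
  shows "in_frame e (riem G x) i j k l + in_frame e (riem G x) j l k i + in_frame e (riem G x) l i k j = 0"
proof -
  have 1: "in_frame e T j l k i = in_frame e (\<lambda>a b c d. T b d c a) i j k l" for T i j l
  proof -
    have "in_frame e T j l k i = (\<Sum>b\<in>UNIV. \<Sum>d\<in>UNIV. \<Sum>c\<in>UNIV. \<Sum>a\<in>UNIV. T b d c a * e j $ b * e l $ d * e k $ c * e i $ a)"
      by (simp add: in_frame_def)
    also have "\<dots> = (\<Sum>a\<in>UNIV. \<Sum>b\<in>UNIV. \<Sum>d\<in>UNIV. \<Sum>c\<in>UNIV. T b d c a * e j $ b * e l $ d * e k $ c * e i $ a)"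
      by (rule trans[OF sum.cong[OF refl trans[OF sum.cong[OF refl sum.swap] sum.swap]] sum.swap])
    also have "\<dots> = (\<Sum>a\<in>UNIV. \<Sum>b\<in>UNIV. \<Sum>c\<in>UNIV. \<Sum>d\<in>UNIV. T b d c a * e j $ b * e l $ d * e k $ c * e i $ a)"
      by (rule sum.cong[OF refl], rule sum.cong[OF refl], rule sum.swap)
    finally show ?thesis by (simp add: in_frame_def mult_ac)
  qed
  have 2: "in_frame e T l i k j = in_frame e (\<lambda>a b c d. T d a c b) i j k l" for T
    unfolding 1[where T = T and j = l and l = i and i = j] by (rule 1)
  have "in_frame e (riem G x) i j k l + in_frame e (riem G x) j l k i + in_frame e (riem G x) l i k j
      = in_frame e (\<lambda>a b c d. riem G x a b c d + riem G x b d c a + riem G x d a c b) i j k l"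
    by (simp only: 1[where T = "riem G x" and i = i and j = j and l = l] 2 in_frame_add)
  also have "\<dots> = 0"
    by (simp add: riem_bianchi1[OF assms] in_frame_def)
  finally show ?thesis .
qed

abbreviation Rm_frame :: "(4 \<Rightarrow> real^4) \<Rightarrow> real^4 \<Rightarrow> tensor4" where
  "Rm_frame e y a b c d \<equiv> frame_comp e (\<lambda>bs. Rm bs y) [a, b, c, d]"

abbreviation dRm_frame :: "(4 \<Rightarrow> real^4) \<Rightarrow> real^4 \<Rightarrow> 4 \<Rightarrow> tensor4" where
  "dRm_frame e y m a b c d \<equiv> frame_comp e (\<lambda>bs. nabla G Rm bs y) [m, a, b, c, d]"

abbreviation ddRm_frame :: "(4 \<Rightarrow> real^4) \<Rightarrow> real^4 \<Rightarrow> 4 \<Rightarrow> 4 \<Rightarrow> tensor4" where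
  "ddRm_frame e y n m a b c d \<equiv> frame_comp e (\<lambda>bs. nabla G (nabla G Rm) bs y) [n, m, a, b, c, d]"

lemma in_frame_riem: "in_frame e (riem G y) = Rm_frame e y"
proof -
  have "list_tensor (riem G y) = (\<lambda>bs. Rm bs y)" by (simp add: fun_eq_iff list_tensor_def field4_def)
  then show ?thesis by (simp only: fun_eq_iff in_frame_frame_comp) simp
qed

lemma Rm_frame_curvature: "y \<in> U \<Longrightarrow> curvature_like (Rm_frame e y)"
  using curvature_like_in_frame[OF curvature_like_riem] by (simp only: in_frame_riem[symmetric])

lemma Rm_frame_bianchi1: "y \<in> U \<Longrightarrow> Rm_frame e y i j k l + Rm_frame e y j l k i + Rm_frame e y l i k j = 0"
  using in_frame_bianchi1[of y e i j k l] unfolding in_frame_riem .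

end

text \<open>
  Identities that hold near \<open>x\<close> in every positive orthonormal frame are differentiated at \<open>x\<close> by means of
  \<open>frame_deriv\<close>, the derivative in the direction of a vector of the adapted frame \<open>v\<close>.
\<close>

locale adapted = metric_on +
  fixes x :: "real^4" and v :: "real^4 \<Rightarrow> 4 \<Rightarrow> real^4"
  assumes xU: "x \<in> U" and adapted: "adapted_frame x v"
begin

abbreviation e :: "4 \<Rightarrow> real^4" where "e \<equiv> v x"

definition frame_deriv :: "4 \<Rightarrow> (real^4 \<Rightarrow> real) \<Rightarrow> real" where
  "frame_deriv a h = (\<Sum>n\<in>UNIV. e a $ n * pd n h x)"

lemma ev: "eventually (\<lambda>y. y \<in> U \<and> positive_frame G y (v y)) (nhds x)"
  using adapted eventually_in_U[OF xU] unfolding adapted_frame_def by (auto elim: eventually_conj)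

lemma par: "parallel_at x (\<lambda>y. v y a)"
  using adapted unfolding adapted_frame_def by blast

lemma v_diff: "(\<lambda>y. v y a $ i) differentiable (at x)"
  using par unfolding parallel_at_def by blast

lemma pos: "positive_frame G x e" and on: "orthonormal_frame G x e"
  using eventually_nhds_x_imp_x[OF ev] by (auto simp: positive_frame_def)

lemma frame_deriv_add: "f differentiable (at x) \<Longrightarrow> g differentiable (at x) \<Longrightarrow> frame_deriv a (\<lambda>y. f y + g y) = frame_deriv a f + frame_deriv a g"
  by (simp add: frame_deriv_def pd_add distrib_left sum.distrib)

lemma frame_deriv_minus: "f differentiable (at x) \<Longrightarrow> frame_deriv a (\<lambda>y. - f y) = - frame_deriv a f"
  by (simp add: frame_deriv_def pd_minus sum_negf)

lemma frame_deriv_mult: "f differentiable (at x) \<Longrightarrow> g differentiable (at x) \<Longrightarrow> frame_deriv a (\<lambda>y. f y * g y) = frame_deriv a f * g x + f x * frame_deriv a g"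
  by (simp add: frame_deriv_def pd_mult distrib_left sum.distrib sum_distrib_left sum_distrib_right mult_ac)

lemma frame_deriv_sum: "(\<And>i. i \<in> A \<Longrightarrow> f i differentiable (at x)) \<Longrightarrow> frame_deriv a (\<lambda>y. \<Sum>i\<in>A. f i y) = (\<Sum>i\<in>A. frame_deriv a (f i))"
  by (simp add: frame_deriv_def pd_sum sum_distrib_left) (rule sum.swap)

lemma frame_deriv_const: "frame_deriv a (\<lambda>y. c) = 0"
  by (simp add: frame_deriv_def)

lemma frame_deriv_cong:
  assumes "\<And>y. y \<in> U \<Longrightarrow> positive_frame G y (v y) \<Longrightarrow> f y = g y"
  shows "frame_deriv a f = frame_deriv a g"
proof -
  have "eventually (\<lambda>y. f y = g y) (nhds x)"
    using ev by eventually_elim (use assms in blast)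
  then show ?thesis by (simp add: frame_deriv_def eventually_pd_cong(1))
qed

lemma frame_comp_nabla:
  assumes "\<And>as. T as differentiable (at x)"
  shows "frame_comp e (\<lambda>bs. nabla G T bs x) (a # as) = frame_deriv a (\<lambda>y. frame_comp (v y) (\<lambda>bs. T bs y) as)"
  unfolding frame_deriv_def using pd_frame_comp_parallel[OF par assms] by simp

lemma Rm_diff: "Rm as differentiable (at x)" and nabla_Rm_diff: "nabla G Rm as differentiable (at x)"
  using smooth_Rm smooth_nabla_Rm xU smooth_on_differentiable by blast+

lemma Rm_frame_diff: "(\<lambda>y. Rm_frame (v y) y a b c d) differentiable (at x)"
  by (rule frame_comp_differentiable) (rule v_diff Rm_diff)+

lemma dRm_frame_diff: "(\<lambda>y. dRm_frame (v y) y m a b c d) differentiable (at x)"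
  by (rule frame_comp_differentiable) (rule v_diff nabla_Rm_diff)+

lemma dRm_frame_frame_deriv: "dRm_frame e x m a b c d = frame_deriv m (\<lambda>y. Rm_frame (v y) y a b c d)"
  by (rule frame_comp_nabla) (rule Rm_diff)

lemma ddRm_frame_frame_deriv: "ddRm_frame e x n m a b c d = frame_deriv n (\<lambda>y. dRm_frame (v y) y m a b c d)"
  by (rule frame_comp_nabla) (rule nabla_Rm_diff)

lemma dRm_frame_curvature: "curvature_like (dRm_frame e x m)"
  unfolding curvature_like_def antisym_pairs_def
proof (intro conjI allI)
  fix a b c d
  note s = Rm_frame_curvature[unfolded curvature_like_def antisym_pairs_def]
  have "dRm_frame e x m a b c d = frame_deriv m (\<lambda>y. - Rm_frame (v y) y b a c d)"
    unfolding dRm_frame_frame_deriv by (rule frame_deriv_cong) (use s in blast)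
  then show "dRm_frame e x m a b c d = - dRm_frame e x m b a c d"
    unfolding dRm_frame_frame_deriv frame_deriv_minus[OF Rm_frame_diff] .
  have "dRm_frame e x m a b c d = frame_deriv m (\<lambda>y. - Rm_frame (v y) y a b d c)"
    unfolding dRm_frame_frame_deriv by (rule frame_deriv_cong) (use s in blast)
  then show "dRm_frame e x m a b c d = - dRm_frame e x m a b d c"
    unfolding dRm_frame_frame_deriv frame_deriv_minus[OF Rm_frame_diff] .
  show "dRm_frame e x m a b c d = dRm_frame e x m c d a b"
    unfolding dRm_frame_frame_deriv by (rule frame_deriv_cong) (use s in blast)
qed

end

context metric_on
begin

lemma adapted_at:
  assumes "y \<in> U" "positive_frame G y e"
  obtains v where "adapted U G y v" "v y = e"
proof -
  obtain v where "adapted_frame y v" "v y = e"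
    using adapted_frame_exists[OF assms] by blast
  moreover from this(1) have "adapted U G y v"
    using assms(1) by unfold_locales
  ultimately show ?thesis using that by blast
qed

lemma dRm_frame_curvature_like:
  assumes "y \<in> U" "positive_frame G y e"
  shows "curvature_like (dRm_frame e y m)"
proof -
  obtain v where v: "adapted U G y v" "v y = e" using adapted_at[OF assms] by blast
  show ?thesis using adapted.dRm_frame_curvature[OF v(1), of m] unfolding v(2) .
qed

lemma dRm_frame_bianchi2:
  assumes "y \<in> U"
  shows "dRm_frame e y m a b c d + dRm_frame e y a b m c d + dRm_frame e y b m a c d = 0"
proof -
  let ?T = "\<lambda>bs. nabla G Rm bs y"
  have 2: "frame_comp e ?T [a, b, m, c, d] = frame_comp e (\<lambda>bs. ?T [bs ! 1, bs ! 2, bs ! 0, bs ! 3, bs ! 4]) [m, a, b, c, d]"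
    by (rule frm5_rotate)
  have 3: "frame_comp e ?T [b, m, a, c, d] = frame_comp e (\<lambda>bs. ?T [bs ! 2, bs ! 0, bs ! 1, bs ! 3, bs ! 4]) [m, a, b, c, d]"
    by (subst frm5_rotate, subst frm5_rotate) simp
  have "dRm_frame e y m a b c d + dRm_frame e y a b m c d + dRm_frame e y b m a c d
      = frame_comp e (\<lambda>bs. ?T bs + ?T [bs ! 1, bs ! 2, bs ! 0, bs ! 3, bs ! 4] + ?T [bs ! 2, bs ! 0, bs ! 1, bs ! 3, bs ! 4]) [m, a, b, c, d]"
    unfolding 2 3 frame_comp_add ..
  also have "\<dots> = frame_comp e (\<lambda>bs. 0) [m, a, b, c, d]"
  proof (rule frame_comp_cong)
    fix bs :: "4 list" assume "length bs = length [m, a, b, c, d]"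
    then obtain i j k l n where "bs = [i, j, k, l, n]"
      by (auto simp: length_Suc_conv)
    then show "?T bs + ?T [bs ! 1, bs ! 2, bs ! 0, bs ! 3, bs ! 4] + ?T [bs ! 2, bs ! 0, bs ! 1, bs ! 3, bs ! 4] = 0"
      using riem_bianchi2[OF assms, of i j k l n] by simp
  qed
  finally show ?thesis by (simp only: frame_comp_zero)
qed

text \<open>
  Contracting the curvature operator with the frame and expanding the result in the frame lowers its
  index, so that only components of the curvature tensor are left.
\<close>

lemma frame_comp_ricci_identity:
  assumes x: "x \<in> U" and e: "orthonormal_frame G x e" and T: "\<And>as. smooth_on U (T as)"
  shows "frame_comp e (\<lambda>bs. nabla G (nabla G T) bs x) (c # d # as) - frame_comp e (\<lambda>bs. nabla G (nabla G T) bs x) (d # c # as)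
    = - gl_act (\<lambda>q a. Rm_frame e x c d q a) (frame_comp e (\<lambda>bs. T bs x)) as"
proof -
  let ?N = "\<lambda>bs. nabla G (nabla G T) bs x"
  have "frame_comp e ?N (d # c # as) = (\<Sum>i\<in>UNIV. \<Sum>j\<in>UNIV. e c $ i * (e d $ j * frame_comp e (\<lambda>bs. ?N (j # i # bs)) as))"
    by (simp add: sum_distrib_left mult_ac) (subst sum.swap, simp add: mult_ac)
  moreover have "frame_comp e ?N (c # d # as) = (\<Sum>i\<in>UNIV. \<Sum>j\<in>UNIV. e c $ i * (e d $ j * frame_comp e (\<lambda>bs. ?N (i # j # bs)) as))"
    by (simp add: sum_distrib_left mult_ac)
  ultimately have "frame_comp e ?N (c # d # as) - frame_comp e ?N (d # c # as)
      = (\<Sum>i\<in>UNIV. \<Sum>j\<in>UNIV. e c $ i * (e d $ j * frame_comp e (\<lambda>bs. ?N (i # j # bs) - ?N (j # i # bs)) as))"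
    by (simp add: frame_comp_diff right_diff_distrib sum_subtractf)
  also have "\<dots> = (\<Sum>i\<in>UNIV. \<Sum>j\<in>UNIV. e c $ i * (e d $ j * frame_comp e (\<lambda>bs. (-1) * gl_act (\<lambda>p a. curv_op G p a i j x) (\<lambda>bs. T bs x) bs) as))"
    by (simp add: ricci_identity[OF T x])
  also have "\<dots> = - frame_comp e (\<lambda>bs. \<Sum>i\<in>UNIV. \<Sum>j\<in>UNIV. e c $ i * (e d $ j * gl_act (\<lambda>p a. curv_op G p a i j x) (\<lambda>bs. T bs x) bs)) as"
    by (simp only: frame_comp_cmult frame_comp_sum finite) (simp add: sum_negf)
  also have "(\<lambda>bs. \<Sum>i\<in>UNIV. \<Sum>j\<in>UNIV. e c $ i * (e d $ j * gl_act (\<lambda>p a. curv_op G p a i j x) (\<lambda>bs. T bs x) bs))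
      = gl_act (\<lambda>p a. \<Sum>i\<in>UNIV. \<Sum>j\<in>UNIV. e c $ i * (e d $ j * curv_op G p a i j x)) (\<lambda>bs. T bs x)"
    by (simp only: fun_eq_iff gl_act_sum_matrix gl_act_cmult_matrix simp_thms)
  also have "frame_comp e (gl_act (\<lambda>p a. \<Sum>i\<in>UNIV. \<Sum>j\<in>UNIV. e c $ i * (e d $ j * curv_op G p a i j x)) (\<lambda>bs. T bs x)) as
      = gl_act (\<lambda>q a. Rm_frame e x c d q a) (frame_comp e (\<lambda>bs. T bs x)) as"
  proof (rule frame_comp_gl_act)
    fix a p
    have r: "(\<Sum>k\<in>UNIV. ginv G x $ p $ k * riem G x i j k l) = curv_op G p l i j x" for i j l
    proof -
      have "ginv G x $ p $ k = ginv G x $ k $ p" for k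
        unfolding ginv_frame[OF x e] by (simp add: mult.commute)
      then have "(\<Sum>k\<in>UNIV. ginv G x $ p $ k * riem G x i j k l)
          = (\<Sum>k\<in>UNIV. \<Sum>m\<in>UNIV. (G x $ m $ k * ginv G x $ k $ p) * curv_op G m l i j x)"
        by (simp add: riem_def sum_distrib_left symG[OF x] mult_ac)
      also have "\<dots> = (\<Sum>m\<in>UNIV. (\<Sum>k\<in>UNIV. G x $ m $ k * ginv G x $ k $ p) * curv_op G m l i j x)"
        unfolding sum_distrib_right by (rule sum.swap)
      finally show ?thesis by (simp only: G_ginv[OF x] sum_kronecker)
    qed
    have "(\<Sum>q\<in>UNIV. Rm_frame e x c d q a * e q $ p)
        = (\<Sum>q\<in>UNIV. \<Sum>i\<in>UNIV. \<Sum>j\<in>UNIV. \<Sum>k\<in>UNIV. \<Sum>l\<in>UNIV.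
            e c $ i * (e d $ j * (e a $ l * (riem G x i j k l * (e q $ p * e q $ k)))))"
      by (simp add: sum_distrib_left sum_distrib_right mult_ac)
    also have "\<dots> = (\<Sum>i\<in>UNIV. \<Sum>j\<in>UNIV. \<Sum>k\<in>UNIV. \<Sum>l\<in>UNIV. \<Sum>q\<in>UNIV.
            e c $ i * (e d $ j * (e a $ l * (riem G x i j k l * (e q $ p * e q $ k)))))"
      by (rule sum_swap4[symmetric])
    also have "\<dots> = (\<Sum>i\<in>UNIV. \<Sum>j\<in>UNIV. \<Sum>k\<in>UNIV. \<Sum>l\<in>UNIV.
            e c $ i * (e d $ j * (e a $ l * (ginv G x $ p $ k * riem G x i j k l))))"
      by (simp only: sum_distrib_left[symmetric] ginv_frame[OF x e, symmetric]) (simp only: mult.commute)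
    also have "\<dots> = (\<Sum>i\<in>UNIV. \<Sum>j\<in>UNIV. \<Sum>l\<in>UNIV. \<Sum>k\<in>UNIV.
            e c $ i * (e d $ j * (e a $ l * (ginv G x $ p $ k * riem G x i j k l))))"
      by (rule sum.cong[OF refl], rule sum.cong[OF refl], rule sum.swap)
    also have "\<dots> = (\<Sum>i\<in>UNIV. \<Sum>j\<in>UNIV. \<Sum>l\<in>UNIV. e c $ i * (e d $ j * (e a $ l * curv_op G p l i j x)))"
      by (simp only: sum_distrib_left[symmetric] r)
    also have "\<dots> = (\<Sum>l\<in>UNIV. \<Sum>i\<in>UNIV. \<Sum>j\<in>UNIV. e c $ i * (e d $ j * (e a $ l * curv_op G p l i j x)))"
      by (rule trans[OF sum.cong[OF refl sum.swap] sum.swap])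
    also have "\<dots> = (\<Sum>i'\<in>UNIV. (\<Sum>i\<in>UNIV. \<Sum>j\<in>UNIV. e c $ i * (e d $ j * curv_op G p i' i j x)) * e a $ i')"
      by (simp add: sum_distrib_right sum_distrib_left mult_ac)
    finally show "(\<Sum>q\<in>UNIV. Rm_frame e x c d q a * e q $ p)
        = (\<Sum>i'\<in>UNIV. (\<Sum>i\<in>UNIV. \<Sum>j\<in>UNIV. e c $ i * (e d $ j * curv_op G p i' i j x)) * e a $ i')" .
  qed
  finally show ?thesis .
qed

end

section \<open>The Laplacian of the squared norm\<close>

\<comment> \<open>From here on frame components are no longer expanded into sums over coordinates.\<close>
declare frame_comp.simps(2) [simp del]

context metric_on
begin

abbreviation coord_dRm_frame :: "(4 \<Rightarrow> real^4) \<Rightarrow> real^4 \<Rightarrow> 4 \<Rightarrow> tensor4" where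
  "coord_dRm_frame e y m a b c d \<equiv> frame_comp e (\<lambda>bs. nabla G Rm (m # bs) y) [a, b, c, d]"

lemma weyl_plus_frame:
  assumes "y \<in> U" "positive_frame G y e"
  shows "in_frame e (weyl_plus G y) = phi_tensor (weyl_matrix (Rm_frame e y))"
  unfolding weyl_plus_eq
  using phi_tensor_weyl_plus[OF assms, of "riem G y"] Rm_frame_curvature[OF assms(1)] by (simp only: in_frame_riem)

lemma curv_inner_weyl_plus:
  assumes "y \<in> U" "positive_frame G y e" "antisym_pairs S"
  shows "curv_inner G y S (weyl_plus G y) = (\<Sum>p\<in>UNIV. \<Sum>q\<in>UNIV. weyl_matrix (Rm_frame e y) p q * sd_pairing (in_frame e S) p q)"
  unfolding weyl_plus_eq
  using curv_inner_weyl_plus_of[OF assms(1,2), of "riem G y" S] Rm_frame_curvature[OF assms(1)] assms(3)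
  by (simp only: in_frame_riem)

lemma normsq_frame:
  assumes "y \<in> U" "positive_frame G y e"
  shows "weyl_plus_normsq G y = (\<Sum>p\<in>UNIV. \<Sum>q\<in>UNIV. weyl_matrix (Rm_frame e y) p q * weyl_matrix (Rm_frame e y) p q)"
  unfolding weyl_plus_normsq_def curv_inner_weyl_plus[OF assms antisym_pairs_weyl_plus] weyl_plus_frame[OF assms] sd_pairing_phi_tensor ..

text \<open>
  The derivative of a parallel field supplies the Christoffel term of the Hessian.
\<close>

lemma hess_parallel:
  assumes w: "parallel_at x w" and u: "\<And>m. pd m u differentiable (at x)"
  shows "pd n (\<lambda>y. \<Sum>m\<in>UNIV. w y $ m * pd m u y) x = (\<Sum>m\<in>UNIV. w x $ m * hess G u x $ n $ m)"
proof -
  have w': "(\<lambda>y. w y $ m) differentiable (at x)" "pd n (\<lambda>y. w y $ m) x = - (\<Sum>p\<in>UNIV. Gam m n p x * w x $ p)" for m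
    using w by (simp_all add: parallel_at_def)
  have "pd n (\<lambda>y. \<Sum>m\<in>UNIV. w y $ m * pd m u y) x
      = (\<Sum>m\<in>UNIV. w x $ m * pd n (pd m u) x) - (\<Sum>m\<in>UNIV. \<Sum>p\<in>UNIV. Gam m n p x * w x $ p * pd m u x)"
    using w' u by (simp add: pd_sum pd_mult differentiable_mult sum.distrib sum_negf sum_subtractf sum_distrib_right)
  also have "(\<Sum>m\<in>UNIV. \<Sum>p\<in>UNIV. Gam m n p x * w x $ p * pd m u x)
      = (\<Sum>p\<in>UNIV. w x $ p * (\<Sum>m\<in>UNIV. Gam m n p x * pd m u x))"
    by (subst sum.swap) (simp add: sum_distrib_left mult_ac)
  finally show ?thesis
    by (simp add: hess_def right_diff_distrib sum_subtractf)
qed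

end

context adapted
begin

lemma weyl_matrix_Rm_frame_diff: "(\<lambda>y. weyl_matrix (Rm_frame (v y) y) p q) differentiable (at x)"
  by (rule pd_weyl_matrix(1)) (rule Rm_frame_diff)

lemma weyl_matrix_dRm_frame_diff: "(\<lambda>y. weyl_matrix (dRm_frame (v y) y a) p q) differentiable (at x)"
  by (rule pd_weyl_matrix(1)) (rule dRm_frame_diff)

lemma pd_weyl_matrix_Rm_frame: "pd m (\<lambda>y. weyl_matrix (Rm_frame (v y) y) p q) x = weyl_matrix (coord_dRm_frame e x m) p q"
proof -
  have "pd m (\<lambda>y. Rm_frame (v y) y a b c d) x = coord_dRm_frame e x m a b c d" for a b c d
    by (rule pd_frame_comp_parallel) (rule par Rm_diff)+
  then show ?thesis by (simp only: pd_weyl_matrix(2)[OF Rm_frame_diff])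
qed

lemma eventually_normsq:
  "eventually (\<lambda>y. weyl_plus_normsq G y = (\<Sum>p\<in>UNIV. \<Sum>q\<in>UNIV. weyl_matrix (Rm_frame (v y) y) p q * weyl_matrix (Rm_frame (v y) y) p q)) (nhds x)"
  using ev by eventually_elim (use normsq_frame in blast)

lemma pd_normsq:
  "pd m (weyl_plus_normsq G) x = 2 * (\<Sum>p\<in>UNIV. \<Sum>q\<in>UNIV. weyl_matrix (Rm_frame e x) p q * weyl_matrix (coord_dRm_frame e x m) p q)"
  unfolding eventually_pd_cong(1)[OF eventually_normsq] sum_distrib_left
  by (simp add: pd_sum pd_mult weyl_matrix_Rm_frame_diff differentiable_mult differentiable_sum pd_weyl_matrix_Rm_frame mult_ac)

lemma frame_deriv_weyl_matrix:
  assumes "\<And>a b c d. (\<lambda>y. F y a b c d) differentiable (at x)"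
  shows "frame_deriv k (\<lambda>y. weyl_matrix (F y) p q) = weyl_matrix (\<lambda>a b c d. frame_deriv k (\<lambda>y. F y a b c d)) p q"
  unfolding frame_deriv_def pd_weyl_matrix(2)[OF assms] weyl_matrix_sum ..

end

context metric_on
begin

lemma pd_normsq_frame:
  assumes "y \<in> U" "positive_frame G y e"
  shows "pd m (weyl_plus_normsq G) y = 2 * (\<Sum>p\<in>UNIV. \<Sum>q\<in>UNIV. weyl_matrix (Rm_frame e y) p q * weyl_matrix (coord_dRm_frame e y m) p q)"
proof -
  obtain v where v: "adapted U G y v" "v y = e" using adapted_at[OF assms] by blast
  show ?thesis using adapted.pd_normsq[OF v(1), of m] unfolding v(2) .
qed

lemma weyl_matrix_dRm_frame: "weyl_matrix (dRm_frame e y a) p q = (\<Sum>m\<in>UNIV. e a $ m * weyl_matrix (coord_dRm_frame e y m) p q)"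
  unfolding weyl_matrix_sum[symmetric] by (simp only: frame_comp.simps(2)[of e "\<lambda>bs. nabla G Rm bs y" a])

lemma frame_deriv_normsq:
  assumes "y \<in> U" "positive_frame G y e"
  shows "(\<Sum>m\<in>UNIV. e a $ m * pd m (weyl_plus_normsq G) y)
    = 2 * (\<Sum>p\<in>UNIV. \<Sum>q\<in>UNIV. weyl_matrix (Rm_frame e y) p q * weyl_matrix (dRm_frame e y a) p q)"
proof -
  have "(\<Sum>m\<in>UNIV. e a $ m * pd m (weyl_plus_normsq G) y)
      = (\<Sum>m\<in>UNIV. \<Sum>p\<in>UNIV. \<Sum>q\<in>UNIV. 2 * (weyl_matrix (Rm_frame e y) p q * (e a $ m * weyl_matrix (coord_dRm_frame e y m) p q)))"
    unfolding pd_normsq_frame[OF assms] by (simp add: sum_distrib_left mult_ac)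
  also have "\<dots> = (\<Sum>p\<in>UNIV. \<Sum>q\<in>UNIV. \<Sum>m\<in>UNIV. 2 * (weyl_matrix (Rm_frame e y) p q * (e a $ m * weyl_matrix (coord_dRm_frame e y m) p q)))"
    by (rule trans[OF sum.swap sum.cong[OF refl sum.swap]])
  finally show ?thesis unfolding weyl_matrix_dRm_frame by (simp only: sum_distrib_left)
qed

end

context adapted
begin

lemma pd_normsq_diff: "pd m (weyl_plus_normsq G) differentiable (at x)"
proof -
  have E: "eventually (\<lambda>y. pd m (weyl_plus_normsq G) y
      = 2 * (\<Sum>p\<in>UNIV. \<Sum>q\<in>UNIV. weyl_matrix (Rm_frame (v y) y) p q * weyl_matrix (coord_dRm_frame (v y) y m) p q)) (nhds x)"
    using ev by eventually_elim (use pd_normsq_frame in blast)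
  have "(\<lambda>y. weyl_matrix (coord_dRm_frame (v y) y m) p q) differentiable (at x)" for p q
    by (rule pd_weyl_matrix(1), rule frame_comp_differentiable) (rule v_diff nabla_Rm_diff)+
  then have "(\<lambda>y. 2 * (\<Sum>p\<in>UNIV. \<Sum>q\<in>UNIV. weyl_matrix (Rm_frame (v y) y) p q * weyl_matrix (coord_dRm_frame (v y) y m) p q)) differentiable (at x)"
    using weyl_matrix_Rm_frame_diff by (intro differentiable_mult differentiable_sum) simp_all
  then show ?thesis by (subst eventually_pd_cong(2)[OF E])
qed

text \<open>
  The first derivative of the norm is known in every positive frame near \<open>x\<close>, so it can be differentiated
  once more in the adapted frame.
\<close>

lemma laplacian_normsq:
  "laplacian G (weyl_plus_normsq G) x
    = 2 * (\<Sum>a\<in>UNIV. \<Sum>p\<in>UNIV. \<Sum>q\<in>UNIV. (weyl_matrix (dRm_frame e x a) p q)\<^sup>2)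
      + 2 * (\<Sum>a\<in>UNIV. \<Sum>p\<in>UNIV. \<Sum>q\<in>UNIV. weyl_matrix (Rm_frame e x) p q * weyl_matrix (ddRm_frame e x a a) p q)"
proof -
  let ?u = "weyl_plus_normsq G"
  have "laplacian G ?u x = (\<Sum>a\<in>UNIV. \<Sum>n\<in>UNIV. e a $ n * (\<Sum>m\<in>UNIV. e a $ m * hess G ?u x $ n $ m))"
    by (simp add: laplacian_def gtrace_frame[OF xU on] in_frame2_def sum_distrib_left mult_ac)
  also have "\<dots> = (\<Sum>a\<in>UNIV. frame_deriv a (\<lambda>y. \<Sum>m\<in>UNIV. v y a $ m * pd m ?u y))"
    by (simp add: frame_deriv_def hess_parallel[OF par pd_normsq_diff])
  also have "\<dots> = (\<Sum>a\<in>UNIV. frame_deriv a (\<lambda>y. \<Sum>p\<in>UNIV. \<Sum>q\<in>UNIV. 2 * (weyl_matrix (Rm_frame (v y) y) p q * weyl_matrix (dRm_frame (v y) y a) p q)))"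
    by (intro sum.cong refl frame_deriv_cong) (simp add: frame_deriv_normsq sum_distrib_left)
  also have "\<dots> = (\<Sum>a\<in>UNIV. \<Sum>p\<in>UNIV. \<Sum>q\<in>UNIV. 2 * (weyl_matrix (dRm_frame e x a) p q * weyl_matrix (dRm_frame e x a) p q + weyl_matrix (Rm_frame e x) p q * weyl_matrix (ddRm_frame e x a a) p q))"
  proof (rule sum.cong[OF refl])
    fix a :: 4
    have d: "(\<lambda>y. weyl_matrix (Rm_frame (v y) y) p q * weyl_matrix (dRm_frame (v y) y a) p q) differentiable (at x)" for p q
      using weyl_matrix_Rm_frame_diff weyl_matrix_dRm_frame_diff by (intro differentiable_mult)
    have 1: "frame_deriv a (\<lambda>y. weyl_matrix (Rm_frame (v y) y) p q) = weyl_matrix (dRm_frame e x a) p q" for p q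
      unfolding frame_deriv_weyl_matrix[OF Rm_frame_diff] dRm_frame_frame_deriv ..
    have 2: "frame_deriv a (\<lambda>y. weyl_matrix (dRm_frame (v y) y a) p q) = weyl_matrix (ddRm_frame e x a a) p q" for p q
      unfolding frame_deriv_weyl_matrix[OF dRm_frame_diff] ddRm_frame_frame_deriv ..
    have 3: "frame_deriv a (\<lambda>y. 2 * (weyl_matrix (Rm_frame (v y) y) p q * weyl_matrix (dRm_frame (v y) y a) p q))
        = 2 * (weyl_matrix (dRm_frame e x a) p q * weyl_matrix (dRm_frame e x a) p q + weyl_matrix (Rm_frame e x) p q * weyl_matrix (ddRm_frame e x a a) p q)" for p q
      using frame_deriv_mult[of "\<lambda>y. 2" "\<lambda>y. weyl_matrix (Rm_frame (v y) y) p q * weyl_matrix (dRm_frame (v y) y a) p q" a] d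
        frame_deriv_mult[OF weyl_matrix_Rm_frame_diff weyl_matrix_dRm_frame_diff, of a p q a p q]
      unfolding 1 2 frame_deriv_const by simp
    have d': "(\<lambda>y. 2 * (weyl_matrix (Rm_frame (v y) y) p q * weyl_matrix (dRm_frame (v y) y a) p q)) differentiable (at x)" for p q
      using d by (rule differentiable_mult[OF differentiable_const])
    show "frame_deriv a (\<lambda>y. \<Sum>p\<in>UNIV. \<Sum>q\<in>UNIV. 2 * (weyl_matrix (Rm_frame (v y) y) p q * weyl_matrix (dRm_frame (v y) y a) p q))
        = (\<Sum>p\<in>UNIV. \<Sum>q\<in>UNIV. 2 * (weyl_matrix (dRm_frame e x a) p q * weyl_matrix (dRm_frame e x a) p q + weyl_matrix (Rm_frame e x) p q * weyl_matrix (ddRm_frame e x a a) p q))"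
      unfolding 3[symmetric]
      by (rule trans[OF frame_deriv_sum sum.cong[OF refl frame_deriv_sum]]) (intro differentiable_sum d' finite ballI)+
  qed
  finally show ?thesis
    by (simp add: power2_eq_square sum.distrib distrib_left sum_distrib_left)
qed

lemma coframe_diff: "(\<lambda>y. coframe y (v y) a $ i) differentiable (at x)"
proof -
  have "(\<lambda>y. G y $ i $ j) differentiable (at x)" for j
    using smooth_G_entry xU smooth_on_differentiable by blast
  then show ?thesis
    unfolding coframe_def matrix_vector_mult_def vec_lambda_beta
    using v_diff by (intro differentiable_sum differentiable_mult) simp_all
qed

lemma phi_tensor_Rm_frame_diff: "(\<lambda>y. phi_tensor (weyl_matrix (Rm_frame (v y) y)) a b c d) differentiable (at x)"
  unfolding phi_tensor_def divide_inverse
  using weyl_matrix_Rm_frame_diff by (intro differentiable_mult differentiable_sum) simp_all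

text \<open>
  The dual frame converts frame components back to coordinate components.
\<close>

lemma frame_comp_coframe:
  assumes "y \<in> U" "orthonormal_frame G y e'"
  shows "frame_comp (\<lambda>i. \<chi> a. coframe y e' a $ i) (frame_comp e' T) as = T as"
proof -
  have "(\<lambda>i. \<Sum>p\<in>UNIV. (\<chi> a. coframe y e' a $ i) $ p *\<^sub>R e' p) = (\<lambda>i. axis i 1)"
    using axis_coframe[OF assms] by (simp add: fun_eq_iff)
  then show ?thesis unfolding frame_comp_frame_comp by (simp only: frame_comp_axis)
qed

text \<open>
  In the frame, \<open>W\<^sup>+\<close> depends linearly on the curvature with constant coefficients; neither the inverse metric
  nor the volume form has to be differentiated.
\<close>

lemma weyl_plus_diff: "(\<lambda>y. weyl_plus G y a b c d) differentiable (at x)"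
proof -
  have E: "eventually (\<lambda>y. weyl_plus G y a b c d
      = frame_comp (\<lambda>i. \<chi> a. coframe y (v y) a $ i) (\<lambda>bs. list_tensor (phi_tensor (weyl_matrix (Rm_frame (v y) y))) bs) [a, b, c, d]) (nhds x)"
    using ev
  proof eventually_elim
    case (elim y)
    then have o: "orthonormal_frame G y (v y)" by (simp add: positive_frame_def)
    have "frame_comp (\<lambda>i. \<chi> a. coframe y (v y) a $ i) (\<lambda>bs. list_tensor (phi_tensor (weyl_matrix (Rm_frame (v y) y))) bs) [a, b, c, d]
        = frame_comp (\<lambda>i. \<chi> a. coframe y (v y) a $ i) (frame_comp (v y) (list_tensor (weyl_plus G y))) [a, b, c, d]"
    proof (rule frame_comp_cong)
      fix bs :: "4 list" assume "length bs = length [a, b, c, d]"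
      then obtain i j k l where "bs = [i, j, k, l]"
        by (auto simp: length_Suc_conv)
      then show "list_tensor (phi_tensor (weyl_matrix (Rm_frame (v y) y))) bs = frame_comp (v y) (list_tensor (weyl_plus G y)) bs"
        using weyl_plus_frame[of y "v y"] elim by (simp only: in_frame_frame_comp[symmetric] list_tensor_simp)
    qed
    also have "\<dots> = weyl_plus G y a b c d"
      using elim by (simp only: frame_comp_coframe[OF _ o] list_tensor_simp)
    finally show ?case by simp
  qed
  have "(\<lambda>y. frame_comp (\<lambda>i. \<chi> a. coframe y (v y) a $ i) (\<lambda>bs. list_tensor (phi_tensor (weyl_matrix (Rm_frame (v y) y))) bs) [a, b, c, d]) differentiable (at x)"
  proof (rule frame_comp_differentiable)
    show "(\<lambda>y. (\<chi> a. coframe y (v y) a $ i) $ j) differentiable (at x)" for i j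
      by (simp add: coframe_diff)
    show "(\<lambda>y. list_tensor (phi_tensor (weyl_matrix (Rm_frame (v y) y))) as) differentiable (at x)" for as
      unfolding list_tensor_def by (rule phi_tensor_Rm_frame_diff)
  qed
  then show ?thesis by (subst eventually_pd_cong(2)[OF E])
qed

text \<open>
  The constant coefficients also show that the passage from the curvature to \<open>W\<^sup>+\<close> commutes with the
  covariant derivative.
\<close>

lemma nabla_weyl_plus_frame:
  "in_frame e (cov_deriv4 G (weyl_plus G) x m) = phi_tensor (weyl_matrix (coord_dRm_frame e x m))"
proof (intro ext)
  fix a b c d
  have W: "field4 (weyl_plus G) as differentiable (at x)" for as
    unfolding field4_def[abs_def] by (rule weyl_plus_diff)
  have "in_frame e (cov_deriv4 G (weyl_plus G) x m) a b c d
      = frame_comp e (\<lambda>bs. nabla G (field4 (weyl_plus G)) (m # bs) x) [a, b, c, d]"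
    by (simp add: in_frame_frame_comp cov_deriv4_eq_nabla frame_comp.simps(2))
  also have "\<dots> = pd m (\<lambda>y. frame_comp (v y) (\<lambda>bs. field4 (weyl_plus G) bs y) [a, b, c, d]) x"
    by (rule pd_frame_comp_parallel[OF par W, symmetric])
  also have "\<dots> = pd m (\<lambda>y. phi_tensor (weyl_matrix (Rm_frame (v y) y)) a b c d) x"
  proof (rule eventually_pd_cong(1))
    show "eventually (\<lambda>y. frame_comp (v y) (\<lambda>bs. field4 (weyl_plus G) bs y) [a, b, c, d] = phi_tensor (weyl_matrix (Rm_frame (v y) y)) a b c d) (nhds x)"
      using ev
    proof eventually_elim
      case (elim y)
      have "frame_comp (v y) (\<lambda>bs. field4 (weyl_plus G) bs y) [a, b, c, d] = in_frame (v y) (weyl_plus G y) a b c d"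
        by (simp add: in_frame_frame_comp frame_comp.simps(2))
      then show ?case using weyl_plus_frame elim by simp
    qed
  qed
  also have "\<dots> = phi_tensor (weyl_matrix (coord_dRm_frame e x m)) a b c d"
  proof -
    have *: "phi_tensor w a b c d = (\<Sum>p\<in>UNIV. \<Sum>q\<in>UNIV. (phi p a b * phi q c d / 2) * w p q)" for w
      by (simp add: phi_tensor_def sum_divide_distrib mult_ac)
    have d: "(\<lambda>y. k * weyl_matrix (Rm_frame (v y) y) p q) differentiable (at x)" for k p q
      using weyl_matrix_Rm_frame_diff by (intro differentiable_mult) simp_all
    define K where "K p q = phi p a b * phi q c d / 2" for p q
    show ?thesis
      unfolding * K_def[symmetric] using d by (simp add: pd_sum pd_cmult weyl_matrix_Rm_frame_diff differentiable_sum pd_weyl_matrix_Rm_frame)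
  qed
  finally show "in_frame e (cov_deriv4 G (weyl_plus G) x m) a b c d = phi_tensor (weyl_matrix (coord_dRm_frame e x m)) a b c d" .
qed

lemma antisym_pairs_cov_deriv: "antisym_pairs (cov_deriv4 G (weyl_plus G) x m)"
proof -
  let ?T = "cov_deriv4 G (weyl_plus G) x m"
  have p: "antisym_pairs (phi_tensor w)" for w
    unfolding antisym_pairs_def phi_tensor_def
    by (subst (2 4) phi_antisym) (simp add: sum_negf)
  define o' where "o' i = (\<chi> a. coframe x e a $ i)" for i
  have "?T a b c d = in_frame o' (phi_tensor (weyl_matrix (coord_dRm_frame e x m))) a b c d" for a b c d
  proof -
    have "?T a b c d = frame_comp o' (frame_comp e (list_tensor ?T)) [a, b, c, d]"
      unfolding o'_def by (simp only: frame_comp_coframe[OF xU on] list_tensor_simp)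
    also have "\<dots> = frame_comp o' (list_tensor (in_frame e ?T)) [a, b, c, d]"
    proof (rule frame_comp_cong)
      fix bs :: "4 list" assume "length bs = length [a, b, c, d]"
      then obtain i j k l where "bs = [i, j, k, l]"
        by (auto simp: length_Suc_conv)
      then show "frame_comp e (list_tensor ?T) bs = list_tensor (in_frame e ?T) bs"
        by (simp only: in_frame_frame_comp list_tensor_simp)
    qed
    finally show ?thesis by (simp only: in_frame_frame_comp[of o'] nabla_weyl_plus_frame)
  qed
  then have "?T = in_frame o' (phi_tensor (weyl_matrix (coord_dRm_frame e x m)))" by (intro ext)
  then show ?thesis using antisym_pairs_in_frame[OF p] by simp
qed

lemma grad_normsq:
  "grad_weyl_plus_normsq G x = (\<Sum>a\<in>UNIV. \<Sum>p\<in>UNIV. \<Sum>q\<in>UNIV. (weyl_matrix (dRm_frame e x a) p q)\<^sup>2)"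
proof -
  define V where "V = cov_deriv4 G (weyl_plus G) x"
  \<comment> \<open>\<open>VV\<close> is \<open>\<nabla>W\<^sup>+\<close> as a tensor of rank five, with the derivative index first.\<close>
  define VV where "VV as = list_tensor (V (hd as)) (tl as)" for as
  have comb: "in_frame f (\<lambda>a b c d. \<Sum>m\<in>UNIV. f i $ m * V m a b c d) a b c d = frame_comp f VV [i, a, b, c, d]" for f i a b c d
  proof -
    have "list_tensor (\<lambda>a b c d. \<Sum>m\<in>UNIV. f i $ m * V m a b c d) = (\<lambda>bs. \<Sum>m\<in>UNIV. f i $ m * list_tensor (V m) bs)"
      by (simp add: fun_eq_iff list_tensor_def)
    then have "in_frame f (\<lambda>a b c d. \<Sum>m\<in>UNIV. f i $ m * V m a b c d) a b c d
        = (\<Sum>m\<in>UNIV. f i $ m * frame_comp f (list_tensor (V m)) [a, b, c, d])"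
      by (simp only: in_frame_frame_comp frame_comp_sum frame_comp_cmult finite)
    also have "\<dots> = (\<Sum>m\<in>UNIV. f i $ m * frame_comp f (\<lambda>bs. VV (m # bs)) [a, b, c, d])"
      by (simp only: VV_def list.sel)
    finally show ?thesis by (simp only: frame_comp.simps(2)[of f VV i])
  qed
  have anti: "antisym_pairs (\<lambda>a b c d. frame_comp f VV [i, a, b, c, d])" for f i
  proof -
    have V: "antisym_pairs (V m)" for m unfolding V_def by (rule antisym_pairs_cov_deriv)
    have "antisym_pairs (\<lambda>a b c d. \<Sum>m\<in>UNIV. f i $ m * V m a b c d)"
      unfolding antisym_pairs_def
    proof (intro allI conjI)
      fix a b c d
      have "f i $ m * V m a b c d = - (f i $ m * V m b a c d)" "f i $ m * V m a b c d = - (f i $ m * V m a b d c)" for m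
        using antisym_pairsD(1)[OF V, of m a b c d] antisym_pairsD(2)[OF V, of m a b c d] by simp_all
      then show "(\<Sum>m\<in>UNIV. f i $ m * V m a b c d) = - (\<Sum>m\<in>UNIV. f i $ m * V m b a c d)"
        "(\<Sum>m\<in>UNIV. f i $ m * V m a b c d) = - (\<Sum>m\<in>UNIV. f i $ m * V m a b d c)"
        unfolding sum_negf[symmetric] by (blast intro: sum.cong)+
    qed
    from antisym_pairs_in_frame[OF this, of f] show ?thesis unfolding antisym_pairs_def comb .
  qed
  have l: "list_sum 5 (\<lambda>as. frame_comp f VV as * frame_comp f VV as) = (\<Sum>i\<in>UNIV. \<Sum>a\<in>UNIV. \<Sum>b\<in>UNIV. \<Sum>c\<in>UNIV. \<Sum>d\<in>UNIV.
      frame_comp f VV [i, a, b, c, d] * frame_comp f VV [i, a, b, c, d])" for f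
    by (simp only: numeral_eq_Suc pred_numeral_simps list_sum.simps BitM.simps Num.BitM.simps One_nat_def)
  have "grad_weyl_plus_normsq G x = (\<Sum>i\<in>UNIV. (\<Sum>a\<in>UNIV. \<Sum>b\<in>UNIV. \<Sum>c\<in>UNIV. \<Sum>d\<in>UNIV.
      frame_comp (frame G x) VV [i, a, b, c, d] * frame_comp (frame G x) VV [i, a, b, c, d]) / 4)"
    unfolding grad_weyl_plus_normsq_def V_def[symmetric] comb power2_eq_square
    by (intro sum.cong refl sum_less_pairs_product anti)
  also have "\<dots> = list_sum 5 (\<lambda>as. frame_comp (frame G x) VV as * frame_comp (frame G x) VV as) / 4"
    by (simp only: l sum_divide_distrib)
  also have "\<dots> = list_sum 5 (\<lambda>as. frame_comp e VV as * frame_comp e VV as) / 4"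
    using list_sum_frame_comp_invariant[OF xU on orthonormal_frame_frame[OF xU]] by simp
  also have "\<dots> = (\<Sum>i\<in>UNIV. (\<Sum>a\<in>UNIV. \<Sum>b\<in>UNIV. \<Sum>c\<in>UNIV. \<Sum>d\<in>UNIV.
      frame_comp e VV [i, a, b, c, d] * frame_comp e VV [i, a, b, c, d]) / 4)"
    by (simp only: l sum_divide_distrib)
  also have "\<dots> = (\<Sum>i\<in>UNIV. \<Sum>p\<in>UNIV. \<Sum>q\<in>UNIV. (weyl_matrix (dRm_frame e x i) p q)\<^sup>2)"
  proof (rule sum.cong[OF refl])
    fix i
    have "frame_comp e VV [i, a, b, c, d] = phi_tensor (weyl_matrix (dRm_frame e x i)) a b c d" for a b c d
    proof -
      have "frame_comp e VV [i, a, b, c, d] = (\<Sum>m\<in>UNIV. e i $ m * in_frame e (V m) a b c d)"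
        by (simp only: frame_comp.simps(2)[of e VV i] in_frame_frame_comp VV_def list.sel)
      also have "\<dots> = (\<Sum>m\<in>UNIV. e i $ m * phi_tensor (weyl_matrix (coord_dRm_frame e x m)) a b c d)"
        by (simp only: V_def nabla_weyl_plus_frame)
      also have "\<dots> = (\<Sum>m\<in>UNIV. \<Sum>p\<in>UNIV. \<Sum>q\<in>UNIV. (e i $ m * weyl_matrix (coord_dRm_frame e x m) p q) * (phi p a b * phi q c d) / 2)"
        by (simp add: phi_tensor_def sum_distrib_left sum_divide_distrib mult_ac)
      also have "\<dots> = (\<Sum>p\<in>UNIV. \<Sum>q\<in>UNIV. \<Sum>m\<in>UNIV. (e i $ m * weyl_matrix (coord_dRm_frame e x m) p q) * (phi p a b * phi q c d) / 2)"
        by (rule trans[OF sum.swap sum.cong[OF refl sum.swap]])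
      also have "\<dots> = phi_tensor (weyl_matrix (dRm_frame e x i)) a b c d"
        unfolding phi_tensor_def weyl_matrix_dRm_frame by (simp add: sum_divide_distrib sum_distrib_right mult.assoc)
      finally show ?thesis .
    qed
    then show "(\<Sum>a\<in>UNIV. \<Sum>b\<in>UNIV. \<Sum>c\<in>UNIV. \<Sum>d\<in>UNIV. frame_comp e VV [i, a, b, c, d] * frame_comp e VV [i, a, b, c, d]) / 4
        = (\<Sum>p\<in>UNIV. \<Sum>q\<in>UNIV. (weyl_matrix (dRm_frame e x i) p q)\<^sup>2)"
      by (simp only: sum_phi_tensor sd_pairing_phi_tensor power2_eq_square)
  qed
  finally show ?thesis .
qed

lemma normsq_at: "weyl_plus_normsq G x = (\<Sum>p\<in>UNIV. \<Sum>q\<in>UNIV. (weyl_matrix (Rm_frame e x) p q)\<^sup>2)"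
  by (simp add: normsq_frame[OF xU pos] power2_eq_square)

end

section \<open>Curvature of a gradient Ricci soliton\<close>

locale soliton = metric_on +
  fixes F :: "real^4 \<Rightarrow> real" and lam :: real
  assumes smoothF: "smooth_on U F"
    and soliton_eq: "y \<in> U \<Longrightarrow> ricci G y + hess G F y = lam *\<^sub>R G y"
begin

definition dF :: "4 list \<Rightarrow> real^4 \<Rightarrow> real" where
  "dF as y = pd (as ! 0) F y"

lemma smooth_dF: "smooth_on U (dF as)"
  unfolding dF_def[abs_def] using smooth_on_pd[OF smoothF] .

lemma nabla_dF: "nabla G dF [i, j] y = hess G F y $ i $ j"
  by (simp add: nabla_Cons hess_def dF_def[abs_def])

abbreviation dF_frame :: "(4 \<Rightarrow> real^4) \<Rightarrow> real^4 \<Rightarrow> 4 \<Rightarrow> real" where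
  "dF_frame e y a \<equiv> frame_comp e (\<lambda>bs. dF bs y) [a]"

abbreviation hessF_frame :: "(4 \<Rightarrow> real^4) \<Rightarrow> real^4 \<Rightarrow> 4 \<Rightarrow> 4 \<Rightarrow> real" where
  "hessF_frame e y a b \<equiv> frame_comp e (\<lambda>bs. nabla G dF bs y) [a, b]"

abbreviation dhessF_frame :: "(4 \<Rightarrow> real^4) \<Rightarrow> real^4 \<Rightarrow> 4 \<Rightarrow> 4 \<Rightarrow> 4 \<Rightarrow> real" where
  "dhessF_frame e y a b c \<equiv> frame_comp e (\<lambda>bs. nabla G (nabla G dF) bs y) [a, b, c]"

lemma dF_frame_eq: "dF_frame e y a = (\<Sum>j\<in>UNIV. e a $ j * pd j F y)"
  by (simp add: frame_comp.simps(2) dF_def)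

lemma hessF_frame_eq: "hessF_frame e y a b = in_frame2 e (hess G F y) a b"
  by (simp add: frame_comp.simps(2) nabla_dF in_frame2_def sum_distrib_left mult_ac)

lemma ricci_frame:
  assumes "y \<in> U" "orthonormal_frame G y e"
  shows "in_frame2 e (ricci G y) = Ric (Rm_frame e y)"
  by (simp add: fun_eq_iff ricci_eq ric_of_frame[OF assms] in_frame_riem)

lemma soliton_frame:
  assumes "y \<in> U" "orthonormal_frame G y e"
  shows "Ric (Rm_frame e y) a b + hessF_frame e y a b = (if a = b then lam else 0)"
proof -
  have "Ric (Rm_frame e y) a b + hessF_frame e y a b = in_frame2 e (ricci G y + hess G F y) a b"
    unfolding ricci_frame[OF assms, symmetric] hessF_frame_eq by (simp add: in_frame2_def sum.distrib distrib_right)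
  also have "\<dots> = lam * in_frame2 e (G y) a b"
    by (simp add: soliton_eq[OF assms(1)] in_frame2_def sum_distrib_left mult.assoc)
  finally show ?thesis by (simp add: in_frame2_metric[OF assms(2)])
qed

end

locale adapted_soliton = adapted + soliton
begin

lemma dF_diff: "dF as differentiable (at x)" and nabla_dF_diff: "nabla G dF as differentiable (at x)"
  by (rule smooth_on_differentiable[OF smooth_dF xU], rule smooth_on_differentiable[OF smooth_nabla[OF smooth_dF] xU])

lemma dF_frame_diff: "(\<lambda>y. dF_frame (v y) y a) differentiable (at x)"
  by (rule frame_comp_differentiable) (rule v_diff dF_diff)+

lemma hessF_frame_diff: "(\<lambda>y. hessF_frame (v y) y a b) differentiable (at x)"
  by (rule frame_comp_differentiable) (rule v_diff nabla_dF_diff)+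

lemma hessF_frame_frame_deriv: "hessF_frame e x a b = frame_deriv a (\<lambda>y. dF_frame (v y) y b)"
  by (rule frame_comp_nabla) (rule dF_diff)

lemma dhessF_frame_frame_deriv: "dhessF_frame e x a b c = frame_deriv a (\<lambda>y. hessF_frame (v y) y b c)"
  by (rule frame_comp_nabla) (rule nabla_dF_diff)

text \<open>
  The derivative of the soliton equation; its right-hand side is constant in the frame.
\<close>

lemma nabla_ricci: "(\<Sum>k\<in>UNIV. dRm_frame e x a b k d k) = - dhessF_frame e x a b d"
proof -
  have "frame_deriv a (\<lambda>y. Ric (Rm_frame (v y) y) b d + hessF_frame (v y) y b d) = frame_deriv a (\<lambda>y. if b = d then lam else 0)"
    by (rule frame_deriv_cong) (simp add: soliton_frame positive_frame_def)
  moreover have "frame_deriv a (\<lambda>y. Ric (Rm_frame (v y) y) b d + hessF_frame (v y) y b d) = (\<Sum>k\<in>UNIV. dRm_frame e x a b k d k) + dhessF_frame e x a b d"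
    unfolding Ric_def dRm_frame_frame_deriv dhessF_frame_frame_deriv
    by (subst frame_deriv_add) (simp_all only: hessF_frame_diff Rm_frame_diff differentiable_sum finite ball_simps frame_deriv_sum simp_thms)
  ultimately show ?thesis by (simp add: frame_deriv_const)
qed

lemma dhessF_frame_commute: "dhessF_frame e x a b d - dhessF_frame e x b a d = - (\<Sum>q\<in>UNIV. Rm_frame e x a b q d * dF_frame e x q)"
  using frame_comp_ricci_identity[where T = dF and as = "[d]", OF xU on smooth_dF] by simp

text \<open>
  By the second Bianchi identity the divergence is the antisymmetrised derivative of the Ricci tensor.
  The soliton equation turns this into a commutator of covariant derivatives of \<open>\<nabla>f\<close>.
\<close>

lemma div_curvature: "(\<Sum>k\<in>UNIV. dRm_frame e x k a b k d) = (\<Sum>q\<in>UNIV. Rm_frame e x a b q d * dF_frame e x q)"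
proof -
  have a: "dRm_frame e x m a b c d = - dRm_frame e x m b a c d" "dRm_frame e x m a b c d = - dRm_frame e x m a b d c" for m a b c d
    using dRm_frame_curvature unfolding curvature_like_def antisym_pairs_def by blast+
  have "dRm_frame e x k a b k d = dRm_frame e x a b k d k - dRm_frame e x b a k d k" for k
    using dRm_frame_bianchi2[OF xU, of e k a b k d] a(2)[of a b k k d] a(2)[of b k a k d] a(1)[of b k a d k] by simp
  then have "(\<Sum>k\<in>UNIV. dRm_frame e x k a b k d) = (\<Sum>k\<in>UNIV. dRm_frame e x a b k d k) - (\<Sum>k\<in>UNIV. dRm_frame e x b a k d k)"
    by (simp only: sum_subtractf)
  then show ?thesis using dhessF_frame_commute[of a b d] unfolding nabla_ricci by simp
qed

end

context soliton
begin

lemma adapted_soliton_at: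
  assumes "y \<in> U" "positive_frame G y e"
  obtains v where "adapted_soliton U G y v F lam" "v y = e"
proof -
  obtain v where "adapted U G y v" "v y = e" using adapted_at[OF assms] by blast
  moreover from this(1) have "adapted_soliton U G y v F lam"
    using soliton_axioms by (simp add: adapted_soliton_def)
  ultimately show ?thesis using that by blast
qed

lemma div_curvature_frame:
  assumes "y \<in> U" "positive_frame G y e"
  shows "(\<Sum>k\<in>UNIV. dRm_frame e y k a b k d) = (\<Sum>q\<in>UNIV. Rm_frame e y a b q d * dF_frame e y q)"
proof -
  obtain v where v: "adapted_soliton U G y v F lam" "v y = e" using adapted_soliton_at[OF assms] by blast
  show ?thesis using adapted_soliton.div_curvature[OF v(1), of a b d] unfolding v(2) .
qed

end

context adapted_soliton
begin

lemma nabla_div_curvature: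
  "(\<Sum>k\<in>UNIV. ddRm_frame e x c k a b k d)
    = (\<Sum>q\<in>UNIV. dRm_frame e x c a b q d * dF_frame e x q) + (\<Sum>q\<in>UNIV. Rm_frame e x a b q d * hessF_frame e x c q)"
proof -
  have "frame_deriv c (\<lambda>y. \<Sum>k\<in>UNIV. dRm_frame (v y) y k a b k d) = frame_deriv c (\<lambda>y. \<Sum>q\<in>UNIV. Rm_frame (v y) y a b q d * dF_frame (v y) y q)"
    by (rule frame_deriv_cong) (rule div_curvature_frame)
  moreover have "frame_deriv c (\<lambda>y. \<Sum>k\<in>UNIV. dRm_frame (v y) y k a b k d) = (\<Sum>k\<in>UNIV. ddRm_frame e x c k a b k d)"
    unfolding ddRm_frame_frame_deriv by (rule frame_deriv_sum) (rule dRm_frame_diff)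
  moreover have "frame_deriv c (\<lambda>y. \<Sum>q\<in>UNIV. Rm_frame (v y) y a b q d * dF_frame (v y) y q)
      = (\<Sum>q\<in>UNIV. frame_deriv c (\<lambda>y. Rm_frame (v y) y a b q d * dF_frame (v y) y q))"
    by (rule frame_deriv_sum) (intro differentiable_mult Rm_frame_diff dF_frame_diff)
  moreover have "frame_deriv c (\<lambda>y. Rm_frame (v y) y a b q d * dF_frame (v y) y q)
      = dRm_frame e x c a b q d * dF_frame e x q + Rm_frame e x a b q d * hessF_frame e x c q" for q
    unfolding dRm_frame_frame_deriv hessF_frame_frame_deriv by (rule frame_deriv_mult) (rule Rm_frame_diff dF_frame_diff)+
  ultimately show ?thesis by (simp only: sum.distrib)
qed

lemma ddRm_frame_pair: "ddRm_frame e x n m a b c d = ddRm_frame e x n m c d a b"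
  unfolding ddRm_frame_frame_deriv
proof (rule frame_deriv_cong)
  fix y assume "y \<in> U" "positive_frame G y (v y)"
  then show "dRm_frame (v y) y m a b c d = dRm_frame (v y) y m c d a b"
    using dRm_frame_curvature_like unfolding curvature_like_def by blast
qed

lemma ddRm_frame_antisym: "ddRm_frame e x n m a b c d = - ddRm_frame e x n m b a c d"
proof -
  have "ddRm_frame e x n m a b c d = frame_deriv n (\<lambda>y. - dRm_frame (v y) y m b a c d)"
    unfolding ddRm_frame_frame_deriv
  proof (rule frame_deriv_cong)
    fix y assume "y \<in> U" "positive_frame G y (v y)"
    then show "dRm_frame (v y) y m a b c d = - dRm_frame (v y) y m b a c d"
      using dRm_frame_curvature_like unfolding curvature_like_def antisym_pairs_def by blast
  qed
  then show ?thesis unfolding ddRm_frame_frame_deriv frame_deriv_minus[OF dRm_frame_diff] .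
qed

lemma ddRm_frame_bianchi2: "ddRm_frame e x n m a b c d + ddRm_frame e x n a b m c d + ddRm_frame e x n b m a c d = 0"
proof -
  have "frame_deriv n (\<lambda>y. dRm_frame (v y) y m a b c d + dRm_frame (v y) y a b m c d + dRm_frame (v y) y b m a c d) = frame_deriv n (\<lambda>y. 0)"
    by (rule frame_deriv_cong) (rule dRm_frame_bianchi2)
  then show ?thesis
    unfolding ddRm_frame_frame_deriv by (simp add: frame_deriv_add dRm_frame_diff differentiable_add frame_deriv_const)
qed

lemma ddRm_frame_commute:
  "ddRm_frame e x n m a b c d - ddRm_frame e x m n a b c d
    = - ((\<Sum>q\<in>UNIV. Rm_frame e x n m q a * Rm_frame e x q b c d) + (\<Sum>q\<in>UNIV. Rm_frame e x n m q b * Rm_frame e x a q c d)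
       + (\<Sum>q\<in>UNIV. Rm_frame e x n m q c * Rm_frame e x a b q d) + (\<Sum>q\<in>UNIV. Rm_frame e x n m q d * Rm_frame e x a b c q))"
  using frame_comp_ricci_identity[where T = Rm and as = "[a, b, c, d]" and c = n and d = m, OF xU on smooth_Rm] by simp

text \<open>
  Half of the Laplacian of the curvature: commuting the derivatives produces the quadratic terms, and
  the divergence that remains is known from the soliton equation. The Ricci terms of the commutator
  and the Hessian of the potential add up to the constant of the soliton.
\<close>

lemma sum_ddRm_frame_half:
  "(\<Sum>k\<in>UNIV. ddRm_frame e x k a k b c d)
    = (\<Sum>q\<in>UNIV. dRm_frame e x a q b c d * dF_frame e x q) + lam * Rm_frame e x a b c d + curv_quadratic (Rm_frame e x) a b c d"
proof -
  have p: "Rm_frame e x a b c d = Rm_frame e x c d a b" and a1: "Rm_frame e x a b c d = - Rm_frame e x b a c d"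
    and a2: "Rm_frame e x a b c d = - Rm_frame e x a b d c" for a b c d
    using Rm_frame_curvature[OF xU] unfolding curvature_like_def antisym_pairs_def by blast+
  have p1: "dRm_frame e x m a b c d = dRm_frame e x m c d a b" for m a b c d
    using dRm_frame_curvature unfolding curvature_like_def by blast
  have "ddRm_frame e x k a k b c d = ddRm_frame e x a k c d k b
      + ((\<Sum>q\<in>UNIV. Rm_frame e x a k q k * Rm_frame e x q b c d)
      + (\<Sum>q\<in>UNIV. Rm_frame e x k a b q * Rm_frame e x k q c d + Rm_frame e x k a c q * Rm_frame e x k b q d + Rm_frame e x k a d q * Rm_frame e x k b c q))" for k
  proof -
    have 1: "(\<Sum>q\<in>UNIV. Rm_frame e x k a q k * Rm_frame e x q b c d) = - (\<Sum>q\<in>UNIV. Rm_frame e x a k q k * Rm_frame e x q b c d)"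
      unfolding sum_negf[symmetric]
    proof (rule sum.cong[OF refl])
      fix q
      show "Rm_frame e x k a q k * Rm_frame e x q b c d = - (Rm_frame e x a k q k * Rm_frame e x q b c d)"
        unfolding a1[of k a q k] by simp
    qed
    have 2: "(\<Sum>q\<in>UNIV. Rm_frame e x k a q r * S q) = - (\<Sum>q\<in>UNIV. Rm_frame e x k a r q * S q)" for r S
      unfolding sum_negf[symmetric]
    proof (rule sum.cong[OF refl])
      fix q
      show "Rm_frame e x k a q r * S q = - (Rm_frame e x k a r q * S q)"
        unfolding a2[of k a q r] by simp
    qed
    have "ddRm_frame e x k a k b c d = ddRm_frame e x a k k b c d
       - ((\<Sum>q\<in>UNIV. Rm_frame e x k a q k * Rm_frame e x q b c d) + (\<Sum>q\<in>UNIV. Rm_frame e x k a q b * Rm_frame e x k q c d)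
       + (\<Sum>q\<in>UNIV. Rm_frame e x k a q c * Rm_frame e x k b q d) + (\<Sum>q\<in>UNIV. Rm_frame e x k a q d * Rm_frame e x k b c q))"
      using ddRm_frame_commute[of k a k b c d] by simp
    then show ?thesis
      unfolding 1 2[of b] 2[of c] 2[of d] ddRm_frame_pair[of a k k b c d] by (simp add: sum.distrib)
  qed
  then have "(\<Sum>k\<in>UNIV. ddRm_frame e x k a k b c d) = (\<Sum>k\<in>UNIV. ddRm_frame e x a k c d k b)
      + (\<Sum>k\<in>UNIV. \<Sum>q\<in>UNIV. Rm_frame e x a k q k * Rm_frame e x q b c d) + curv_quadratic (Rm_frame e x) a b c d"
    by (simp only: sum.distrib curv_quadratic_def add.assoc)
  also have "(\<Sum>k\<in>UNIV. ddRm_frame e x a k c d k b)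
      = (\<Sum>q\<in>UNIV. dRm_frame e x a q b c d * dF_frame e x q) + (\<Sum>q\<in>UNIV. hessF_frame e x a q * Rm_frame e x q b c d)"
    unfolding nabla_div_curvature
    by (intro arg_cong2[where f = "(+)"] sum.cong refl) (simp_all only: p1[of a c d] p[of c d] mult.commute)
  also have "(\<Sum>k\<in>UNIV. \<Sum>q\<in>UNIV. Rm_frame e x a k q k * Rm_frame e x q b c d) = (\<Sum>q\<in>UNIV. Ric (Rm_frame e x) a q * Rm_frame e x q b c d)"
    unfolding Ric_def sum_distrib_right by (rule sum.swap)
  also have "(\<Sum>q\<in>UNIV. dRm_frame e x a q b c d * dF_frame e x q) + (\<Sum>q\<in>UNIV. hessF_frame e x a q * Rm_frame e x q b c d)
      + (\<Sum>q\<in>UNIV. Ric (Rm_frame e x) a q * Rm_frame e x q b c d) + curv_quadratic (Rm_frame e x) a b c d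
      = (\<Sum>q\<in>UNIV. dRm_frame e x a q b c d * dF_frame e x q) + (\<Sum>q\<in>UNIV. (Ric (Rm_frame e x) a q + hessF_frame e x a q) * Rm_frame e x q b c d)
        + curv_quadratic (Rm_frame e x) a b c d"
    by (simp add: sum.distrib distrib_right)
  also have "(\<Sum>q\<in>UNIV. (Ric (Rm_frame e x) a q + hessF_frame e x a q) * Rm_frame e x q b c d) = lam * Rm_frame e x a b c d"
  proof -
    have "(Ric (Rm_frame e x) a q + hessF_frame e x a q) * Rm_frame e x q b c d = (if a = q then lam * Rm_frame e x q b c d else 0)" for q
      by (simp add: soliton_frame[OF xU on])
    then show ?thesis by simp
  qed
  finally show ?thesis .
qed

text \<open>
  The second Bianchi identity splits the Laplacian into two halves, and once more it collects the two
  first-order terms into the derivative along \<open>\<nabla>f\<close>.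
\<close>

lemma laplacian_curvature:
  "(\<Sum>k\<in>UNIV. ddRm_frame e x k k a b c d)
    = (\<Sum>q\<in>UNIV. dF_frame e x q * dRm_frame e x q a b c d) + 2 * lam * Rm_frame e x a b c d + curv_reaction (Rm_frame e x) a b c d"
proof -
  have a1: "Rm_frame e x a b c d = - Rm_frame e x b a c d" for a b c d
    using Rm_frame_curvature[OF xU] unfolding curvature_like_def antisym_pairs_def by blast
  have a2: "dRm_frame e x m a b c d = - dRm_frame e x m b a c d" for m a b c d
    using dRm_frame_curvature unfolding curvature_like_def antisym_pairs_def by blast
  have "ddRm_frame e x k k a b c d = ddRm_frame e x k a k b c d - ddRm_frame e x k b k a c d" for k
    using ddRm_frame_bianchi2[of k k a b c d] ddRm_frame_antisym[of k a b k c d] by simp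
  then have "(\<Sum>k\<in>UNIV. ddRm_frame e x k k a b c d) = (\<Sum>k\<in>UNIV. ddRm_frame e x k a k b c d) - (\<Sum>k\<in>UNIV. ddRm_frame e x k b k a c d)"
    by (simp only: sum_subtractf)
  also have "\<dots> = ((\<Sum>q\<in>UNIV. dRm_frame e x a q b c d * dF_frame e x q) - (\<Sum>q\<in>UNIV. dRm_frame e x b q a c d * dF_frame e x q))
      + lam * (Rm_frame e x a b c d - Rm_frame e x b a c d) + curv_reaction (Rm_frame e x) a b c d"
    unfolding sum_ddRm_frame_half curv_reaction_def by (simp add: algebra_simps)
  also have "(\<Sum>q\<in>UNIV. dRm_frame e x a q b c d * dF_frame e x q) - (\<Sum>q\<in>UNIV. dRm_frame e x b q a c d * dF_frame e x q)
      = (\<Sum>q\<in>UNIV. dF_frame e x q * dRm_frame e x q a b c d)"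
    unfolding sum_subtractf[symmetric]
  proof (rule sum.cong[OF refl])
    fix q
    have "dRm_frame e x a q b c d - dRm_frame e x b q a c d = dRm_frame e x q a b c d"
      using dRm_frame_bianchi2[OF xU, of e q a b c d] a2[of a q b c d] by simp
    then show "dRm_frame e x a q b c d * dF_frame e x q - dRm_frame e x b q a c d * dF_frame e x q = dF_frame e x q * dRm_frame e x q a b c d"
      unfolding left_diff_distrib[symmetric] by simp
  qed
  also have "Rm_frame e x a b c d - Rm_frame e x b a c d = 2 * Rm_frame e x a b c d"
    using a1[of b a c d] by simp
  finally show ?thesis by simp
qed

lemma gradient_normsq:
  "(\<Sum>i\<in>UNIV. gradient G F x $ i * pd i (weyl_plus_normsq G) x)
    = 2 * (\<Sum>a\<in>UNIV. \<Sum>p\<in>UNIV. \<Sum>q\<in>UNIV. dF_frame e x a * (weyl_matrix (Rm_frame e x) p q * weyl_matrix (dRm_frame e x a) p q))"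
proof -
  let ?u = "weyl_plus_normsq G"
  have "(\<Sum>i\<in>UNIV. gradient G F x $ i * pd i ?u x)
      = (\<Sum>i\<in>UNIV. \<Sum>j\<in>UNIV. \<Sum>a\<in>UNIV. (e a $ j * pd j F x) * (e a $ i * pd i ?u x))"
    by (simp add: gradient_def ginv_frame[OF xU on] sum_distrib_left sum_distrib_right mult_ac)
  also have "\<dots> = (\<Sum>a\<in>UNIV. \<Sum>i\<in>UNIV. \<Sum>j\<in>UNIV. (e a $ j * pd j F x) * (e a $ i * pd i ?u x))"
    by (rule trans[OF sum.cong[OF refl sum.swap] sum.swap])
  also have "\<dots> = (\<Sum>a\<in>UNIV. dF_frame e x a * (\<Sum>i\<in>UNIV. e a $ i * pd i ?u x))"
    unfolding dF_frame_eq sum_product by (rule sum.cong[OF refl sum.swap])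
  finally show ?thesis
    unfolding frame_deriv_normsq[OF xU pos] by (simp add: sum_distrib_left mult_ac)
qed

text \<open>
  The equation for the curvature is paired with \<open>W\<^sup>+\<close>: the terms in \<open>\<nabla>f\<close> cancel, and the trace part of
  the quadratic terms is orthogonal to the trace-free \<open>w\<close>.
\<close>

lemma mod_laplacian_normsq:
  "mod_laplacian G F (weyl_plus_normsq G) x = 2 * grad_weyl_plus_normsq G x + 4 * lam * weyl_plus_normsq G x
    - 36 * det_weyl_plus G x - curv_inner G x (kulkarni_nomizu (ricci G x) (ricci G x)) (weyl_plus G x)"
proof -
  define w where "w = weyl_matrix (Rm_frame e x)"
  define z where "z = sd_pairing (curv_reaction (Rm_frame e x))"
  have wp0: "(\<Sum>p\<in>UNIV. w p p) = 0"
    using trace_weyl_matrix[OF Rm_frame_curvature[OF xU, of e] Rm_frame_bianchi1[OF xU, of e]] by (simp add: sum_3 w_def)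
  have 1: "(\<Sum>a\<in>UNIV. weyl_matrix (ddRm_frame e x a a) p q) = (\<Sum>a\<in>UNIV. dF_frame e x a * weyl_matrix (dRm_frame e x a) p q) + 2 * lam * w p q + weyl_matrix (curv_reaction (Rm_frame e x)) p q" for p q
  proof -
    have "(\<Sum>a\<in>UNIV. weyl_matrix (ddRm_frame e x a a) p q) = weyl_matrix (\<lambda>b c d f. \<Sum>a\<in>UNIV. 1 * ddRm_frame e x a a b c d f) p q"
      unfolding weyl_matrix_sum by simp
    also have "\<dots> = weyl_matrix (\<lambda>a b c d. (\<Sum>q\<in>UNIV. dF_frame e x q * dRm_frame e x q a b c d) + 2 * lam * Rm_frame e x a b c d + curv_reaction (Rm_frame e x) a b c d) p q"
      by (simp only: mult_1_left laplacian_curvature)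
    finally show ?thesis by (simp only: weyl_matrix_add weyl_matrix_sum weyl_matrix_cmult w_def)
  qed
  have 2: "(\<Sum>p\<in>UNIV. \<Sum>q\<in>UNIV. w p q * weyl_matrix (curv_reaction (Rm_frame e x)) p q) = (\<Sum>p\<in>UNIV. \<Sum>q\<in>UNIV. w p q * z p q)"
  proof -
    have "w p q * weyl_matrix (curv_reaction (Rm_frame e x)) p q = w p q * z p q - (if p = q then w p p * (Sc (curv_reaction (Rm_frame e x)) / 12) else 0)" for p q
      by (simp add: weyl_matrix_def z_def algebra_simps)
    then have "(\<Sum>p\<in>UNIV. \<Sum>q\<in>UNIV. w p q * weyl_matrix (curv_reaction (Rm_frame e x)) p q)
        = (\<Sum>p\<in>UNIV. \<Sum>q\<in>UNIV. w p q * z p q) - (\<Sum>p\<in>UNIV. w p p) * (Sc (curv_reaction (Rm_frame e x)) / 12)"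
      by (simp add: sum_subtractf sum_distrib_right)
    then show ?thesis by (simp add: wp0)
  qed
  have "(\<Sum>a\<in>UNIV. \<Sum>p\<in>UNIV. \<Sum>q\<in>UNIV. w p q * weyl_matrix (ddRm_frame e x a a) p q)
      = (\<Sum>p\<in>UNIV. \<Sum>q\<in>UNIV. w p q * (\<Sum>a\<in>UNIV. weyl_matrix (ddRm_frame e x a a) p q))"
    unfolding sum_distrib_left by (rule trans[OF sum.swap sum.cong[OF refl sum.swap]])
  also have "\<dots> = (\<Sum>p\<in>UNIV. \<Sum>q\<in>UNIV. \<Sum>a\<in>UNIV. dF_frame e x a * (w p q * weyl_matrix (dRm_frame e x a) p q))
      + 2 * lam * (\<Sum>p\<in>UNIV. \<Sum>q\<in>UNIV. (w p q)\<^sup>2) + (\<Sum>p\<in>UNIV. \<Sum>q\<in>UNIV. w p q * z p q)"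
    unfolding 1 2[symmetric]
    by (simp add: distrib_left sum.distrib sum_distrib_left power2_eq_square mult_ac)
  also have "(\<Sum>p\<in>UNIV. \<Sum>q\<in>UNIV. \<Sum>a\<in>UNIV. dF_frame e x a * (w p q * weyl_matrix (dRm_frame e x a) p q))
      = (\<Sum>a\<in>UNIV. \<Sum>p\<in>UNIV. \<Sum>q\<in>UNIV. dF_frame e x a * (w p q * weyl_matrix (dRm_frame e x a) p q))"
    by (rule trans[OF sum.cong[OF refl sum.swap] sum.swap])
  finally have "mod_laplacian G F (weyl_plus_normsq G) x
      = 2 * grad_weyl_plus_normsq G x + 4 * lam * weyl_plus_normsq G x + 2 * (\<Sum>p\<in>UNIV. \<Sum>q\<in>UNIV. w p q * z p q)"
    unfolding mod_laplacian_def laplacian_normsq gradient_normsq grad_normsq normsq_at w_def by simp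
  moreover have "2 * (\<Sum>p\<in>UNIV. \<Sum>q\<in>UNIV. w p q * z p q)
      = - 36 * det_weyl_plus G x - (\<Sum>p\<in>UNIV. \<Sum>q\<in>UNIV. w p q * sd_pairing (kn_product (Ric (Rm_frame e x)) (Ric (Rm_frame e x))) p q)"
  proof -
    have "det_weyl_plus G x = det (\<chi> p q. w p q)"
      using det_weyl_plus_frame[OF xU pos] Rm_frame_curvature[OF xU] by (simp only: in_frame_riem w_def)
    then show ?thesis
      using cubic_identity[OF Rm_frame_curvature[OF xU, of e] Rm_frame_bianchi1[OF xU, of e]] by (simp only: w_def z_def)
  qed
  moreover have "curv_inner G x (kulkarni_nomizu (ricci G x) (ricci G x)) (weyl_plus G x)
      = (\<Sum>p\<in>UNIV. \<Sum>q\<in>UNIV. w p q * sd_pairing (kn_product (Ric (Rm_frame e x)) (Ric (Rm_frame e x))) p q)"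
  proof -
    have "antisym_pairs (kulkarni_nomizu A B)" for A B
      by (simp add: antisym_pairs_def kulkarni_nomizu_def)
    from curv_inner_weyl_plus[OF xU pos this] show ?thesis
      by (simp only: in_frame_kulkarni_nomizu[abs_def] ricci_frame[OF xU on] w_def)
  qed
  ultimately show ?thesis by simp
qed

text \<open>
  By the soliton equation \<open>Hess f\<close> and \<open>- Rc\<close> differ by a multiple of the metric, and the products of a
  symmetric tensor with the metric are orthogonal to the trace-free \<open>W\<^sup>+\<close>.
\<close>

lemma curv_inner_hess_ricci:
  "curv_inner G x (kulkarni_nomizu (hess G F x) (hess G F x)) (weyl_plus G x)
    = curv_inner G x (kulkarni_nomizu (ricci G x) (ricci G x)) (weyl_plus G x)"
proof -
  define w where "w = weyl_matrix (Rm_frame e x)"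
  define r where "r = Ric (Rm_frame e x)"
  let ?d = "\<lambda>a b :: 4. if a = b then 1 else 0 :: real"
  have wp0: "(\<Sum>p\<in>UNIV. w p p) = 0"
    using trace_weyl_matrix[OF Rm_frame_curvature[OF xU, of e] Rm_frame_bianchi1[OF xU, of e]] by (simp add: sum_3 w_def)
  have anti: "antisym_pairs (kulkarni_nomizu A B)" for A B
    by (simp add: antisym_pairs_def kulkarni_nomizu_def)
  have h: "in_frame2 e (hess G F x) = (\<lambda>a b. lam * ?d a b - r a b)"
    using soliton_frame[OF xU on] by (auto simp: fun_eq_iff hessF_frame_eq[symmetric] r_def algebra_simps)
  have rs: "r a b = r b a" for a b
    using Rm_frame_curvature[OF xU, of e] unfolding r_def Ric_def curvature_like_def by (intro sum.cong) blast+
  have "kn_product (\<lambda>a b. lam * ?d a b - r a b) (\<lambda>a b. lam * ?d a b - r a b) i j k l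
      = kn_product r r i j k l - (2 * lam) * kn_product r ?d i j k l + lam\<^sup>2 * kn_product ?d ?d i j k l" for i j k l
    unfolding kn_product_def by (simp add: algebra_simps power2_eq_square)
  then have "kn_product (\<lambda>a b. lam * ?d a b - r a b) (\<lambda>a b. lam * ?d a b - r a b)
      = (\<lambda>i j k l. kn_product r r i j k l - (2 * lam) * kn_product r ?d i j k l + lam\<^sup>2 * kn_product ?d ?d i j k l)"
    by (intro ext)
  then have "sd_pairing (kn_product (\<lambda>a b. lam * ?d a b - r a b) (\<lambda>a b. lam * ?d a b - r a b)) p q
      = sd_pairing (kn_product r r) p q - (2 * lam) * sd_pairing (kn_product r ?d) p q + lam\<^sup>2 * sd_pairing (kn_product ?d ?d) p q" for p q
    by (simp only: sd_pairing_add sd_pairing_diff sd_pairing_cmult)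
  moreover have "sd_pairing (kn_product r ?d) p q = (if p = q then (\<Sum>a\<in>UNIV. r a a) / 2 else 0)" for p q
    by (rule sd_pairing_kn_product_delta) (rule rs)
  moreover have "sd_pairing (kn_product ?d ?d) p q = (if p = q then 2 else 0)" for p q
    by (subst sd_pairing_kn_product_delta) auto
  ultimately have p: "sd_pairing (kn_product (\<lambda>a b. lam * ?d a b - r a b) (\<lambda>a b. lam * ?d a b - r a b)) p q
      = sd_pairing (kn_product r r) p q + (if p = q then 2 * lam\<^sup>2 - lam * (\<Sum>a\<in>UNIV. r a a) else 0)" for p q
    by simp
  have "w p q * sd_pairing (kn_product (\<lambda>a b. lam * ?d a b - r a b) (\<lambda>a b. lam * ?d a b - r a b)) p q
      = w p q * sd_pairing (kn_product r r) p q + (if p = q then w p p * (2 * lam\<^sup>2 - lam * (\<Sum>a\<in>UNIV. r a a)) else 0)" for p q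
    unfolding p by (simp add: algebra_simps)
  then have "(\<Sum>p\<in>UNIV. \<Sum>q\<in>UNIV. w p q * sd_pairing (kn_product (\<lambda>a b. lam * ?d a b - r a b) (\<lambda>a b. lam * ?d a b - r a b)) p q)
      = (\<Sum>p\<in>UNIV. \<Sum>q\<in>UNIV. w p q * sd_pairing (kn_product r r) p q) + (\<Sum>p\<in>UNIV. w p p) * (2 * lam\<^sup>2 - lam * (\<Sum>a\<in>UNIV. r a a))"
    by (simp add: sum.distrib sum_distrib_right)
  then show ?thesis
    unfolding curv_inner_weyl_plus[OF xU pos anti] in_frame_kulkarni_nomizu[abs_def] ricci_frame[OF xU on] h
    by (simp only: w_def[symmetric] r_def[symmetric] wp0 mult_zero_left add_0_right)
qed

end

section \<open>The equation for the squared norm in a chart\<close>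

theorem theorem1p1:
  fixes \<A> :: "'m::{t2_space,second_countable_topology} chart set"
    and g :: "'m chart \<Rightarrow> real^4 \<Rightarrow> real^4^4"
    and f :: "'m \<Rightarrow> real"
    and lam :: real
    and c :: "'m chart"
    and x :: "real^4"
  assumes "oriented_atlas \<A>"
    and "gradient_ricci_soliton \<A> g f lam"
    and "c \<in> \<A>"
    and "x \<in> chart_image c"
  shows "mod_laplacian (g c) (f \<circ> chart_inv c) (weyl_plus_normsq (g c)) x =
      2 * grad_weyl_plus_normsq (g c) x + 4 * lam * weyl_plus_normsq (g c) x
      - 36 * det_weyl_plus (g c) x
      - curv_inner (g c) x
          (kulkarni_nomizu (ricci (g c) x) (ricci (g c) x))
          (weyl_plus (g c) x)
    \<and>
      mod_laplacian (g c) (f \<circ> chart_inv c) (weyl_plus_normsq (g c)) x =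
      2 * grad_weyl_plus_normsq (g c) x + 4 * lam * weyl_plus_normsq (g c) x
      - 36 * det_weyl_plus (g c) x
      - curv_inner (g c) x
          (kulkarni_nomizu (hess (g c) (f \<circ> chart_inv c) x) (hess (g c) (f \<circ> chart_inv c) x))
          (weyl_plus (g c) x)"
proof -
  have g: "smooth_on (chart_image c) (g c)"
    "\<And>y. y \<in> chart_image c \<Longrightarrow> transpose (g c y) = g c y"
    "\<And>y v. y \<in> chart_image c \<Longrightarrow> v \<noteq> 0 \<Longrightarrow> v \<bullet> (g c y *v v) > 0"
    using assms(2,3) unfolding gradient_ricci_soliton_def riemannian_metric_def by blast+
  interpret soliton "chart_image c" "g c" "f \<circ> chart_inv c" lam
  proof
    show "open (chart_image c)"
      using assms(1,3) unfolding oriented_atlas_def is_chart_def by blast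
    show "g c y $ i $ j = g c y $ j $ i" if "y \<in> chart_image c" for y i j
      using arg_cong[OF g(2)[OF that], of "\<lambda>A. A $ i $ j"] by (simp add: transpose_def)
    show "smooth_on (chart_image c) (f \<circ> chart_inv c)"
      "\<And>y. y \<in> chart_image c \<Longrightarrow> ricci (g c) y + hess (g c) (f \<circ> chart_inv c) y = lam *\<^sub>R g c y"
      using assms(2,3) unfolding gradient_ricci_soliton_def smooth_function_def by blast+
  qed (use g in blast)+
  obtain e where "positive_frame (g c) x e"
    using positive_frame_exists[OF assms(4)] by blast
  then obtain v where "adapted_soliton (chart_image c) (g c) x v (f \<circ> chart_inv c) lam"
    using adapted_soliton_at[OF assms(4)] by blast
  then interpret adapted_soliton "chart_image c" "g c" x v "f \<circ> chart_inv c" lam .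
  show ?thesis
    using mod_laplacian_normsq curv_inner_hess_ricci by simp
qed

end
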